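(* Let $d,n\ge 2$, let $\mathcal D$ be a domain in $Q_0(d,n)$ whose closure $\overline{\mathcal D}$ is a compact subset of $Q_0(d,n)$, and let $\mathfrak P$ be a reduction of $\mathcal V(d,n)$ to a principal $K$-bundle over $\overline{\mathcal D}$. If $\overline{\mathcal D}$ is $\mathbb I_0(d,n)$-convex, then the algebra $\mathbb S(\mathcal D,\mathfrak P;d,n)$ is a rank $n^2$ Azumaya algebra over $\mathbb I(\mathcal D;d,n)$.
   Context: Setting. $G=PGL(n,\mathbb C)$, $K=PU(n,\mathbb C)$, acting on $M_n(\mathbb C)$ by $s\cdot A=sAs^{-1}$ and on $M_n(\mathbb C)^d$ on the right by $\mathfrak z\cdot s=s^{-1}\mathfrak z s=(s^{-1}Z_1s,\dots,s^{-1}Z_ds)$. $\mathcal V(d,n)$ is the set of $\mathfrak z=(Z_1,\dots,Z_d)\in M_n(\mathbb C)^d$ such that $Z_1,\dots,Z_d$ generate the algebra $M_n(\mathbb C)$. $\mathbb I_0(d,n)$ is the algebra of $G$-invariant polynomial functions $M_n(\mathbb C)^d\to\mathbb C$; $p\in\mathbb I_0(d,n)$ is also identified with the matrix-valued function $\mathfrak z\mapsto p(\mathfrak z)I_n$. $\mathbb G_0(d,n)$ is the algebra of functions $M_n(\mathbb C)^d\to M_n(\mathbb C)$ generated by the coordinate functions $\mathcal Z_i(\mathfrak z)=Z_i$, and $\mathbb S_0(d,n)$ (the trace algebra) is the algebra generated by $\mathbb G_0(d,n)$ and $\mathbb I_0(d,n)$; its elements $\phi$ satisfy $\phi(s^{-1}\mathfrak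 z s)=s^{-1}\phi(\mathfrak z)s$. $Q(d,n)$ is the spectrum of the finitely generated algebra $\mathbb I_0(d,n)$, with its analytic topology, $\pi_0:M_n(\mathbb C)^d\to Q(d,n)$ is the surjection dual to the inclusion of $\mathbb I_0(d,n)$ in the polynomial functions, and $Q_0(d,n)=\pi_0(\mathcal V(d,n))$. By a theorem of Procesi (may be assumed), $Q_0(d,n)$ is an open subset of the smooth points of $Q(d,n)$ and $\pi_0:\mathcal V(d,n)\to Q_0(d,n)$ is a holomorphic principal $G$-bundle; write $[\mathfrak z]=\pi_0(\mathfrak z)$. Elements of $\mathbb I_0(d,n)$ are regarded as regular functions on $Q(d,n)$. Convexity. For a compact $X\subseteq Q(d,n)$, its $\mathbb I_0(d,n)$-convex hull is $\widehat X=\{\mathfrak w\in Q(d,n): |f(\mathfrak w)|\le\sup_{x\in X}|f(x)|\text{ for all }f\in\mathbb I_0(d,n)\}$; $X$ is $\mathbb I_0(d,n)$-convex if $X=\widehat X$. Function algebra. $\mathbb I(\mathcal D;d,n)$ is the sup-norm closure of (the restrictions to $\overline{\mathcal D}$ of) $\mathbb I_0(d,n)$ in $C(\overline{\mathcal D})$; it is a function algebra on $\overline{\mathcal D}$, and $\partial\mathcal D\subseteq\overline{\mathcal D}$ is its Shilov boundary. Reductions and bundles. A reduction $\mathfrak P$ of $\mathcal V(d,n)$ to a principal $K$-bundle over $\overline{\mathcal D}$ is the principal $K$-bundle given by a compact $K$-invariant subset $\mathcal P\subseteq\mathcal V(d,n)$ which $\pi_0$ maps onto $\overline{\mathcal D}$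 and for which $\pi_0$ identifies $\mathcal P/K$ with $\overline{\mathcal D}$. $\mathfrak M^*(\mathfrak P;d,n)$ is the associated $M_n(\mathbb C)$-bundle, with total space $\mathcal P\times_K M_n(\mathbb C)$ (quotient of $\mathcal P\times M_n(\mathbb C)$ by $(\mathfrak z,A)\cdot k=(k^{-1}\mathfrak z k,k^{-1}Ak)$) and projection $\pi([\mathfrak z,A])=[\mathfrak z]$; each fibre $\pi^{-1}(\mathfrak u)$ is a $C^*$-algebra isomorphic to $M_n(\mathbb C)$ via $A\mapsto[\mathfrak z,A]$ for any $\mathfrak z\in\mathcal P$ with $\pi_0(\mathfrak z)=\mathfrak u$. $\Gamma_c(\partial\mathcal D,\mathfrak M^*(\mathfrak P;d,n))$ is the $C^*$-algebra of continuous cross sections over $\partial\mathcal D$, with fibrewise operations and the supremum norm. For $\phi\in\mathbb S_0(d,n)$, $\Psi(\phi)$ is the section $\Psi(\phi)([\mathfrak z])=[\mathfrak z,\phi(\mathfrak z)]$, $\mathfrak z\in\mathcal P$. $\mathbb S(\mathcal D,\mathfrak P;d,n)$ (the tracial function algebra) is the norm closure of $\Psi(\mathbb S_0(d,n))$ in $\Gamma_c(\partial\mathcal D,\mathfrak M^*(\mathfrak P;d,n))$. The algebra $\mathbb I(\mathcal D;d,n)$ is identified with a subalgebra of $\mathbb S(\mathcal D,\mathfrak P;d,n)$ by sending $f$ to the section $[\mathfrak z]\mapsto[\mathfrak z,f([\mathfrak z])I_n]$ over $\partial\mathcal D$. Azumaya algebras. A unital algebra $\mathfrak A$ with center $\mathfrak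 Z$ is an Azumaya algebra (over $\mathfrak Z$) if (1) $\mathfrak A$ is projective as a right $\mathfrak Z$-module, and (2) the map $\mathfrak A\otimes_{\mathfrak Z}\mathfrak A^{op}\to End(\mathfrak A_{\mathfrak Z})$ sending $a\otimes b$ to the endomorphism $c\mapsto acb$ is an isomorphism. It has rank $n^2$ over its center if $\mathfrak A/\mathfrak m\cong M_n(\mathbb C)$ for each maximal two-sided ideal $\mathfrak m$ of $\mathfrak A$. *)

theory Defs
  imports "HOL-Analysis.Analysis" "HOL-Algebra.Algebra"
begin

section \<open>Complex algebras\<close>

text \<open>Algebras over a commutative ring \<open>R\<close>, commutative or not, are carried by the record
  \<open>('r, 'a) module\<close>, which contains both a ring structure and a scalar multiplication.
  (The library locale \<open>algebra\<close> is restricted to commutative algebras.)\<close>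

definition unital_algebra :: "('r, 's) ring_scheme \<Rightarrow> ('r, 'a) module \<Rightarrow> bool" where
  "unital_algebra R A \<longleftrightarrow> ring A \<and> module R A \<and>
     (\<forall>r\<in>carrier R. \<forall>x\<in>carrier A. \<forall>y\<in>carrier A.
        (r \<odot>\<^bsub>A\<^esub> x) \<otimes>\<^bsub>A\<^esub> y = r \<odot>\<^bsub>A\<^esub> (x \<otimes>\<^bsub>A\<^esub> y) \<and>
        x \<otimes>\<^bsub>A\<^esub> (r \<odot>\<^bsub>A\<^esub> y) = r \<odot>\<^bsub>A\<^esub> (x \<otimes>\<^bsub>A\<^esub> y))"

definition complex_alg :: "(complex, complex) module" where
  "complex_alg = \<lparr>carrier = UNIV, monoid.mult = (*), one = 1, ring.zero = 0, add = (+), smult = (*)\<rparr>"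

definition alg_hom :: "(complex, 'a) module \<Rightarrow> (complex, 'b) module \<Rightarrow> ('a \<Rightarrow> 'b) set" where
  "alg_hom A B = {h \<in> ring_hom A B. \<forall>c. \<forall>a\<in>carrier A. h (c \<odot>\<^bsub>A\<^esub> a) = c \<odot>\<^bsub>B\<^esub> h a}"

definition alg_iso :: "(complex, 'a) module \<Rightarrow> (complex, 'b) module \<Rightarrow> ('a \<Rightarrow> 'b) set" where
  "alg_iso A B = {h \<in> alg_hom A B. bij_betw h (carrier A) (carrier B)}"

definition unital_subalgebra :: "'a set \<Rightarrow> (complex, 'a) module \<Rightarrow> bool" where
  "unital_subalgebra B A \<longleftrightarrow> B \<subseteq> carrier A \<and> \<one>\<^bsub>A\<^esub> \<in> B \<and>
     (\<forall>x\<in>B. \<forall>y\<in>B. x \<oplus>\<^bsub>A\<^esub> y \<in> B \<and> x \<otimes>\<^bsub>A\<^esub> y \<in> B) \<and>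
     (\<forall>c. \<forall>x\<in>B. c \<odot>\<^bsub>A\<^esub> x \<in> B)"

definition generated_algebra :: "(complex, 'a) module \<Rightarrow> 'a set \<Rightarrow> 'a set" where
  "generated_algebra A S = \<Inter>{B. S \<subseteq> B \<and> unital_subalgebra B A}"

definition fun_alg :: "(complex, 'a) module \<Rightarrow> (complex, 'x \<Rightarrow> 'a) module" where
  "fun_alg A = \<lparr>carrier = {f. range f \<subseteq> carrier A},
     monoid.mult = (\<lambda>f g x. f x \<otimes>\<^bsub>A\<^esub> g x), one = (\<lambda>x. \<one>\<^bsub>A\<^esub>),
     ring.zero = (\<lambda>x. \<zero>\<^bsub>A\<^esub>), add = (\<lambda>f g x. f x \<oplus>\<^bsub>A\<^esub> g x),
     smult = (\<lambda>c f x. c \<odot>\<^bsub>A\<^esub> f x)\<rparr>"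

definition quotient_algebra :: "('r, 'a) module \<Rightarrow> 'a set \<Rightarrow> ('r, 'a set) module" where
  "quotient_algebra A m = \<lparr>carrier = carrier (A Quot m), monoid.mult = monoid.mult (A Quot m),
     one = \<one>\<^bsub>A Quot m\<^esub>, ring.zero = \<zero>\<^bsub>A Quot m\<^esub>, add = add (A Quot m),
     smult = (\<lambda>c Y. \<Union>x\<in>Y. m +>\<^bsub>A\<^esub> (c \<odot>\<^bsub>A\<^esub> x))\<rparr>"

text \<open>On \<open>complex^'n^'n\<close> the class operation \<open>*\<close> is the entrywise product; matrix
  multiplication is \<open>**\<close>.\<close>

definition cscale :: "complex \<Rightarrow> complex^'n^'n \<Rightarrow> complex^'n^'n" where
  "cscale c A = (\<chi> i j. c * A $ i $ j)"

definition mat_alg :: "(complex, complex^'n^'n) module" where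
  "mat_alg = \<lparr>carrier = UNIV, monoid.mult = (**), one = mat 1, ring.zero = 0, add = (+),
     smult = cscale\<rparr>"


section \<open>Azumaya algebras\<close>

subsection \<open>Projective modules and endomorphisms\<close>

definition module_homs :: "('r, 's) ring_scheme \<Rightarrow> ('r, 'a) module \<Rightarrow> ('r, 'b) module \<Rightarrow> ('a \<Rightarrow> 'b) set" where
  "module_homs R M N = {h \<in> carrier M \<rightarrow> carrier N.
     (\<forall>x\<in>carrier M. \<forall>y\<in>carrier M. h (x \<oplus>\<^bsub>M\<^esub> y) = h x \<oplus>\<^bsub>N\<^esub> h y) \<and>
     (\<forall>r\<in>carrier R. \<forall>x\<in>carrier M. h (r \<odot>\<^bsub>M\<^esub> x) = r \<odot>\<^bsub>N\<^esub> h x)}"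

text \<open>The free module on the basis \<open>I\<close>: finitely supported families in \<open>R\<close>. The
  multiplicative fields of the record play no role in a module.\<close>

definition free_module :: "('r, 's) ring_scheme \<Rightarrow> 'i set \<Rightarrow> ('r, 'i \<Rightarrow> 'r) module" where
  "free_module R I = \<lparr>carrier = {f. (\<forall>i\<in>I. f i \<in> carrier R) \<and> (\<forall>i. i \<notin> I \<longrightarrow> f i = \<zero>\<^bsub>R\<^esub>) \<and>
                                    finite {i. f i \<noteq> \<zero>\<^bsub>R\<^esub>}},
     monoid.mult = undefined, one = undefined,
     ring.zero = (\<lambda>i. \<zero>\<^bsub>R\<^esub>), add = (\<lambda>f g i. f i \<oplus>\<^bsub>R\<^esub> g i), smult = (\<lambda>r f i. r \<otimes>\<^bsub>R\<^esub> f i)\<rparr>"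

text \<open>A module is projective if it is a direct summand of a free module. Taking the basis inside
  the type of \<open>M\<close> is no restriction: \<open>M\<close> is a direct summand of some free module iff it
  is one of the free module on the set \<open>carrier M\<close>, which surjects onto \<open>M\<close>.\<close>

definition projective_module :: "('r, 's) ring_scheme \<Rightarrow> ('r, 'a) module \<Rightarrow> bool" where
  "projective_module R M \<longleftrightarrow> module R M \<and>
     (\<exists>I :: 'a set. \<exists>\<iota> \<in> module_homs R M (free_module R I). \<exists>\<rho> \<in> module_homs R (free_module R I) M.
        \<forall>x\<in>carrier M. \<rho> (\<iota> x) = x)"

definition module_End :: "('r, 's) ring_scheme \<Rightarrow> ('r, 'a) module \<Rightarrow> ('a \<Rightarrow> 'a) ring" where
  "module_End R M = \<lparr>carrier = module_homs R M M \<inter> extensional (carrier M),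
     monoid.mult = compose (carrier M), one = (\<lambda>x\<in>carrier M. x),
     ring.zero = (\<lambda>x\<in>carrier M. \<zero>\<^bsub>M\<^esub>), add = (\<lambda>f g. \<lambda>x\<in>carrier M. f x \<oplus>\<^bsub>M\<^esub> g x)\<rparr>"

subsection \<open>Tensor products of algebras\<close>

text \<open>\<open>A \<otimes>\<^sub>R B\<close> is the quotient of the free abelian group on \<open>A \<times> B\<close>, with the
  multiplication extending \<open>(a, b) (a', b') = (aa', bb')\<close> biadditively, by the subgroup
  generated by the usual relations; for \<open>R\<close>-algebras this subgroup is a two-sided ideal.\<close>

definition pretensor_ring :: "('r, 'a) module \<Rightarrow> ('r, 'b) module \<Rightarrow> (('a \<times> 'b) \<Rightarrow>\<^sub>0 int) ring" where
  "pretensor_ring A B = \<lparr>carrier = {x. Poly_Mapping.keys x \<subseteq> carrier A \<times> carrier B},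
     monoid.mult = (\<lambda>x y. frag_extend (\<lambda>(a, b). frag_extend (\<lambda>(a', b').
                       frag_of (a \<otimes>\<^bsub>A\<^esub> a', b \<otimes>\<^bsub>B\<^esub> b')) y) x),
     one = frag_of (\<one>\<^bsub>A\<^esub>, \<one>\<^bsub>B\<^esub>), ring.zero = 0, add = (+)\<rparr>"

definition tensor_relations ::
  "('r, 's) ring_scheme \<Rightarrow> ('r, 'a) module \<Rightarrow> ('r, 'b) module \<Rightarrow> (('a \<times> 'b) \<Rightarrow>\<^sub>0 int) set" where
  "tensor_relations R A B =
     {frag_of (a \<oplus>\<^bsub>A\<^esub> a', b) - frag_of (a, b) - frag_of (a', b) |a a' b.
        a \<in> carrier A \<and> a' \<in> carrier A \<and> b \<in> carrier B} \<union>
     {frag_of (a, b \<oplus>\<^bsub>B\<^esub> b') - frag_of (a, b) - frag_of (a, b') |a b b'.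
        a \<in> carrier A \<and> b \<in> carrier B \<and> b' \<in> carrier B} \<union>
     {frag_of (r \<odot>\<^bsub>A\<^esub> a, b) - frag_of (a, r \<odot>\<^bsub>B\<^esub> b) |r a b.
        r \<in> carrier R \<and> a \<in> carrier A \<and> b \<in> carrier B}"

definition tensor_kernel ::
  "('r, 's) ring_scheme \<Rightarrow> ('r, 'a) module \<Rightarrow> ('r, 'b) module \<Rightarrow> (('a \<times> 'b) \<Rightarrow>\<^sub>0 int) set" where
  "tensor_kernel R A B = generate (add_monoid (pretensor_ring A B)) (tensor_relations R A B)"

definition tensor_ring ::
  "('r, 's) ring_scheme \<Rightarrow> ('r, 'a) module \<Rightarrow> ('r, 'b) module \<Rightarrow> (('a \<times> 'b) \<Rightarrow>\<^sub>0 int) set ring" where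
  "tensor_ring R A B = pretensor_ring A B Quot tensor_kernel R A B"

definition pure_tensor ::
  "('r, 's) ring_scheme \<Rightarrow> ('r, 'a) module \<Rightarrow> ('r, 'b) module \<Rightarrow> 'a \<Rightarrow> 'b \<Rightarrow> (('a \<times> 'b) \<Rightarrow>\<^sub>0 int) set" where
  "pure_tensor R A B a b = tensor_kernel R A B +>\<^bsub>pretensor_ring A B\<^esub> frag_of (a, b)"

subsection \<open>The Azumaya property\<close>

definition centre :: "('r, 'a) module \<Rightarrow> 'a set" where
  "centre A = {z \<in> carrier A. \<forall>a\<in>carrier A. z \<otimes>\<^bsub>A\<^esub> a = a \<otimes>\<^bsub>A\<^esub> z}"

definition centre_alg :: "('r, 'a) module \<Rightarrow> ('r, 'a) module" where
  "centre_alg A = A\<lparr>carrier := centre A\<rparr>"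

text \<open>\<open>A\<close> as an algebra over its centre; the scalar multiplication is that of the right module
  \<open>A\<^sub>Z\<close>, written on the left as the library's modules require (the centre is
  commutative).\<close>

definition over_centre :: "('r, 'a) module \<Rightarrow> ('a, 'a) module" where
  "over_centre A = \<lparr>carrier = carrier A, monoid.mult = monoid.mult A, one = \<one>\<^bsub>A\<^esub>,
     ring.zero = \<zero>\<^bsub>A\<^esub>, add = add A, smult = (\<lambda>z a. a \<otimes>\<^bsub>A\<^esub> z)\<rparr>"

definition opposite_alg :: "('r, 'a) module \<Rightarrow> ('r, 'a) module" where
  "opposite_alg A = A\<lparr>monoid.mult := (\<lambda>a b. b \<otimes>\<^bsub>A\<^esub> a)\<rparr>"

definition azumaya :: "(complex, 'a) module \<Rightarrow> bool" where
  "azumaya A \<longleftrightarrow> unital_algebra complex_alg A \<and>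
     projective_module (centre_alg A) (over_centre A) \<and>
     (\<exists>h \<in> ring_iso (tensor_ring (centre_alg A) (over_centre A) (opposite_alg (over_centre A)))
                    (module_End (centre_alg A) (over_centre A)).
        \<forall>a\<in>carrier A. \<forall>b\<in>carrier A.
          h (pure_tensor (centre_alg A) (over_centre A) (opposite_alg (over_centre A)) a b)
            = (\<lambda>c\<in>carrier A. a \<otimes>\<^bsub>A\<^esub> c \<otimes>\<^bsub>A\<^esub> b))"

text \<open>Rank \<open>n\<^sup>2\<close> over the centre, where \<open>n = CARD('n)\<close>. The locale \<open>maximalideal\<close>
  is about two-sided ideals.\<close>

definition azumaya_rank_sq :: "'n::finite itself \<Rightarrow> (complex, 'a) module \<Rightarrow> bool" where
  "azumaya_rank_sq _ A \<longleftrightarrow> azumaya A \<and>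
     (\<forall>m. maximalideal m A \<longrightarrow> alg_iso (quotient_algebra A m) (mat_alg :: (complex, complex^'n^'n) module) \<noteq> {})"


section \<open>Invariants and the quotient variety\<close>

text \<open>\<open>PGL(n)\<close> and \<open>PU(n)\<close> act through representatives in \<open>GL(n)\<close> and \<open>U(n)\<close>;
  \<open>conj_mat s A = s\<^sup>-\<^sup>1 A s\<close> is unchanged if \<open>s\<close> is multiplied by a scalar.\<close>

type_synonym ('n, 'd) tuple = "complex^'n^'n^'d"

definition conj_mat :: "complex^'n^'n \<Rightarrow> complex^'n^'n \<Rightarrow> complex^'n^'n" where
  "conj_mat s A = matrix_inv s ** A ** s"

definition conj_tuple :: "complex^'n^'n \<Rightarrow> ('n::finite, 'd::finite) tuple \<Rightarrow> ('n, 'd) tuple" where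
  "conj_tuple s z = (\<chi> k. conj_mat s (z $ k))"

definition conj_transpose :: "complex^'n^'n \<Rightarrow> complex^'n^'n" where
  "conj_transpose A = (\<chi> i j. cnj (A $ j $ i))"

definition unitary_group :: "(complex^'n^'n) set" where
  "unitary_group = {U. conj_transpose U ** U = mat 1 \<and> U ** conj_transpose U = mat 1}"

definition generating_tuples :: "('n::finite, 'd::finite) tuple set" where
  "generating_tuples = {z. generated_algebra mat_alg (range (\<lambda>k. z $ k)) = UNIV}"

definition polynomial_functions :: "(('n::finite, 'd::finite) tuple \<Rightarrow> complex) set" where
  "polynomial_functions = generated_algebra (fun_alg complex_alg) {(\<lambda>z. z $ k $ i $ j) |k i j. True}"

definition I0 :: "(('n::finite, 'd::finite) tuple \<Rightarrow> complex) set" where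
  "I0 = {p \<in> polynomial_functions. \<forall>s z. invertible s \<longrightarrow> p (conj_tuple s z) = p z}"

definition I0_alg :: "(complex, ('n::finite, 'd::finite) tuple \<Rightarrow> complex) module" where
  "I0_alg = (fun_alg complex_alg)\<lparr>carrier := I0\<rparr>"

text \<open>A point of the spectrum \<open>Q(d,n)\<close> of the finitely generated algebra \<open>I0\<close> is a complex
  point, i.e. a unital \<open>\<complex>\<close>-algebra homomorphism \<open>I0 \<rightarrow> \<complex>\<close>; the regular function given
  by \<open>f \<in> I0\<close> takes the value \<open>w f\<close> at the point \<open>w\<close>. The analytic topology, induced by
  an embedding \<open>w \<mapsto> (w f\<^sub>1, \<dots>, w f\<^sub>m)\<close> into affine space for generators
  \<open>f\<^sub>1, \<dots>, f\<^sub>m\<close>, is the topology of pointwise convergence on \<open>I0\<close>, because every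
  \<open>w f\<close> is a polynomial in the \<open>w f\<^sub>i\<close>.\<close>

type_synonym ('n, 'd) qpoint = "(('n, 'd) tuple \<Rightarrow> complex) \<Rightarrow> complex"

definition Q :: "('n::finite, 'd::finite) qpoint set" where
  "Q = alg_hom I0_alg complex_alg \<inter> extensional I0"

definition Qtop :: "('n::finite, 'd::finite) qpoint topology" where
  "Qtop = subtopology (product_topology (\<lambda>_. euclidean) I0) Q"

definition \<pi>0 :: "('n::finite, 'd::finite) tuple \<Rightarrow> ('n, 'd) qpoint" where
  "\<pi>0 z = (\<lambda>p\<in>I0. p z)"

definition Q0 :: "('n::finite, 'd::finite) qpoint set" where
  "Q0 = \<pi>0 ` generating_tuples"

definition domain_in_Q0 :: "('n::finite, 'd::finite) qpoint set \<Rightarrow> bool" where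
  "domain_in_Q0 D \<longleftrightarrow> D \<noteq> {} \<and> openin (subtopology Qtop Q0) D \<and> connectedin Qtop D"

definition I0_hull :: "('n::finite, 'd::finite) qpoint set \<Rightarrow> ('n, 'd) qpoint set" where
  "I0_hull Y = {w \<in> Q. \<forall>f\<in>I0. cmod (w f) \<le> (SUP x\<in>Y. cmod (x f))}"

definition I0_convex :: "('n::finite, 'd::finite) qpoint set \<Rightarrow> bool" where
  "I0_convex Y \<longleftrightarrow> I0_hull Y = Y"


section \<open>The function algebra and its Shilov boundary\<close>

definition clos :: "('n::finite, 'd::finite) qpoint set \<Rightarrow> ('n, 'd) qpoint set" where
  "clos D = Qtop closure_of D"

text \<open>A function on \<open>clos D\<close> is represented by its extension by \<open>undefined\<close>.\<close>

definition I_carrier :: "('n::finite, 'd::finite) qpoint set \<Rightarrow> (('n, 'd) qpoint \<Rightarrow> complex) set" where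
  "I_carrier D = {f \<in> extensional (clos D).
     continuous_map (subtopology Qtop (clos D)) euclidean f \<and>
     (\<forall>\<epsilon>>0. \<exists>p\<in>I0. \<forall>u\<in>clos D. cmod (f u - u p) \<le> \<epsilon>)}"

definition I_alg :: "('n::finite, 'd::finite) qpoint set \<Rightarrow> (complex, ('n, 'd) qpoint \<Rightarrow> complex) module" where
  "I_alg D = \<lparr>carrier = I_carrier D,
     monoid.mult = (\<lambda>f g. \<lambda>u\<in>clos D. f u * g u), one = (\<lambda>u\<in>clos D. 1),
     ring.zero = (\<lambda>u\<in>clos D. 0), add = (\<lambda>f g. \<lambda>u\<in>clos D. f u + g u),
     smult = (\<lambda>c f. \<lambda>u\<in>clos D. c * f u)\<rparr>"

text \<open>A (closed) boundary for a set \<open>F\<close> of functions on a compact space is a closed subset on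
  which every \<open>\<bar>f\<bar>\<close> attains its maximum. The Shilov boundary is the smallest one; by Shilov's
  theorem this is the intersection of all of them.\<close>

definition boundary_for :: "'x topology \<Rightarrow> ('x \<Rightarrow> complex) set \<Rightarrow> 'x set \<Rightarrow> bool" where
  "boundary_for T F E \<longleftrightarrow> closedin T E \<and>
     (\<forall>f\<in>F. \<exists>y\<in>E. \<forall>x\<in>topspace T. cmod (f x) \<le> cmod (f y))"

definition shilov_boundary :: "'x topology \<Rightarrow> ('x \<Rightarrow> complex) set \<Rightarrow> 'x set" where
  "shilov_boundary T F = \<Inter>{E. boundary_for T F E}"

definition bdry :: "('n::finite, 'd::finite) qpoint set \<Rightarrow> ('n, 'd) qpoint set" where
  "bdry D = shilov_boundary (subtopology Qtop (clos D)) (I_carrier D)"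


section \<open>Reductions and the associated matrix bundle\<close>

text \<open>The last two conditions say that \<open>\<pi>0\<close> induces a homeomorphism of the orbit space
  \<open>P/K\<close> onto \<open>Y\<close>.\<close>

definition reduction :: "('n::finite, 'd::finite) tuple set \<Rightarrow> ('n, 'd) qpoint set \<Rightarrow> bool" where
  "reduction P Y \<longleftrightarrow> compact P \<and> P \<subseteq> generating_tuples \<and>
     (\<forall>z\<in>P. \<forall>k\<in>unitary_group. conj_tuple k z \<in> P) \<and>
     quotient_map (top_of_set P) (subtopology Qtop Y) \<pi>0 \<and>
     (\<forall>z\<in>P. \<forall>w\<in>P. \<pi>0 z = \<pi>0 w \<longleftrightarrow> (\<exists>k\<in>unitary_group. w = conj_tuple k z))"

definition quotient_topology :: "'a topology \<Rightarrow> ('a \<Rightarrow> 'b) \<Rightarrow> 'b topology" where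
  "quotient_topology T q =
     topology (\<lambda>U. U \<subseteq> q ` topspace T \<and> openin T {x \<in> topspace T. q x \<in> U})"

lemma openin_quotient_topology:
  "openin (quotient_topology T q) U \<longleftrightarrow>
     U \<subseteq> q ` topspace T \<and> openin T {x \<in> topspace T. q x \<in> U}"
proof -
  have "istopology (\<lambda>U. U \<subseteq> q ` topspace T \<and> openin T {x \<in> topspace T. q x \<in> U})"
    unfolding istopology_def
  proof (intro conjI allI impI; (elim conjE)?)
    fix S S'
    assume "openin T {x \<in> topspace T. q x \<in> S}" "openin T {x \<in> topspace T. q x \<in> S'}"
    then have "openin T ({x \<in> topspace T. q x \<in> S} \<inter> {x \<in> topspace T. q x \<in> S'})" by blast
    then show "openin T {x \<in> topspace T. q x \<in> S \<inter> S'}"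
      by (rule back_subst[of "openin T"]) auto
  next
    fix \<K> assume *: "\<forall>K\<in>\<K>. K \<subseteq> q ` topspace T \<and> openin T {x \<in> topspace T. q x \<in> K}"
    then show "\<Union>\<K> \<subseteq> q ` topspace T" by blast
    have "openin T (\<Union>K\<in>\<K>. {x \<in> topspace T. q x \<in> K})" using * by blast
    then show "openin T {x \<in> topspace T. q x \<in> \<Union>\<K>}"
      by (rule back_subst[of "openin T"]) auto
  qed auto
  then show ?thesis by (simp add: quotient_topology_def topology_inverse')
qed

text \<open>\<open>bundle_point z A\<close> is \<open>[z, A]\<close>, the \<open>K\<close>-orbit of \<open>(z, A)\<close>.\<close>

type_synonym ('n, 'd) bpoint = "(('n, 'd) tuple \<times> (complex^'n^'n)) set"

definition bundle_point :: "('n::finite, 'd::finite) tuple \<Rightarrow> complex^'n^'n \<Rightarrow> ('n, 'd) bpoint" where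
  "bundle_point z A = (\<lambda>k. (conj_tuple k z, conj_mat k A)) ` unitary_group"

definition bundle_top :: "('n::finite, 'd::finite) tuple set \<Rightarrow> ('n, 'd) bpoint topology" where
  "bundle_top P = quotient_topology (top_of_set (P \<times> UNIV)) (\<lambda>(z, A). bundle_point z A)"

definition bundle_proj :: "('n::finite, 'd::finite) bpoint \<Rightarrow> ('n, 'd) qpoint" where
  "bundle_proj e = the_elem ((\<lambda>(z, A). \<pi>0 z) ` e)"

text \<open>For \<open>z\<close> generating \<open>M\<^sub>n(\<complex>)\<close> only scalars commute with \<open>z\<close>, so a point of the
  bundle contains exactly one pair \<open>(z, A)\<close> over each \<open>z \<in> P\<close> in its fibre. Hence, for
  instance, \<open>fibre_op2 (**) [z, A] [z, B] = [z, A ** B]\<close>. The norm of \<open>[z, A]\<close> is the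
  operator norm of \<open>A\<close> on the Hilbert space \<open>\<complex>\<^sup>n\<close>.\<close>

definition fibre_op1 :: "(complex^'n^'n \<Rightarrow> complex^'n^'n) \<Rightarrow> ('n::finite, 'd::finite) bpoint \<Rightarrow> ('n, 'd) bpoint" where
  "fibre_op1 g e = {(z, g A) |z A. (z, A) \<in> e}"

definition fibre_op2 :: "(complex^'n^'n \<Rightarrow> complex^'n^'n \<Rightarrow> complex^'n^'n) \<Rightarrow>
    ('n::finite, 'd::finite) bpoint \<Rightarrow> ('n, 'd) bpoint \<Rightarrow> ('n, 'd) bpoint" where
  "fibre_op2 g e e' = {(z, g A B) |z A B. (z, A) \<in> e \<and> (z, B) \<in> e'}"

definition fibre_norm :: "('n::finite, 'd::finite) bpoint \<Rightarrow> real" where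
  "fibre_norm e = the_elem ((\<lambda>(z, A). onorm (\<lambda>v. A *v v)) ` e)"

definition sections :: "('n::finite, 'd::finite) tuple set \<Rightarrow> ('n, 'd) qpoint set \<Rightarrow>
    (('n, 'd) qpoint \<Rightarrow> ('n, 'd) bpoint) set" where
  "sections P B = {\<sigma> \<in> extensional B. continuous_map (subtopology Qtop B) (bundle_top P) \<sigma> \<and>
     (\<forall>u\<in>B. bundle_proj (\<sigma> u) = u)}"

text \<open>The section \<open>[z] \<mapsto> [z, F z]\<close>, \<open>z \<in> P\<close>, of a function \<open>F\<close> that is equivariant on
  \<open>P\<close>; by equivariance the choice of \<open>z\<close> over \<open>u\<close> does not matter.\<close>

definition section_of :: "('n::finite, 'd::finite) tuple set \<Rightarrow> ('n, 'd) qpoint set \<Rightarrow>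
    (('n, 'd) tuple \<Rightarrow> complex^'n^'n) \<Rightarrow> ('n, 'd) qpoint \<Rightarrow> ('n, 'd) bpoint" where
  "section_of P B F = (\<lambda>u\<in>B. let z = (SOME z. z \<in> P \<and> \<pi>0 z = u) in bundle_point z (F z))"

definition section_alg :: "('n::finite, 'd::finite) tuple set \<Rightarrow> ('n, 'd) qpoint set \<Rightarrow>
    (complex, ('n, 'd) qpoint \<Rightarrow> ('n, 'd) bpoint) module" where
  "section_alg P B = \<lparr>carrier = sections P B,
     monoid.mult = (\<lambda>\<sigma> \<tau>. \<lambda>u\<in>B. fibre_op2 (**) (\<sigma> u) (\<tau> u)),
     one = section_of P B (\<lambda>_. mat 1), ring.zero = section_of P B (\<lambda>_. 0),
     add = (\<lambda>\<sigma> \<tau>. \<lambda>u\<in>B. fibre_op2 (+) (\<sigma> u) (\<tau> u)),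
     smult = (\<lambda>c \<sigma>. \<lambda>u\<in>B. fibre_op1 (cscale c) (\<sigma> u))\<rparr>"


section \<open>Trace algebra and tracial function algebra\<close>

definition G0 :: "(('n::finite, 'd::finite) tuple \<Rightarrow> complex^'n^'n) set" where
  "G0 = generated_algebra (fun_alg mat_alg) (range (\<lambda>k z. z $ k))"

definition S0 :: "(('n::finite, 'd::finite) tuple \<Rightarrow> complex^'n^'n) set" where
  "S0 = generated_algebra (fun_alg mat_alg) (G0 \<union> {(\<lambda>z. cscale (p z) (mat 1)) |p. p \<in> I0})"

text \<open>The carrier is the closure of \<open>\<Psi>(S0)\<close> in the sections over the Shilov boundary for
  the supremum over \<open>bdry D\<close> of the fibre norms.\<close>

definition S_alg :: "('n::finite, 'd::finite) qpoint set \<Rightarrow> ('n, 'd) tuple set \<Rightarrow>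
    (complex, ('n, 'd) qpoint \<Rightarrow> ('n, 'd) bpoint) module" where
  "S_alg D P = (section_alg P (bdry D))\<lparr>carrier :=
     {\<sigma> \<in> sections P (bdry D). \<forall>\<epsilon>>0. \<exists>\<phi>\<in>S0. \<forall>u\<in>bdry D.
        fibre_norm (fibre_op2 (-) (\<sigma> u) (section_of P (bdry D) \<phi> u)) \<le> \<epsilon>}\<rparr>"

definition I_to_S :: "('n::finite, 'd::finite) qpoint set \<Rightarrow> ('n, 'd) tuple set \<Rightarrow>
    (('n, 'd) qpoint \<Rightarrow> complex) \<Rightarrow> ('n, 'd) qpoint \<Rightarrow> ('n, 'd) bpoint" where
  "I_to_S D P f = section_of P (bdry D) (\<lambda>z. cscale (f (\<pi>0 z)) (mat 1))"

end

theory Submission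
  imports Defs "HOL-Library.Function_Algebras"
begin

text \<open>
The algebra \<open>S_alg D P\<close> is Azumaya because it contains elements \<open>x\<^sub>k\<close>, \<open>y\<^sub>k\<close> that behave like two bases of a matrix
algebra that are dual for the trace form: \<open>\<Sum>\<^sub>k x\<^sub>k a y\<^sub>k = tr a\<close> is central and \<open>a = \<Sum>\<^sub>k tr (y\<^sub>k a) x\<^sub>k\<close>. For any
algebra with such a Casimir family, projectivity over the centre and the isomorphism of \<open>A \<otimes> A\<^sup>o\<^sup>p\<close> with the
endomorphism ring are formal consequences (locale \<open>casimir_algebra\<close>).

At a generating tuple \<open>z\<^sub>0\<close> there are elements of \<open>G0\<close> whose values are the matrix units. Cramer's rule for
their Gram matrix, whose entries are traces and hence invariant polynomials, gives \<open>x\<^sub>k\<close>, \<open>y\<^sub>k\<close> in the trace algebra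
that are dual up to an invariant polynomial \<open>q\<close> with \<open>q z\<^sub>0 \<noteq> 0\<close> (\<open>local_dual_family\<close>). The functions \<open>f\<close> for which
there is a family dual up to \<open>f\<close> form an ideal of the algebra of uniform limits of invariant polynomials on \<open>P\<close>.
It has no common zero, so it contains 1 (\<open>global_dual_family\<close>).

The last step is a Nullstellensatz (\<open>I0_limits_nullstellensatz\<close>): a proper ideal of the uniform closure of
\<open>I0\<close> has a common zero. The quotient by a maximal ideal is \<open>\<complex>\<close> by the Gelfand--Mazur theorem, so the ideal yields a
character of \<open>I0\<close> bounded by the supremum norm over \<open>clos D\<close>, and convexity says that this is a point of \<open>clos D\<close>.

The elements of \<open>S_alg D P\<close> are sections over the Shilov boundary only. Shilov's theorem
(\<open>shilov_boundary_attains\<close>) makes it a boundary, so by the maximum principle the coefficients \<open>tr (y\<^sub>k a)\<close> of such a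
section extend to all of \<open>P\<close>, and \<open>S_alg D P\<close> becomes the algebra \<open>S0_limits P\<close> of uniform limits on \<open>P\<close> of the trace
algebra (\<open>carrier_S_alg\<close>). Its centre consists of the scalar functions and so is the function algebra of \<open>D\<close>. The scalar
functions in a maximal ideal have a common zero \<open>z\<close> by the Nullstellensatz, so by the expansion above the ideal is the kernel of
the evaluation at \<open>z\<close>, which maps onto the full matrix algebra (\<open>maximal_ideal_evaluation\<close>).
\<close>

section \<open>A criterion for Azumaya algebras\<close>

context
  fixes A :: "('r, 'a) module" and B :: "('r, 'b) module"
begin

abbreviation "PT \<equiv> pretensor_ring A B"

lemma pretensor_mult_diff_left:
  "(x - x') \<otimes>\<^bsub>PT\<^esub> y = x \<otimes>\<^bsub>PT\<^esub> y - x' \<otimes>\<^bsub>PT\<^esub> y"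
  by (simp add: pretensor_ring_def frag_extend_diff)

lemma pretensor_mult_diff_right:
  "x \<otimes>\<^bsub>PT\<^esub> (y - y') = x \<otimes>\<^bsub>PT\<^esub> y - x \<otimes>\<^bsub>PT\<^esub> y'"
  by (rule frag_induction[of x UNIV])
    (auto simp: pretensor_mult_diff_left, auto simp: pretensor_ring_def frag_extend_diff)

lemma pretensor_mult_of:
  "frag_of (a, b) \<otimes>\<^bsub>PT\<^esub> frag_of (a', b') = frag_of (a \<otimes>\<^bsub>A\<^esub> a', b \<otimes>\<^bsub>B\<^esub> b')"
  by (simp add: pretensor_ring_def)

lemma pretensor_mult_zero [simp]:
  "0 \<otimes>\<^bsub>PT\<^esub> y = 0" "y \<otimes>\<^bsub>PT\<^esub> 0 = 0"
  using pretensor_mult_diff_left[of 0 0 y] pretensor_mult_diff_right[of y 0 0] by simp_all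

lemma pretensor_simps [simp]:
  "carrier (PT) = {x. Poly_Mapping.keys x \<subseteq> carrier A \<times> carrier B}"
  "x \<oplus>\<^bsub>PT\<^esub> y = x + y" "\<zero>\<^bsub>PT\<^esub> = 0"
  "\<one>\<^bsub>PT\<^esub> = frag_of (\<one>\<^bsub>A\<^esub>, \<one>\<^bsub>B\<^esub>)"
  by (simp_all add: pretensor_ring_def)

lemma pretensor_induct [consumes 1, case_names zero diff of]:
  assumes "x \<in> carrier (PT)"
    and "R 0"
    and "\<And>x y. x \<in> carrier (PT) \<Longrightarrow> y \<in> carrier (PT) \<Longrightarrow> R x \<Longrightarrow> R y \<Longrightarrow> R (x - y)"
    and "\<And>a b. a \<in> carrier A \<Longrightarrow> b \<in> carrier B \<Longrightarrow> R (frag_of (a, b))"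
  shows "R x"
  by (rule free_Abelian_group_induct[of x "carrier A \<times> carrier B"]) (use assms in auto)

lemma pretensor_diff_closed:
  assumes "x \<in> carrier (PT)" "y \<in> carrier (PT)"
  shows "x - y \<in> carrier (PT)"
  using assms keys_diff[of x y] by auto

context
  assumes ring_A: "ring A" and ring_B: "ring B"
begin

interpretation A: ring A by (rule ring_A)
interpretation B: ring B by (rule ring_B)

lemma pretensor_mult_closed:
  assumes x: "x \<in> carrier (PT)" and y: "y \<in> carrier (PT)"
  shows "x \<otimes>\<^bsub>PT\<^esub> y \<in> carrier (PT)"
  using x
proof (induction rule: pretensor_induct)
  case (diff x x')
  then show ?case by (metis pretensor_diff_closed pretensor_mult_diff_left)
next
  case (of a b)
  show ?case using y
  proof (induction rule: pretensor_induct)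
    case (diff x x')
    then show ?case by (metis pretensor_diff_closed pretensor_mult_diff_right)
  qed (use of in \<open>auto simp: pretensor_mult_of\<close>)
qed auto

lemma pretensor_mult_assoc:
  assumes x: "x \<in> carrier (PT)" and y: "y \<in> carrier (PT)"
    and z: "z \<in> carrier (PT)"
  shows "x \<otimes>\<^bsub>PT\<^esub> y \<otimes>\<^bsub>PT\<^esub> z
    = x \<otimes>\<^bsub>PT\<^esub> (y \<otimes>\<^bsub>PT\<^esub> z)"
proof -
  show ?thesis using x
  proof (induction rule: pretensor_induct)
    case (of a b)
    show ?case using y
    proof (induction rule: pretensor_induct)
      case (of a' b')
      show ?case using z
        by (induction rule: pretensor_induct)
          (use of \<open>a \<in> carrier A\<close> \<open>b \<in> carrier B\<close> in \<open>auto simp: pretensor_mult_of pretensor_mult_diff_right A.m_assoc B.m_assoc\<close>)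
    qed (auto simp: pretensor_mult_diff_right pretensor_mult_diff_left)
  qed (auto simp: pretensor_mult_diff_left)
qed

lemma ring_pretensor: "ring PT"
proof -
  have add: "x + y \<in> carrier (PT)"
    if "x \<in> carrier (PT)" "y \<in> carrier (PT)" for x y
    using that keys_add[of x y] by auto
  have addl: "(x + y) \<otimes>\<^bsub>PT\<^esub> z = x \<otimes>\<^bsub>PT\<^esub> z + y \<otimes>\<^bsub>PT\<^esub> z" for x y z
    by (simp add: pretensor_ring_def frag_extend_add)
  have addr: "z \<otimes>\<^bsub>PT\<^esub> (x + y) = z \<otimes>\<^bsub>PT\<^esub> x + z \<otimes>\<^bsub>PT\<^esub> y" for x y z
    using pretensor_mult_diff_right[of z "x + y" y] by (simp add: algebra_simps)
  have unit_l: "\<one>\<^bsub>PT\<^esub> \<otimes>\<^bsub>PT\<^esub> x = x"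
   and unit_r: "x \<otimes>\<^bsub>PT\<^esub> \<one>\<^bsub>PT\<^esub> = x" if "x \<in> carrier (PT)" for x
    using that by (induction rule: pretensor_induct) (auto simp: pretensor_mult_diff_right pretensor_mult_diff_left pretensor_mult_of)
  show ?thesis
  proof (intro ringI abelian_groupI monoidI)
    fix x assume "x \<in> carrier (PT)"
    then show "\<exists>y\<in>carrier (PT). y \<oplus>\<^bsub>PT\<^esub> x = \<zero>\<^bsub>PT\<^esub>"
      by (intro bexI[of _ "-x"]) auto
  next
    fix x y assume "x \<in> carrier (PT)" "y \<in> carrier (PT)"
    then show "x \<oplus>\<^bsub>PT\<^esub> y \<in> carrier (PT)"
      using add by simp
    show "x \<oplus>\<^bsub>PT\<^esub> y = y \<oplus>\<^bsub>PT\<^esub> x"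
      by (simp add: add.commute)
  next
    fix x y z assume "x \<in> carrier (PT)" "y \<in> carrier (PT)" "z \<in> carrier (PT)"
    then show "x \<otimes>\<^bsub>PT\<^esub> y \<otimes>\<^bsub>PT\<^esub> z
        = x \<otimes>\<^bsub>PT\<^esub> (y \<otimes>\<^bsub>PT\<^esub> z)"
      by (rule pretensor_mult_assoc)
  next
    fix x assume "x \<in> carrier (PT)"
    then show "\<one>\<^bsub>PT\<^esub> \<otimes>\<^bsub>PT\<^esub> x = x"
      and "x \<otimes>\<^bsub>PT\<^esub> \<one>\<^bsub>PT\<^esub> = x"
      by (rule unit_l, rule unit_r)
  next
    fix x y assume "x \<in> carrier (PT)" "y \<in> carrier (PT)"
    then show "x \<otimes>\<^bsub>PT\<^esub> y \<in> carrier (PT)"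
      by (rule pretensor_mult_closed)
  qed (simp_all add: addl addr add.assoc)
qed

end

end

lemma tensor_kernel_closed:
  assumes "ring A" "ring B" "module R A" "module R B"
  shows "tensor_relations R A B \<subseteq> carrier (pretensor_ring A B)"
    "tensor_kernel R A B \<subseteq> carrier (pretensor_ring A B)"
    "0 \<in> tensor_kernel R A B"
    "x \<in> tensor_relations R A B \<Longrightarrow> x \<in> tensor_kernel R A B"
    "x \<in> tensor_kernel R A B \<Longrightarrow> y \<in> tensor_kernel R A B \<Longrightarrow> x + y \<in> tensor_kernel R A B"
    "x \<in> tensor_kernel R A B \<Longrightarrow> y \<in> tensor_kernel R A B \<Longrightarrow> x - y \<in> tensor_kernel R A B"
proof -
  interpret A: ring A by fact
  interpret B: ring B by fact
  interpret MA: module R A by fact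
  interpret MB: module R B by fact
  interpret T: ring "pretensor_ring A B" using ring_pretensor[OF assms(1,2)] .
  show rel: "tensor_relations R A B \<subseteq> carrier (pretensor_ring A B)"
  proof
    fix x assume "x \<in> tensor_relations R A B"
    then consider 
       (1) a a' b where "x = frag_of (a \<oplus>\<^bsub>A\<^esub> a', b) - frag_of (a, b) - frag_of (a', b)" "a \<in> carrier A" "a' \<in> carrier A" "b \<in> carrier B"
     | (2) a b b' where "x = frag_of (a, b \<oplus>\<^bsub>B\<^esub> b') - frag_of (a, b) - frag_of (a, b')" "a \<in> carrier A" "b \<in> carrier B" "b' \<in> carrier B"
     | (3) r a b where "x = frag_of (r \<odot>\<^bsub>A\<^esub> a, b) - frag_of (a, r \<odot>\<^bsub>B\<^esub> b)" "r \<in> carrier R" "a \<in> carrier A" "b \<in> carrier B"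
      unfolding tensor_relations_def by blast
    then show "x \<in> carrier (pretensor_ring A B)"
    proof cases
      case 1
      show ?thesis unfolding 1(1) by (intro pretensor_diff_closed) (use 1 in auto)
    next
      case 2
      show ?thesis unfolding 2(1) by (intro pretensor_diff_closed) (use 2 in auto)
    next
      case 3
      show ?thesis unfolding 3(1) by (intro pretensor_diff_closed) (use 3 in auto)
    qed
  qed
  show "tensor_kernel R A B \<subseteq> carrier (pretensor_ring A B)"
    unfolding tensor_kernel_def using T.add.generate_incl[of "tensor_relations R A B"] rel by simp
  have sub: "subgroup (tensor_kernel R A B) (add_monoid (pretensor_ring A B))"
    unfolding tensor_kernel_def by (rule T.add.generate_is_subgroup) (use rel in simp)
  show "0 \<in> tensor_kernel R A B"
    using subgroup.one_closed[OF sub] by simp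
  show "x \<in> tensor_kernel R A B" if "x \<in> tensor_relations R A B"
    using that unfolding tensor_kernel_def by (rule generate.incl)
  show plus: "x + y \<in> tensor_kernel R A B" if "x \<in> tensor_kernel R A B" "y \<in> tensor_kernel R A B" for x y
    using subgroup.m_closed[OF sub that] by simp
  have neg: "-y \<in> tensor_kernel R A B" if "y \<in> tensor_kernel R A B"
  proof -
    have yc: "y \<in> carrier (pretensor_ring A B)" using that subgroup.subset[OF sub] by auto
    have "inv\<^bsub>add_monoid (pretensor_ring A B)\<^esub> y = -y"
      by (rule group.inv_equality[OF T.a_group]) (use yc in auto)
    then show ?thesis using subgroup.m_inv_closed[OF sub that] by simp
  qed
  show "x - y \<in> tensor_kernel R A B" if "x \<in> tensor_kernel R A B" "y \<in> tensor_kernel R A B"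
    using plus[OF that(1) neg[OF that(2)]] by simp
qed

lemma ring_module_End:
  assumes "module R M"
  shows "ring (module_End R M)"
proof -
  interpret module R M by fact
  have ext: "f = g" if "f \<in> extensional (carrier M)" "g \<in> extensional (carrier M)" "\<And>x. x \<in> carrier M \<Longrightarrow> f x = g x" for f g
    using that by (rule extensionalityI)
  have cl: "f x \<in> carrier M" if "f \<in> module_homs R M M" "x \<in> carrier M" for f x
    using that by (auto simp: module_homs_def)
  show ?thesis
  proof (intro ringI abelian_groupI monoidI)
    fix f assume f: "f \<in> carrier (module_End R M)"
    show "\<exists>g\<in>carrier (module_End R M). g \<oplus>\<^bsub>module_End R M\<^esub> f = \<zero>\<^bsub>module_End R M\<^esub>"
      by (intro bexI[of _ "\<lambda>x\<in>carrier M. \<ominus>\<^bsub>M\<^esub> f x"])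
        (use f in \<open>auto simp: module_End_def module_homs_def Pi_def M.l_neg M.minus_add smult_r_minus fun_eq_iff restrict_def extensional_def\<close>)
  qed (auto simp: module_End_def module_homs_def Pi_def compose_def fun_eq_iff restrict_def M.a_ac smult_r_distr smult_assoc1[symmetric] R.m_comm extensional_def)
qed

text \<open>A Casimir family: elements \<open>x\<^sub>k\<close>, \<open>y\<^sub>k\<close> such that \<open>tr a = \<Sum>\<^sub>k x\<^sub>k a y\<^sub>k\<close> is central and
  \<open>a = \<Sum>\<^sub>k tr (y\<^sub>k a) x\<^sub>k\<close> for all \<open>a\<close>. In a matrix algebra any two bases that are dual for the trace form are
  one, with the matrix trace as \<open>tr\<close>. The existence of such a family makes \<open>A\<close> an Azumaya algebra:
  the \<open>x\<^sub>k\<close> with the coordinates \<open>a \<mapsto> tr (y\<^sub>k a)\<close> are a dual basis, a \<open>Z\<close>-linear \<open>g\<close> is the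
  action of \<open>\<Sum>\<^sub>k\<^sub>l g(x\<^sub>k) x\<^sub>l y\<^sub>k \<otimes> y\<^sub>l\<close>, and an element of the tensor product can be recovered from its action.\<close>

locale casimir_algebra =
  fixes A :: "(complex, 'a) module" (structure) and I :: "'i set" and x y :: "'i \<Rightarrow> 'a"
  assumes unital_algebra: "unital_algebra complex_alg A"
    and fin: "finite I"
    and x_closed: "k \<in> I \<Longrightarrow> x k \<in> carrier A"
    and y_closed: "k \<in> I \<Longrightarrow> y k \<in> carrier A"
    and casimir_central: "a \<in> carrier A \<Longrightarrow> (\<Oplus>k\<in>I. x k \<otimes> a \<otimes> y k) \<in> centre A"
    and casimir_expansion:
      "a \<in> carrier A \<Longrightarrow> (\<Oplus>k\<in>I. (\<Oplus>l\<in>I. x l \<otimes> (y k \<otimes> a) \<otimes> y l) \<otimes> x k) = a"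
begin

sublocale ring A
  using unital_algebra by (simp add: unital_algebra_def)

text \<open>The generalised trace of the Casimir family.\<close>

definition tr :: "'a \<Rightarrow> 'a" where
  "tr a = (\<Oplus>l\<in>I. x l \<otimes> a \<otimes> y l)"

abbreviation "Z \<equiv> centre_alg A"
abbreviation "M \<equiv> over_centre A"
abbreviation "Op \<equiv> opposite_alg (over_centre A)"
abbreviation "K \<equiv> tensor_kernel Z M Op"
abbreviation "F \<equiv> pretensor_ring M Op"

lemma centre_simps [simp]:
  "carrier Z = centre A" "\<zero>\<^bsub>Z\<^esub> = \<zero>" "\<one>\<^bsub>Z\<^esub> = \<one>" "a \<oplus>\<^bsub>Z\<^esub> b = a \<oplus> b" "a \<otimes>\<^bsub>Z\<^esub> b = a \<otimes> b"
  by (simp_all add: centre_alg_def)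

lemma M_simps [simp]:
  "carrier M = carrier A" "\<zero>\<^bsub>M\<^esub> = \<zero>" "\<one>\<^bsub>M\<^esub> = \<one>" "a \<oplus>\<^bsub>M\<^esub> b = a \<oplus> b" "a \<otimes>\<^bsub>M\<^esub> b = a \<otimes> b"
  "z \<odot>\<^bsub>M\<^esub> a = a \<otimes> z"
  by (simp_all add: over_centre_def)

lemma Op_simps [simp]:
  "carrier Op = carrier A" "\<zero>\<^bsub>Op\<^esub> = \<zero>" "\<one>\<^bsub>Op\<^esub> = \<one>" "a \<oplus>\<^bsub>Op\<^esub> b = a \<oplus> b" "a \<otimes>\<^bsub>Op\<^esub> b = b \<otimes> a"
  "z \<odot>\<^bsub>Op\<^esub> a = a \<otimes> z"
  by (simp_all add: opposite_alg_def over_centre_def)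

lemma centreD: "z \<in> centre A \<Longrightarrow> z \<in> carrier A" "z \<in> centre A \<Longrightarrow> a \<in> carrier A \<Longrightarrow> z \<otimes> a = a \<otimes> z"
  by (simp_all add: centre_def)

lemma tr_central: "a \<in> carrier A \<Longrightarrow> tr a \<in> centre A"
  by (simp add: tr_def casimir_central)

lemma tr_closed [simp]: "a \<in> carrier A \<Longrightarrow> tr a \<in> carrier A"
  using tr_central centreD by blast

lemma tr_add: assumes "a \<in> carrier A" "b \<in> carrier A" shows "tr (a \<oplus> b) = tr a \<oplus> tr b"
proof -
  have "tr (a \<oplus> b) = (\<Oplus>l\<in>I. x l \<otimes> a \<otimes> y l \<oplus> x l \<otimes> b \<otimes> y l)"
    unfolding tr_def using x_closed y_closed assms
    by (intro finsum_cong') (auto simp: l_distr r_distr)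
  also have "\<dots> = tr a \<oplus> tr b"
    unfolding tr_def using x_closed y_closed assms by (intro finsum_addf) auto
  finally show ?thesis .
qed

lemma tr_mult_centre:
  assumes "a \<in> carrier A" "z \<in> centre A" shows "tr (a \<otimes> z) = tr a \<otimes> z"
proof -
  have "x l \<otimes> (a \<otimes> z) \<otimes> y l = (x l \<otimes> a \<otimes> y l) \<otimes> z" if "l \<in> I" for l
    using that assms x_closed y_closed centreD(1)[OF assms(2)] centreD(2)[OF assms(2), of "y l"]
    by (simp add: m_assoc)
  then show ?thesis
    using x_closed y_closed fin assms centreD(1)[OF assms(2)] unfolding tr_def
    by (subst finsum_ldistr) (auto intro!: finsum_cong')
qed

lemma tr_expansion: "a \<in> carrier A \<Longrightarrow> (\<Oplus>k\<in>I. tr (y k \<otimes> a) \<otimes> x k) = a"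
  by (simp add: tr_def casimir_expansion)

lemma cring_Z: "cring Z"
proof -
  have "subring (centre A) A"
  proof (rule subringI)
    fix h assume h: "h \<in> centre A"
    show "\<ominus> h \<in> centre A"
      using h by (auto simp: centre_def l_minus r_minus)
  next
    fix h k assume h: "h \<in> centre A" and k: "k \<in> centre A"
    have "h \<otimes> k \<otimes> a = a \<otimes> (h \<otimes> k)" if a: "a \<in> carrier A" for a
    proof -
      have "h \<otimes> k \<otimes> a = h \<otimes> a \<otimes> k"
        using h k a centreD(2)[OF k a] by (simp add: centreD(1) m_assoc)
      also have "\<dots> = a \<otimes> (h \<otimes> k)"
        using h k a centreD(2)[OF h a] by (simp add: centreD(1) m_assoc)
      finally show ?thesis .
    qed
    moreover have "h \<otimes> k \<in> carrier A"
      using h k centreD(1) by simp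
    ultimately show "h \<otimes> k \<in> centre A"
      unfolding centre_def by blast
  next
    fix h k assume h: "h \<in> centre A" and k: "k \<in> centre A"
    have "(h \<oplus> k) \<otimes> a = a \<otimes> (h \<oplus> k)" if a: "a \<in> carrier A" for a
      using h k a centreD(2)[OF h a] centreD(2)[OF k a] by (simp add: centreD(1) l_distr r_distr)
    moreover have "h \<oplus> k \<in> carrier A"
      using h k centreD(1) by simp
    ultimately show "h \<oplus> k \<in> centre A"
      unfolding centre_def by blast
  qed (auto simp: centre_def)
  then have "subcring (centre A) A"
    by (rule subcringI) (use centreD in blast)
  then show ?thesis
    unfolding centre_alg_def using subcring_iff[of "centre A"] centreD(1) by blast
qed

lemma module_M: "module Z M"
proof -
  interpret Z: cring Z by (rule cring_Z)
  show ?thesis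
  proof (intro moduleI abelian_groupI)
    fix a assume "a \<in> carrier M"
    then show "\<exists>b\<in>carrier M. b \<oplus>\<^bsub>M\<^esub> a = \<zero>\<^bsub>M\<^esub>"
      by (intro bexI[of _ "\<ominus> a"]) (auto simp: l_neg)
  qed (use centreD in \<open>auto simp: a_ac l_distr r_distr m_assoc Z.is_cring\<close>)
qed

lemma ring_M: "ring M"
proof (intro ringI monoidI)
  show "abelian_group M"
    using module_M by (simp add: module_def)
qed (simp_all add: l_distr r_distr m_assoc)

lemma module_Op: "module Z Op"
  using module_M unfolding module_def module_axioms_def abelian_group_def abelian_monoid_def abelian_group_axioms_def
  by (simp add: opposite_alg_def over_centre_def)

lemma ring_Op: "ring Op"
proof (intro ringI monoidI)
  show "abelian_group Op"
    using module_Op by (simp add: module_def)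
qed (simp_all add: l_distr r_distr m_assoc)

lemma projective: "projective_module Z M"
proof -
  interpret Z: cring Z by (rule cring_Z)
  \<comment> \<open>The basis of the free module is a set of elements of \<open>A\<close>, so coordinates of coinciding \<open>x\<^sub>k\<close> are added up.\<close>
  let ?J = "x ` I"
  define \<iota> where "\<iota> a = (\<lambda>e. if e \<in> ?J then (\<Oplus>k\<in>{k\<in>I. x k = e}. tr (y k \<otimes> a)) else \<zero>)" for a
  define \<rho> where "\<rho> f = (\<Oplus>e\<in>?J. f e \<otimes> e)" for f
  have sum_centre: "(\<Oplus>k\<in>S. g k) \<in> centre A" if "finite S" "\<And>k. k \<in> S \<Longrightarrow> g k \<in> centre A" for S :: "'i set" and g
    using that
  proof (induction S rule: finite_induct)
    case (insert k S)
    then have "(\<Oplus>k\<in>insert k S. g k) = g k \<oplus> (\<Oplus>k\<in>S. g k)"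
      using centreD by (subst finsum_insert) auto
    with insert Z.a_closed show ?case by simp
  qed (use Z.zero_closed in simp)
  have \<iota>: "\<iota> a e \<in> centre A" if "a \<in> carrier A" for a e
    unfolding \<iota>_def using that fin y_closed Z.zero_closed by (auto intro!: sum_centre tr_central)
  have fs: "finite {e. \<iota> a e \<noteq> \<zero>}" for a
    by (rule finite_subset[of _ ?J]) (use fin in \<open>auto simp: \<iota>_def\<close>)
  have \<iota>_hom: "\<iota> \<in> module_homs Z M (free_module Z ?J)"
    unfolding module_homs_def
  proof (intro CollectI conjI ballI funcsetI)
    fix a assume "a \<in> carrier M"
    then show "\<iota> a \<in> carrier (free_module Z ?J)"
      using \<iota>[of a] fs[of a] by (simp add: free_module_def) (simp add: \<iota>_def)
  next
    fix a b assume ab: "a \<in> carrier M" "b \<in> carrier M"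
    have "(\<Oplus>k\<in>{k\<in>I. x k = e}. tr (y k \<otimes> (a \<oplus> b)))
        = (\<Oplus>k\<in>{k\<in>I. x k = e}. tr (y k \<otimes> a) \<oplus> tr (y k \<otimes> b))" for e
      using y_closed ab by (intro finsum_cong') (auto simp: r_distr tr_add)
    moreover have "(\<Oplus>k\<in>{k\<in>I. x k = e}. tr (y k \<otimes> a) \<oplus> tr (y k \<otimes> b))
        = (\<Oplus>k\<in>{k\<in>I. x k = e}. tr (y k \<otimes> a)) \<oplus> (\<Oplus>k\<in>{k\<in>I. x k = e}. tr (y k \<otimes> b))" for e
      using y_closed ab by (intro finsum_addf) auto
    ultimately show "\<iota> (a \<oplus>\<^bsub>M\<^esub> b) = \<iota> a \<oplus>\<^bsub>free_module Z ?J\<^esub> \<iota> b"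
      by (simp add: free_module_def \<iota>_def fun_eq_iff)
  next
    fix z a assume z: "z \<in> carrier Z" and a: "a \<in> carrier M"
    have "tr (y k \<otimes> (a \<otimes> z)) = tr (y k \<otimes> a) \<otimes> z" if "k \<in> I" for k
      using that z a y_closed centreD(1)[of z] tr_mult_centre[of "y k \<otimes> a" z] by (simp add: m_assoc)
    then have "(\<Oplus>k\<in>{k\<in>I. x k = e}. tr (y k \<otimes> (a \<otimes> z))) = (\<Oplus>k\<in>{k\<in>I. x k = e}. tr (y k \<otimes> a)) \<otimes> z" for e
      using fin z a y_closed centreD(1)[of z] by (subst finsum_ldistr) (auto intro!: finsum_cong')
    then have "\<iota> (a \<otimes> z) e = z \<otimes> \<iota> a e" for e
      using centreD(2)[of z "\<iota> a e"] centreD(1)[OF \<iota>[of a e]] z a centreD(1)[of z]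
      by (simp add: \<iota>_def)
    then show "\<iota> (z \<odot>\<^bsub>M\<^esub> a) = z \<odot>\<^bsub>free_module Z ?J\<^esub> \<iota> a"
      by (simp add: free_module_def fun_eq_iff)
  qed
  have \<rho>_hom: "\<rho> \<in> module_homs Z (free_module Z ?J) M"
    unfolding module_homs_def
  proof (intro CollectI conjI ballI funcsetI)
    fix f assume "f \<in> carrier (free_module Z ?J)"
    then show "\<rho> f \<in> carrier M"
      using centreD(1) x_closed by (auto simp: \<rho>_def free_module_def intro!: finsum_closed)
  next
    fix f g assume "f \<in> carrier (free_module Z ?J)" "g \<in> carrier (free_module Z ?J)"
    then have fg: "\<forall>e\<in>?J. f e \<in> carrier A" "\<forall>e\<in>?J. g e \<in> carrier A"
      using centreD(1) by (auto simp: free_module_def)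
    have "\<rho> (f \<oplus>\<^bsub>free_module Z ?J\<^esub> g) = (\<Oplus>e\<in>?J. f e \<otimes> e \<oplus> g e \<otimes> e)"
      unfolding \<rho>_def using fg x_closed by (intro finsum_cong') (auto simp: free_module_def l_distr)
    also have "\<dots> = \<rho> f \<oplus> \<rho> g"
      unfolding \<rho>_def using fg x_closed by (intro finsum_addf) auto
    finally show "\<rho> (f \<oplus>\<^bsub>free_module Z ?J\<^esub> g) = \<rho> f \<oplus>\<^bsub>M\<^esub> \<rho> g"
      by simp
  next
    fix z f assume z: "z \<in> carrier Z" and "f \<in> carrier (free_module Z ?J)"
    then have f: "\<forall>e\<in>?J. f e \<in> carrier A"
      using centreD(1) by (auto simp: free_module_def)
    have "z \<otimes> f e \<otimes> e = f e \<otimes> e \<otimes> z" if "e \<in> ?J" for e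
    proof -
      have "e \<in> carrier A" "f e \<in> carrier A" using that f x_closed by auto
      then show ?thesis using z centreD(1)[of z] centreD(2)[of z "f e \<otimes> e"] by (simp add: m_assoc)
    qed
    then show "\<rho> (z \<odot>\<^bsub>free_module Z ?J\<^esub> f) = z \<odot>\<^bsub>M\<^esub> \<rho> f"
      using z f fin x_closed centreD(1)[of z] unfolding \<rho>_def M_simps
      by (subst finsum_ldistr) (auto simp: free_module_def intro!: finsum_cong')
  qed
  have "\<rho> (\<iota> a) = a" if a: "a \<in> carrier A" for a
  proof -
    let ?c = "\<lambda>k. tr (y k \<otimes> a) \<otimes> x k"
    have "\<rho> (\<iota> a) = (\<Oplus>e\<in>?J. \<Oplus>k\<in>{k\<in>I. x k = e}. ?c k)"
      unfolding \<rho>_def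
    proof (rule finsum_cong')
      fix e assume e: "e \<in> ?J"
      have "\<iota> a e \<otimes> e = (\<Oplus>k\<in>{k\<in>I. x k = e}. tr (y k \<otimes> a) \<otimes> e)"
        using e fin a y_closed x_closed unfolding \<iota>_def by (simp, subst finsum_ldistr) auto
      also have "\<dots> = (\<Oplus>k\<in>{k\<in>I. x k = e}. ?c k)"
        using a y_closed x_closed by (intro finsum_cong') auto
      finally show "\<iota> a e \<otimes> e = \<dots>" .
    qed (use a x_closed y_closed in \<open>auto intro!: finsum_closed\<close>)
    also have "\<dots> = (\<Oplus>k\<in>(\<Union>e\<in>?J. {k\<in>I. x k = e}). ?c k)"
      by (rule add.finprod_UN_disjoint[symmetric])
        (use fin a x_closed y_closed in \<open>auto simp: pairwise_def disjnt_def\<close>)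
    also have "(\<Union>e\<in>?J. {k\<in>I. x k = e}) = I" by auto
    finally show "\<rho> (\<iota> a) = a"
      using tr_expansion[OF a] by simp
  qed
  then show ?thesis
    using module_M \<iota>_hom \<rho>_hom unfolding projective_module_def M_simps by blast
qed


lemmas K_closed = tensor_kernel_closed[OF ring_M ring_Op module_M module_Op]

lemma K_sum: "finite S \<Longrightarrow> (\<And>k. k \<in> S \<Longrightarrow> f k \<in> K) \<Longrightarrow> (\<Sum>k\<in>S. f k) \<in> K"
  by (induction S rule: finite_induct) (auto intro: K_closed)

lemma K_add_left:
  assumes "a \<in> carrier A" "a' \<in> carrier A" "b \<in> carrier A"
  shows "frag_of (a \<oplus> a', b) - frag_of (a, b) - frag_of (a', b) \<in> K"
proof -
  have "frag_of (a \<oplus> a', b) - frag_of (a, b) - frag_of (a', b) \<in> tensor_relations Z M Op"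
    unfolding tensor_relations_def M_simps Op_simps using assms by blast
  then show ?thesis by (rule K_closed(4))
qed

lemma K_add_right:
  assumes "a \<in> carrier A" "b \<in> carrier A" "b' \<in> carrier A"
  shows "frag_of (a, b \<oplus> b') - frag_of (a, b) - frag_of (a, b') \<in> K"
proof -
  have "frag_of (a, b \<oplus> b') - frag_of (a, b) - frag_of (a, b') \<in> tensor_relations Z M Op"
    unfolding tensor_relations_def M_simps Op_simps using assms by blast
  then show ?thesis by (rule K_closed(4))
qed

lemma K_smult:
  assumes "a \<in> carrier A" "b \<in> carrier A" "z \<in> centre A"
  shows "frag_of (a \<otimes> z, b) - frag_of (a, b \<otimes> z) \<in> K"
proof -
  have "frag_of (a \<otimes> z, b) - frag_of (a, b \<otimes> z) \<in> tensor_relations Z M Op"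
    unfolding tensor_relations_def M_simps Op_simps centre_simps using assms by blast
  then show ?thesis by (rule K_closed(4))
qed

lemma K_zero_left: "b \<in> carrier A \<Longrightarrow> frag_of (\<zero>, b) \<in> K"
  using K_closed(6)[OF K_closed(3) K_add_left[of \<zero> \<zero> b]] by simp

lemma K_zero_right: "a \<in> carrier A \<Longrightarrow> frag_of (a, \<zero>) \<in> K"
  using K_closed(6)[OF K_closed(3) K_add_right[of a \<zero> \<zero>]] by simp

lemma K_minus_left:
  assumes "a \<in> carrier A" "a' \<in> carrier A" "b \<in> carrier A"
  shows "frag_of (a, b) - frag_of (a', b) - frag_of (a \<ominus> a', b) \<in> K"
proof -
  have "a \<ominus> a' \<oplus> a' = a" using assms by algebra
  then show ?thesis
    using K_add_left[of "a \<ominus> a'" a' b] assms by (simp add: diff_diff_eq add.commute)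
qed

lemma K_finsum_right:
  assumes "finite S" "a \<in> carrier A" "\<And>k. k \<in> S \<Longrightarrow> f k \<in> carrier A"
  shows "frag_of (a, \<Oplus>k\<in>S. f k) - (\<Sum>k\<in>S. frag_of (a, f k)) \<in> K"
  using assms(1,3)
proof (induction S rule: finite_induct)
  case (insert k S)
  then have 1: "frag_of (a, f k \<oplus> (\<Oplus>k\<in>S. f k)) - frag_of (a, f k) - frag_of (a, \<Oplus>k\<in>S. f k) \<in> K"
    by (intro K_add_right assms(2) finsum_closed) auto
  have 2: "frag_of (a, \<Oplus>k\<in>S. f k) - (\<Sum>k\<in>S. frag_of (a, f k)) \<in> K"
    using insert by auto
  have "(\<Oplus>k\<in>insert k S. f k) = f k \<oplus> (\<Oplus>k\<in>S. f k)"
    using insert by (intro finsum_insert) auto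
  then show ?case
    using K_closed(5)[OF 1 2] insert.hyps by (simp add: diff_diff_eq)
qed (use K_zero_right assms(2) in simp)

text \<open>The action of \<open>\<Sum> a \<otimes> b\<close> on \<open>c\<close> by \<open>\<Sum> a c b\<close>, defined on formal sums of pairs by the universal
  property of the free abelian group.\<close>

definition act :: "(('a \<times> 'a) \<Rightarrow>\<^sub>0 int) \<Rightarrow> ('a \<Rightarrow> 'a)" where
  "act = (SOME h. h \<in> hom (free_Abelian_group (carrier A \<times> carrier A)) (add_monoid (module_End Z M)) \<and>
     (\<forall>a\<in>carrier A. \<forall>b\<in>carrier A. h (frag_of (a, b)) = (\<lambda>c\<in>carrier A. a \<otimes> c \<otimes> b)))"

lemma ring_E: "ring (module_End Z M)"
  by (rule ring_module_End[OF module_M])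

lemma two_sided_mult_End:
  assumes a: "a \<in> carrier A" and b: "b \<in> carrier A"
  shows "(\<lambda>c\<in>carrier A. a \<otimes> c \<otimes> b) \<in> carrier (module_End Z M)"
proof -
  have "a \<otimes> (c \<otimes> z) \<otimes> b = a \<otimes> c \<otimes> b \<otimes> z" if "z \<in> centre A" "c \<in> carrier A" for z c
    using that a b centreD(1)[of z] centreD(2)[of z b] by (simp add: m_assoc)
  then show ?thesis
    using a b by (auto simp: module_End_def module_homs_def l_distr r_distr centreD(1))
qed

lemma act_hom: "act \<in> hom (free_Abelian_group (carrier A \<times> carrier A)) (add_monoid (module_End Z M))"
  and act_of: "a \<in> carrier A \<Longrightarrow> b \<in> carrier A \<Longrightarrow> act (frag_of (a, b)) = (\<lambda>c\<in>carrier A. a \<otimes> c \<otimes> b)"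
proof -
  interpret E: ring "module_End Z M" by (rule ring_E)
  have "(\<lambda>(a, b). \<lambda>c\<in>carrier A. a \<otimes> c \<otimes> b) ` (carrier A \<times> carrier A) \<subseteq> carrier (add_monoid (module_End Z M))"
    using two_sided_mult_End by auto
  from comm_group.free_Abelian_group_universal[OF E.a_comm_group this]
  obtain h where "h \<in> hom (free_Abelian_group (carrier A \<times> carrier A)) (add_monoid (module_End Z M))"
    "\<And>t. t \<in> carrier A \<times> carrier A \<Longrightarrow> h (frag_of t) = (case t of (a, b) \<Rightarrow> \<lambda>c\<in>carrier A. a \<otimes> c \<otimes> b)"
    by blast
  then have "\<exists>h. h \<in> hom (free_Abelian_group (carrier A \<times> carrier A)) (add_monoid (module_End Z M)) \<and>
     (\<forall>a\<in>carrier A. \<forall>b\<in>carrier A. h (frag_of (a, b)) = (\<lambda>c\<in>carrier A. a \<otimes> c \<otimes> b))"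
    by (intro exI[of _ h]) auto
  from someI_ex[OF this]
  show "act \<in> hom (free_Abelian_group (carrier A \<times> carrier A)) (add_monoid (module_End Z M))"
    and "a \<in> carrier A \<Longrightarrow> b \<in> carrier A \<Longrightarrow> act (frag_of (a, b)) = (\<lambda>c\<in>carrier A. a \<otimes> c \<otimes> b)"
    unfolding act_def by auto
qed

lemma act_End: "t \<in> carrier F \<Longrightarrow> act t \<in> carrier (module_End Z M)"
  using act_hom by (auto simp: hom_def Pi_def)

lemma End_D:
  assumes "g \<in> carrier (module_End Z M)"
  shows "c \<in> carrier A \<Longrightarrow> g c \<in> carrier A"
    "c \<in> carrier A \<Longrightarrow> c' \<in> carrier A \<Longrightarrow> g (c \<oplus> c') = g c \<oplus> g c'"
    "c \<in> carrier A \<Longrightarrow> z \<in> centre A \<Longrightarrow> g (c \<otimes> z) = g c \<otimes> z"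
    "g \<in> extensional (carrier A)"
  using assms by (auto simp: module_End_def module_homs_def)

lemma End_finsum:
  assumes g: "g \<in> carrier (module_End Z M)" and S: "finite S" and f: "\<And>k. k \<in> S \<Longrightarrow> f k \<in> carrier A"
  shows "g (\<Oplus>k\<in>S. f k) = (\<Oplus>k\<in>S. g (f k))"
  using S f
proof (induction S rule: finite_induct)
  case empty
  have "g \<zero> \<oplus> g \<zero> = g \<zero>" using End_D(2)[OF g, of \<zero> \<zero>] by simp
  then have "g \<zero> = \<zero>" using End_D(1)[OF g, of \<zero>] by (metis local.add.l_cancel_one' zero_closed)
  then show ?case by simp
next
  case (insert k S)
  have 1: "(\<Oplus>k\<in>insert k S. f k) = f k \<oplus> (\<Oplus>k\<in>S. f k)"
    using insert by (intro finsum_insert) auto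
  have 2: "(\<Oplus>k\<in>insert k S. g (f k)) = g (f k) \<oplus> (\<Oplus>k\<in>S. g (f k))"
    using insert End_D(1)[OF g] by (intro finsum_insert) auto
  have "(\<Oplus>k\<in>S. f k) \<in> carrier A" using insert by (intro finsum_closed) auto
  then show ?case
    unfolding 1 2 using insert End_D(2)[OF g] by auto
qed

lemma act_closed [simp]: "t \<in> carrier F \<Longrightarrow> c \<in> carrier A \<Longrightarrow> act t c \<in> carrier A"
  using End_D(1)[OF act_End] .

lemma act_add:
  assumes "t \<in> carrier F" "t' \<in> carrier F"
  shows "act (t + t') = act t \<oplus>\<^bsub>module_End Z M\<^esub> act t'"
  using act_hom assms by (auto simp: hom_def)

lemma act_diff:
  assumes t: "t \<in> carrier F" "t' \<in> carrier F" and c: "c \<in> carrier A"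
  shows "act (t - t') c = act t c \<ominus> act t' c"
proof -
  have d: "t - t' \<in> carrier F" using t by (rule pretensor_diff_closed)
  have "act t = act (t - t') \<oplus>\<^bsub>module_End Z M\<^esub> act t'"
    using act_add[OF d t(2)] by simp
  then have "act t c = act (t - t') c \<oplus> act t' c"
    using c by (simp add: module_End_def)
  then show ?thesis
    using d t c by (simp add: minus_eq a_assoc r_neg)
qed

lemma act_zero: "c \<in> carrier A \<Longrightarrow> act 0 c = \<zero>"
  using act_diff[of 0 0 c] by (simp add: minus_eq r_neg)

lemma act_mult:
  assumes t: "t \<in> carrier F" and u: "u \<in> carrier F" and c: "c \<in> carrier A"
  shows "act (t \<otimes>\<^bsub>F\<^esub> u) c = act t (act u c)"
  using t
proof (induction rule: pretensor_induct)
  case zero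
  then show ?case using c u by (simp add: act_zero del: pretensor_simps(1))
next
  case (diff t t')
  then show ?case
    using c u pretensor_mult_closed[OF ring_M ring_Op]
    by (simp add: pretensor_mult_diff_left act_diff del: pretensor_simps(1))
next
  case (of a b)
  show ?case using u
  proof (induction rule: pretensor_induct)
    case zero
    then show ?case using c of by (simp add: act_zero act_of)
  next
    case (diff u u')
    have ab: "frag_of (a, b) \<in> carrier F" using of by simp
    have "act (frag_of (a, b) \<otimes>\<^bsub>F\<^esub> (u - u')) c = act (frag_of (a, b)) (act u c) \<ominus> act (frag_of (a, b)) (act u' c)"
      using diff c ab pretensor_mult_closed[OF ring_M ring_Op ab]
      by (simp add: pretensor_mult_diff_right act_diff del: pretensor_simps(1))
    also have "\<dots> = act (frag_of (a, b)) (act u c \<ominus> act u' c)"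
      using of diff(1,2) c by (simp add: act_of minus_eq l_distr r_distr l_minus r_minus del: pretensor_simps(1))
    also have "\<dots> = act (frag_of (a, b)) (act (u - u') c)"
      using diff(1,2) c by (simp add: act_diff del: pretensor_simps(1))
    finally show ?case .
  next
    case (of a' b')
    then show ?case using c \<open>a \<in> carrier M\<close> \<open>b \<in> carrier Op\<close>
      by (simp add: pretensor_mult_of act_of m_assoc)
  qed
qed

lemma act_ring_hom: "ring_hom_ring F (module_End Z M) act"
proof -
  have "act \<in> ring_hom F (module_End Z M)"
  proof (rule ring_hom_memI)
    fix t assume "t \<in> carrier F" then show "act t \<in> carrier (module_End Z M)" by (rule act_End)
  next
    fix t u assume t: "t \<in> carrier F" and u: "u \<in> carrier F"
    have "t \<otimes>\<^bsub>F\<^esub> u \<in> carrier F" by (rule pretensor_mult_closed[OF ring_M ring_Op t u])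
    from End_D(4)[OF act_End[OF this]]
    show "act (t \<otimes>\<^bsub>F\<^esub> u) = act t \<otimes>\<^bsub>module_End Z M\<^esub> act u"
      by (intro extensionalityI[of _ "carrier A"])
        (auto simp: module_End_def compose_def act_mult[OF t u])
    show "act (t \<oplus>\<^bsub>F\<^esub> u) = act t \<oplus>\<^bsub>module_End Z M\<^esub> act u"
      using act_add[OF t u] by simp
  next
    show "act \<one>\<^bsub>F\<^esub> = \<one>\<^bsub>module_End Z M\<^esub>"
      by (simp add: act_of module_End_def fun_eq_iff restrict_def)
  qed
  then show ?thesis
    by (intro ring_hom_ringI2 ring_pretensor ring_M ring_Op ring_E)
qed

lemma act_surj: "act ` carrier F = carrier (module_End Z M)"
proof
  show "act ` carrier F \<subseteq> carrier (module_End Z M)" using act_End by blast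
  show "carrier (module_End Z M) \<subseteq> act ` carrier F"
  proof
    fix g assume g: "g \<in> carrier (module_End Z M)"
    interpret E: ring "module_End Z M" by (rule ring_E)
    interpret F: ring F by (rule ring_pretensor[OF ring_M ring_Op])
    define e where "e = (\<lambda>k l. frag_of (g (x k) \<otimes> x l \<otimes> y k, y l))"
    have e: "e k l \<in> carrier F" if "k \<in> I" "l \<in> I" for k l
      using that x_closed y_closed End_D(1)[OF g] by (simp add: e_def)
    have act_sum: "(\<Sum>k\<in>S. f k) \<in> carrier F \<and> act (\<Sum>k\<in>S. f k) c = (\<Oplus>k\<in>S. act (f k) c)"
      if "finite S" "\<And>k. k \<in> S \<Longrightarrow> f k \<in> carrier F" "c \<in> carrier A" for f c and S :: "'i set"
      using that(1,2)
    proof (induction S rule: finite_induct)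
      case empty
      then show ?case using \<open>c \<in> carrier A\<close> by (simp add: act_zero)
    next
      case (insert k S)
      have "(\<Oplus>k\<in>insert k S. act (f k) c) = act (f k) c \<oplus> (\<Oplus>k\<in>S. act (f k) c)"
        using insert \<open>c \<in> carrier A\<close> by (intro finsum_insert) (auto simp del: pretensor_simps(1))
      then show ?case
        using insert \<open>c \<in> carrier A\<close> act_add[of "f k" "\<Sum>k\<in>S. f k"] F.a_closed[of "f k" "\<Sum>k\<in>S. f k"]
        by (simp add: module_End_def del: pretensor_simps(1))
    qed
    define t where "t = (\<Sum>k\<in>I. \<Sum>l\<in>I. e k l)"
    have inner: "(\<Sum>l\<in>I. e k l) \<in> carrier F" if "k \<in> I" for k
      using act_sum[of I "e k" \<zero>] e that fin by simp
    have t: "t \<in> carrier F"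
      unfolding t_def using act_sum[of I "\<lambda>k. \<Sum>l\<in>I. e k l" \<zero>] inner fin by simp
    have "act t c = g c" if c: "c \<in> carrier A" for c
    proof -
      have "act t c = (\<Oplus>k\<in>I. act (\<Sum>l\<in>I. e k l) c)"
        unfolding t_def using act_sum[of I "\<lambda>k. \<Sum>l\<in>I. e k l" c] inner fin c by blast
      also have "\<dots> = (\<Oplus>k\<in>I. g (x k) \<otimes> tr (y k \<otimes> c))"
      proof (rule finsum_cong')
        fix k assume k: "k \<in> I"
        have gx: "g (x k) \<in> carrier A" using k x_closed End_D(1)[OF g] by simp
        have "act (\<Sum>l\<in>I. e k l) c = (\<Oplus>l\<in>I. act (e k l) c)"
          using act_sum[of I "e k" c] e k fin c by blast
        also have "\<dots> = (\<Oplus>l\<in>I. g (x k) \<otimes> (x l \<otimes> (y k \<otimes> c) \<otimes> y l))"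
          unfolding e_def using x_closed y_closed gx k c
          by (intro finsum_cong') (auto simp: act_of m_assoc)
        also have "\<dots> = g (x k) \<otimes> tr (y k \<otimes> c)"
          unfolding tr_def using x_closed y_closed gx k c fin by (intro finsum_rdistr[symmetric]) auto
        finally show "act (\<Sum>l\<in>I. e k l) c = g (x k) \<otimes> tr (y k \<otimes> c)" .
      qed (use x_closed y_closed End_D(1)[OF g] c in auto)
      also have "\<dots> = (\<Oplus>k\<in>I. g (tr (y k \<otimes> c) \<otimes> x k))"
      proof (rule finsum_cong')
        fix k assume k: "k \<in> I"
        have "tr (y k \<otimes> c) \<in> centre A" using k c y_closed by (intro tr_central) simp
        then show "g (x k) \<otimes> tr (y k \<otimes> c) = g (tr (y k \<otimes> c) \<otimes> x k)"
          using End_D(3)[OF g] centreD(2) k x_closed by simp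
      qed (use x_closed y_closed End_D(1)[OF g] c in auto)
      also have "\<dots> = g (\<Oplus>k\<in>I. tr (y k \<otimes> c) \<otimes> x k)"
        using End_finsum[OF g fin] x_closed y_closed c by simp
      also have "\<dots> = g c" using tr_expansion[OF c] by simp
      finally show ?thesis .
    qed
    then have "act t = g"
      using End_D(4)[OF g] End_D(4)[OF act_End[OF t]] by (intro extensionalityI[of _ "carrier A"]) auto
    then show "g \<in> act ` carrier F" using t by blast
  qed
qed

text \<open>Modulo the tensor relations every formal sum \<open>t\<close> equals
  \<open>\<Sum>\<^sub>k L\<^sub>k t \<otimes> x\<^sub>k\<close>, where the coefficient \<open>L\<^sub>k t = coef k t\<close>
  depends only on the action of \<open>t\<close>.\<close>

definition coef :: "'i \<Rightarrow> (('a \<times> 'a) \<Rightarrow>\<^sub>0 int) \<Rightarrow> 'a" where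
  "coef k t = (\<Oplus>l\<in>I. act t (x l \<otimes> y k) \<otimes> y l)"

lemma coef_closed: "k \<in> I \<Longrightarrow> t \<in> carrier F \<Longrightarrow> coef k t \<in> carrier A"
  unfolding coef_def using x_closed y_closed by (intro finsum_closed) (auto simp del: pretensor_simps(1))

lemma coef_diff:
  assumes "k \<in> I" "t \<in> carrier F" "t' \<in> carrier F"
  shows "coef k (t - t') = coef k t \<ominus> coef k t'"
proof -
  have d: "t - t' \<in> carrier F" using assms(2,3) by (rule pretensor_diff_closed)
  have "coef k (t - t') \<oplus> coef k t' = (\<Oplus>l\<in>I. act (t - t') (x l \<otimes> y k) \<otimes> y l \<oplus> act t' (x l \<otimes> y k) \<otimes> y l)"
    unfolding coef_def using assms d x_closed y_closed
    by (intro finsum_addf[symmetric]) (auto simp del: pretensor_simps(1))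
  also have "\<dots> = coef k t"
    unfolding coef_def
  proof (rule finsum_cong')
    fix l assume l: "l \<in> I"
    have "x l \<otimes> y k \<in> carrier A" using l assms x_closed y_closed by simp
    then show "act (t - t') (x l \<otimes> y k) \<otimes> y l \<oplus> act t' (x l \<otimes> y k) \<otimes> y l = act t (x l \<otimes> y k) \<otimes> y l"
      using assms l y_closed
      by (simp add: act_diff minus_eq l_distr l_minus a_assoc l_neg del: pretensor_simps(1))
  qed (use assms x_closed y_closed in \<open>auto simp del: pretensor_simps(1)\<close>)
  finally have *: "coef k t = coef k (t - t') \<oplus> coef k t'" by simp
  show ?thesis
    unfolding * using coef_closed[OF assms(1)] d assms(3) by (simp add: minus_eq a_assoc r_neg del: pretensor_simps(1))
qed

lemma expansion_mod_K:
  assumes "t \<in> carrier F"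
  shows "t - (\<Sum>k\<in>I. frag_of (coef k t, x k)) \<in> K"
  using assms
proof (induction rule: pretensor_induct)
  case zero
  have "coef k 0 = \<zero>" if "k \<in> I" for k
    using coef_diff[OF that, of 0 0] coef_closed[OF that, of 0] by (simp add: minus_eq r_neg)
  then have "(\<Sum>k\<in>I. frag_of (coef k 0, x k)) \<in> K"
    using K_zero_left x_closed by (intro K_sum fin) simp
  from K_closed(6)[OF K_closed(3) this] show ?case by simp
next
  case (diff t t')
  have "(\<Sum>k\<in>I. frag_of (coef k t, x k) - frag_of (coef k t', x k) - frag_of (coef k (t - t'), x k)) \<in> K"
    by (intro K_sum fin) (simp only: coef_diff[OF _ diff(1,2)], intro K_minus_left coef_closed x_closed diff)
  from K_closed(5)[OF K_closed(6)[OF diff(3,4)] this]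
  show ?case by (simp add: sum_subtractf)
next
  case (of a b)
  then have a: "a \<in> carrier A" and b: "b \<in> carrier A" by simp_all
  have co: "coef k (frag_of (a, b)) = a \<otimes> tr (y k \<otimes> b)" if k: "k \<in> I" for k
  proof -
    have "coef k (frag_of (a, b)) = (\<Oplus>l\<in>I. a \<otimes> (x l \<otimes> (y k \<otimes> b) \<otimes> y l))"
      unfolding coef_def using a b k x_closed y_closed
      by (intro finsum_cong') (auto simp: act_of m_assoc)
    also have "\<dots> = a \<otimes> tr (y k \<otimes> b)"
      unfolding tr_def using a b k x_closed y_closed fin by (intro finsum_rdistr[symmetric]) auto
    finally show ?thesis .
  qed
  have trc: "tr (y k \<otimes> b) \<in> centre A" if "k \<in> I" for k
    using that b y_closed by (intro tr_central) simp
  have "frag_of (a, \<Oplus>k\<in>I. tr (y k \<otimes> b) \<otimes> x k) - (\<Sum>k\<in>I. frag_of (a, tr (y k \<otimes> b) \<otimes> x k)) \<in> K"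
    using a b x_closed y_closed by (intro K_finsum_right fin) auto
  moreover have "(\<Sum>k\<in>I. frag_of (a \<otimes> tr (y k \<otimes> b), x k) - frag_of (a, x k \<otimes> tr (y k \<otimes> b))) \<in> K"
    using a x_closed trc by (intro K_sum fin K_smult)
  moreover have "x k \<otimes> tr (y k \<otimes> b) = tr (y k \<otimes> b) \<otimes> x k" if "k \<in> I" for k
    using centreD(2)[OF trc[OF that]] x_closed that by simp
  ultimately have "(frag_of (a, b) - (\<Sum>k\<in>I. frag_of (a, tr (y k \<otimes> b) \<otimes> x k))) \<in> K"
    "(\<Sum>k\<in>I. frag_of (a \<otimes> tr (y k \<otimes> b), x k)) - (\<Sum>k\<in>I. frag_of (a, tr (y k \<otimes> b) \<otimes> x k)) \<in> K"
    using tr_expansion[OF b] by (simp_all add: sum_subtractf)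
  from K_closed(6)[OF this] show ?case
    by (simp add: co)
qed

text \<open>If \<open>t\<close> acts as zero then all its coefficients vanish, so \<open>t\<close> is zero modulo the tensor relations.\<close>

lemma act_kernel: "a_kernel F (module_End Z M) act = K"
proof
  interpret h: ring_hom_ring F "module_End Z M" act by (rule act_ring_hom)
  have sub: "subgroup (a_kernel F (module_End Z M) act) (add_monoid F)"
    unfolding a_kernel_def by (rule group_hom.subgroup_kernel) (rule h.a_group_hom)
  have zeroI: "t \<in> a_kernel F (module_End Z M) act" if t: "t \<in> carrier F" and "\<And>c. c \<in> carrier A \<Longrightarrow> act t c = \<zero>" for t
  proof -
    have "act t = \<zero>\<^bsub>module_End Z M\<^esub>"
      using End_D(4)[OF act_End[OF t]] that(2)
      by (intro extensionalityI[of _ "carrier A"]) (auto simp: module_End_def)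
    then show ?thesis using t unfolding a_kernel_def' by blast
  qed
  have rel: "tensor_relations Z M Op \<subseteq> a_kernel F (module_End Z M) act"
  proof
    fix t assume tr: "t \<in> tensor_relations Z M Op"
    then have t: "t \<in> carrier F" using K_closed(1) by blast
    have sum_cancel: "p \<oplus> q \<ominus> p \<ominus> q = \<zero>" if "p \<in> carrier A" "q \<in> carrier A" for p q
      using that by algebra
    have d: "u - v \<in> carrier F" if "u \<in> carrier F" "v \<in> carrier F" for u v
      using that by (rule pretensor_diff_closed)
    have fc: "frag_of (a, b) \<in> carrier F" if "a \<in> carrier A" "b \<in> carrier A" for a b
      using that by simp
    consider
       (1) a a' b where "t = frag_of (a \<oplus> a', b) - frag_of (a, b) - frag_of (a', b)" "a \<in> carrier A" "a' \<in> carrier A" "b \<in> carrier A"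
     | (2) a b b' where "t = frag_of (a, b \<oplus> b') - frag_of (a, b) - frag_of (a, b')" "a \<in> carrier A" "b \<in> carrier A" "b' \<in> carrier A"
     | (3) z a b where "t = frag_of (a \<otimes> z, b) - frag_of (a, b \<otimes> z)" "z \<in> centre A" "a \<in> carrier A" "b \<in> carrier A"
      using tr unfolding tensor_relations_def M_simps Op_simps centre_simps by blast
    then show "t \<in> a_kernel F (module_End Z M) act"
    proof cases
      case 1
      show ?thesis
      proof (rule zeroI[OF t])
        fix c assume c: "c \<in> carrier A"
        then show "act t c = \<zero>"
          unfolding 1(1) using 1 fc d
          by (simp add: act_diff act_of l_distr sum_cancel del: pretensor_simps(1))
      qed
    next
      case 2
      show ?thesis
      proof (rule zeroI[OF t])
        fix c assume c: "c \<in> carrier A"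
        then show "act t c = \<zero>"
          unfolding 2(1) using 2 fc d
          by (simp add: act_diff act_of r_distr sum_cancel del: pretensor_simps(1))
      qed
    next
      case 3
      show ?thesis
      proof (rule zeroI[OF t])
        fix c assume c: "c \<in> carrier A"
        then show "act t c = \<zero>"
          unfolding 3(1) using 3 fc d centreD(1)[OF 3(2)] centreD(2)[OF 3(2), of "c \<otimes> b"]
          by (simp add: act_diff act_of m_assoc minus_eq r_neg del: pretensor_simps(1))
      qed
    qed
  qed
  show "K \<subseteq> a_kernel F (module_End Z M) act"
    unfolding tensor_kernel_def by (rule group.generate_subgroup_incl[OF h.R.a_group rel sub])
  show "a_kernel F (module_End Z M) act \<subseteq> K"
  proof
    fix t assume "t \<in> a_kernel F (module_End Z M) act"
    then have t: "t \<in> carrier F" and "act t = \<zero>\<^bsub>module_End Z M\<^esub>"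
      unfolding a_kernel_def' by blast+
    then have act0: "act t c = \<zero>" if "c \<in> carrier A" for c
      using that by (simp add: module_End_def)
    have "coef k t = \<zero>" if k: "k \<in> I" for k
    proof -
      have "coef k t = (\<Oplus>l\<in>I. \<zero>)"
        unfolding coef_def using k x_closed y_closed by (intro finsum_cong') (auto simp: act0)
      then show ?thesis by simp
    qed
    then have "(\<Sum>k\<in>I. frag_of (coef k t, x k)) \<in> K"
      using K_zero_left x_closed by (intro K_sum fin) simp
    from K_closed(5)[OF expansion_mod_K[OF t] this] show "t \<in> K" by simp
  qed
qed

theorem azumaya: "azumaya A"
proof -
  interpret h: ring_hom_ring F "module_End Z M" act by (rule act_ring_hom)
  let ?h = "\<lambda>t. the_elem (act ` t)"
  have "?h \<in> ring_iso (tensor_ring Z M Op) (module_End Z M)"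
    unfolding tensor_ring_def act_kernel[symmetric] by (rule h.FactRing_iso_set[OF act_surj])
  moreover have "?h (pure_tensor Z M Op a b) = (\<lambda>c\<in>carrier A. a \<otimes> c \<otimes> b)"
    if "a \<in> carrier A" "b \<in> carrier A" for a b
    unfolding pure_tensor_def act_kernel[symmetric]
    using that h.the_elem_simp[of "frag_of (a, b)"] by (simp add: act_of)
  ultimately show ?thesis
    unfolding azumaya_def using unital_algebra projective
    by (intro conjI bexI[of _ ?h] ballI)
qed

end


section \<open>An elementary Gelfand--Mazur theorem\<close>

text \<open>A commutative complex algebra \<open>R\<close>, given as a subset of a ring together with the embedding \<open>c\<close> of the
  scalars, with a submultiplicative seminorm. The seminorm stands for the norm of a quotient algebra.\<close>

locale seminormed_algebra =
  fixes R :: "'a::comm_ring_1 set" and c :: "complex \<Rightarrow> 'a" and N :: "'a \<Rightarrow> real"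
  assumes R_add: "x \<in> R \<Longrightarrow> y \<in> R \<Longrightarrow> x + y \<in> R"
    and R_mult: "x \<in> R \<Longrightarrow> y \<in> R \<Longrightarrow> x * y \<in> R"
    and R_c: "c a \<in> R"
    and c_add: "c (a + b) = c a + c b"
    and c_mult: "c (a * b) = c a * c b"
    and c_1: "c 1 = 1"
    and N_nonneg: "x \<in> R \<Longrightarrow> 0 \<le> N x"
    and N_add: "x \<in> R \<Longrightarrow> y \<in> R \<Longrightarrow> N (x + y) \<le> N x + N y"
    and N_mult: "x \<in> R \<Longrightarrow> y \<in> R \<Longrightarrow> N (x * y) \<le> N x * N y"
    and N_c: "N (c a) \<le> cmod a"
    and N_1: "N 1 \<noteq> 0"
begin

lemma c_0: "c 0 = 0"
  using c_add[of 0 0] by simp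

lemma c_minus: "c (- a) = - c a"
  using c_add[of a "- a"] by (simp add: c_0 add_eq_0_iff)

lemma R_1: "1 \<in> R" and R_0: "0 \<in> R"
  using R_c[of 1] R_c[of 0] by (simp_all add: c_1 c_0)

lemma R_minus: "x \<in> R \<Longrightarrow> - x \<in> R"
  using R_mult[OF R_c[of "-1"], of x] by (simp add: c_minus c_1)

lemma R_diff: "x \<in> R \<Longrightarrow> y \<in> R \<Longrightarrow> x - y \<in> R"
  using R_add[OF _ R_minus, of x y] by simp

lemma R_power: "x \<in> R \<Longrightarrow> x ^ n \<in> R"
  by (induction n) (auto intro: R_1 R_mult)

lemma R_sum: "(\<And>k. k \<in> S \<Longrightarrow> f k \<in> R) \<Longrightarrow> (\<Sum>k\<in>S. f k) \<in> R"
  by (induction S rule: infinite_finite_induct) (auto intro: R_0 R_add)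

lemmas R_intros = R_add R_mult R_c R_1 R_0 R_minus R_diff R_power R_sum

lemma N_c_mult: "x \<in> R \<Longrightarrow> N (c a * x) \<le> cmod a * N x"
  using N_mult[OF R_c, of x a] mult_right_mono[OF N_c N_nonneg, of x a] by linarith

lemma N_c_mult_eq: assumes "x \<in> R" shows "N (c a * x) = cmod a * N x"
proof (cases "a = 0")
  case True
  then show ?thesis
    using N_c_mult[OF assms, of 0] N_nonneg[OF R_mult[OF R_c assms], of 0] by simp
next
  case False
  have "c (1 / a) * (c a * x) = x"
    using False by (simp add: mult.assoc[symmetric] c_mult[symmetric] c_1)
  then have "N x \<le> (1 / cmod a) * N (c a * x)"
    using N_c_mult[OF R_mult[OF R_c assms], of "1 / a" a] by (simp add: norm_divide)
  then have "cmod a * N x \<le> N (c a * x)"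
    using False by (simp add: field_simps)
  then show ?thesis using N_c_mult[OF assms, of a] by linarith
qed

lemma N_0: "N 0 = 0"
  using N_c_mult_eq[OF R_0, of 0] by simp

lemma N_minus: "x \<in> R \<Longrightarrow> N (- x) = N x"
  using N_c_mult_eq[of x "-1"] by (simp add: c_minus c_1)

lemma N_sum: "(\<And>k. k \<in> S \<Longrightarrow> f k \<in> R) \<Longrightarrow> N (\<Sum>k\<in>S. f k) \<le> (\<Sum>k\<in>S. N (f k))"
proof (induction S rule: infinite_finite_induct)
  case (insert k S)
  then have "N (f k + (\<Sum>k\<in>S. f k)) \<le> N (f k) + N (\<Sum>k\<in>S. f k)"
    by (intro N_add R_sum) auto
  with insert show ?case by simp
qed (auto simp: N_0)

lemma N_power: "x \<in> R \<Longrightarrow> N (x ^ Suc n) \<le> N x ^ Suc n"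
proof (induction n)
  case (Suc n)
  have "N (x * x ^ Suc n) \<le> N x * N (x ^ Suc n)"
    using Suc.prems by (intro N_mult R_power)
  also have "\<dots> \<le> N x * N x ^ Suc n"
    using Suc N_nonneg by (intro mult_left_mono) auto
  finally show ?case by simp
qed simp

lemma N_le: "x \<in> R \<Longrightarrow> y \<in> R \<Longrightarrow> N x \<le> N y + N (x - y)"
  using N_add[of y "x - y"] R_diff by simp

lemma N_diff_zero_add: "x \<in> R \<Longrightarrow> y \<in> R \<Longrightarrow> N x = 0 \<Longrightarrow> N y = 0 \<Longrightarrow> N (x + y) = 0"
  using N_add[of x y] N_nonneg[OF R_add, of x y] by simp

lemma N_zero_mult: "x \<in> R \<Longrightarrow> y \<in> R \<Longrightarrow> N y = 0 \<Longrightarrow> N (x * y) = 0"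
  using N_mult[of x y] N_nonneg[OF R_mult, of x y] by simp

lemma sum_powers_root_of_unity:
  fixes k n :: nat
  assumes "0 < k" "k < n"
  shows "(\<Sum>j<n. cis (2 * pi * j / n) ^ k) = 0"
proof -
  let ?w = "cis (2 * pi * k / n)"
  have "?w \<noteq> 1"
  proof
    assume w: "?w = 1"
    have "cos (2 * pi * k / n) = 1" using arg_cong[OF w, of Re] by simp
    then obtain m :: int where m: "2 * pi * k / n = of_int m * 2 * pi"
      using cos_one_2pi_int by blast
    then have "real k = m * n" using assms by (simp add: field_simps)
    then have "int k = m * int n" using of_int_eq_iff[where 'a=real, of "int k" "m * int n"] by simp
    then have "int n dvd int k" by simp
    then show False using assms by (simp add: nat_dvd_not_less)
  qed
  moreover have "?w ^ n = cis (2 * pi * k)"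
    using assms by (simp add: Complex.DeMoivre)
  then have "?w ^ n = 1" by simp
  moreover have "cis (2 * pi * j / n) ^ k = ?w ^ j" for j
    by (simp add: Complex.DeMoivre field_simps)
  ultimately show ?thesis by (simp add: sum_gp_strict)
qed

text \<open>Up to elements of seminorm zero, \<open>f - \<mu>\<close> is not invertible for some \<open>\<mu>\<close>. Otherwise let \<open>h \<mu>\<close> be its inverse.
  The function \<open>\<nu> \<mu> = N (h \<mu>)\<close> is continuous, positive and tends to zero at infinity. By the
  resolvent equation the mean of \<open>h\<close> over the \<open>n\<close>-th roots of unity on a small circle about \<open>\<mu>\<close> is close
  to \<open>h \<mu>\<close> for large \<open>n\<close>, so \<open>\<nu>\<close> satisfies a sub-mean-value inequality. This contradicts the existence of a
  maximum point that is as far from the origin as possible. Neither linear functionals nor vector-valued holomorphic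
  functions are needed.\<close>

theorem Gelfand_Mazur:
  assumes f: "f \<in> R"
  shows "\<exists>\<mu>. \<forall>h\<in>R. N (h * (f - c \<mu>) - 1) \<noteq> 0"
proof (rule ccontr)
  assume "\<nexists>\<mu>. \<forall>h\<in>R. N (h * (f - c \<mu>) - 1) \<noteq> 0"
  then obtain h where hR: "\<And>\<mu>. h \<mu> \<in> R" and h: "\<And>\<mu>. N (h \<mu> * (f - c \<mu>) - 1) = 0"
    by metis
  define \<nu> where "\<nu> \<mu> = N (h \<mu>)" for \<mu>
  have N1: "0 < N 1" "N 1 \<le> 1"
    using N_1 N_nonneg[OF R_1] N_c[of 1] by (auto simp: c_1)
  have h': "N (1 - h \<mu> * (f - c \<mu>)) = 0" for \<mu>
    using N_minus[of "h \<mu> * (f - c \<mu>) - 1"] h[of \<mu>] hR f by (simp add: R_intros)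
  have \<nu>_pos: "\<nu> \<mu> > 0" for \<mu>
  proof -
    have "N 1 \<le> N (h \<mu> * (f - c \<mu>)) + N (1 - h \<mu> * (f - c \<mu>))"
      using hR f by (intro N_le R_intros)
    also have "\<dots> \<le> \<nu> \<mu> * N (f - c \<mu>)"
      unfolding h' \<nu>_def using N_mult[OF hR[of \<mu>], of "f - c \<mu>"] f by (simp add: R_intros)
    finally have "\<nu> \<mu> \<noteq> 0" using N1 by auto
    then show ?thesis using N_nonneg[OF hR[of \<mu>]] unfolding \<nu>_def by linarith
  qed
  have resolvent: "N (h (\<mu> + s) - h \<mu> - c s * h \<mu> * h (\<mu> + s)) = 0" for \<mu> s
  proof -
    let ?a = "f - c \<mu>" and ?a' = "f - c (\<mu> + s)"
    have "h (\<mu> + s) - h \<mu> - c s * h \<mu> * h (\<mu> + s)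
        = h (\<mu> + s) * (1 - h \<mu> * ?a) + (- h \<mu>) * (1 - h (\<mu> + s) * ?a')"
      by (simp add: c_add algebra_simps)
    also have "N \<dots> = 0"
      using hR f h' by (intro N_diff_zero_add N_zero_mult R_intros) auto
    finally show ?thesis .
  qed
  have expand: "N (h (\<mu> + s) - (\<Sum>k<n. c (s ^ k) * h \<mu> ^ Suc k) - c (s ^ n) * h \<mu> ^ n * h (\<mu> + s)) = 0" for \<mu> s n
  proof (induction n)
    case 0
    then show ?case by (simp add: c_1 N_0)
  next
    case (Suc n)
    have "h (\<mu> + s) - (\<Sum>k<Suc n. c (s ^ k) * h \<mu> ^ Suc k) - c (s ^ Suc n) * h \<mu> ^ Suc n * h (\<mu> + s)
      = (h (\<mu> + s) - (\<Sum>k<n. c (s ^ k) * h \<mu> ^ Suc k) - c (s ^ n) * h \<mu> ^ n * h (\<mu> + s))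
        + c (s ^ n) * h \<mu> ^ n * (h (\<mu> + s) - h \<mu> - c s * h \<mu> * h (\<mu> + s))"
      by (simp add: c_mult algebra_simps)
    also have "N \<dots> = 0"
      using hR Suc resolvent by (intro N_diff_zero_add N_zero_mult R_intros) auto
    finally show ?case .
  qed
  \<comment> \<open>Only the term \<open>k = 0\<close> of the expansion survives averaging over the roots of unity.\<close>
  have average: "n * \<nu> \<mu> \<le> (\<Sum>j<n. \<nu> (\<mu> + t * cis (2 * pi * j / n))) * (1 + (cmod t * \<nu> \<mu>) ^ n)"
    if n: "0 < n" for n :: nat and \<mu> t
  proof -
    define s where "s j = t * cis (2 * pi * real j / n)" for j
    define H where "H = (\<Sum>j<n. h (\<mu> + s j))"
    have H: "H \<in> R" unfolding H_def by (intro R_intros hR)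
    have "cis (2 * pi * real j / real n) ^ n = cis (2 * pi * real j)" for j
      using n by (simp add: Complex.DeMoivre)
    then have sn: "s j ^ n = t ^ n" for j
      by (simp add: s_def power_mult_distrib)
    have sum_s: "(\<Sum>j<n. s j ^ k) = (if k = 0 then of_nat n else 0)" if "k < n" for k
      using sum_powers_root_of_unity[of k n] that
      by (auto simp: s_def power_mult_distrib sum_distrib_left[symmetric])
    have c_sum: "c (\<Sum>j\<in>S. g j) = (\<Sum>j\<in>S. c (g j))" for g and S :: "nat set"
      by (induction S rule: infinite_finite_induct) (auto simp: c_0 c_add)
    have "(\<Sum>j<n. \<Sum>k<n. c (s j ^ k) * h \<mu> ^ Suc k) = (\<Sum>k<n. c (\<Sum>j<n. s j ^ k) * h \<mu> ^ Suc k)"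
      by (subst sum.swap) (simp add: c_sum sum_distrib_right)
    also have "\<dots> = (\<Sum>k<n. if k = 0 then c (of_nat n) * h \<mu> else 0)"
      by (rule sum.cong) (auto simp: sum_s c_0)
    also have "\<dots> = c (of_nat n) * h \<mu>" using n by simp
    finally have "(\<Sum>j<n. h (\<mu> + s j) - (\<Sum>k<n. c (s j ^ k) * h \<mu> ^ Suc k) - c (s j ^ n) * h \<mu> ^ n * h (\<mu> + s j))
       = H - c (of_nat n) * h \<mu> - c (t ^ n) * h \<mu> ^ n * H"
      by (simp add: sum_subtractf H_def sn sum_distrib_left)
    moreover have "N (\<Sum>j<n. h (\<mu> + s j) - (\<Sum>k<n. c (s j ^ k) * h \<mu> ^ Suc k) - c (s j ^ n) * h \<mu> ^ n * h (\<mu> + s j))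
        \<le> (\<Sum>j<n. N (h (\<mu> + s j) - (\<Sum>k<n. c (s j ^ k) * h \<mu> ^ Suc k) - c (s j ^ n) * h \<mu> ^ n * h (\<mu> + s j)))"
      by (intro N_sum R_intros hR)
    ultimately have 0: "N (H - c (of_nat n) * h \<mu> - c (t ^ n) * h \<mu> ^ n * H) \<le> 0"
      unfolding expand by simp
    let ?E = "H - c (of_nat n) * h \<mu> - c (t ^ n) * h \<mu> ^ n * H"
    have ER: "?E \<in> R" by (intro R_intros hR H)
    have "c (of_nat n) * h \<mu> = H + (- (c (t ^ n) * (h \<mu> ^ n * H)) + - ?E)"
      by (simp add: algebra_simps)
    also have "N \<dots> \<le> N H + (N (- (c (t ^ n) * (h \<mu> ^ n * H))) + N (- ?E))"
      using hR H by (intro order_trans[OF N_add] add_left_mono N_add R_intros)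
    also have "N (- (c (t ^ n) * (h \<mu> ^ n * H))) = cmod t ^ n * N (h \<mu> ^ n * H)"
      using hR H by (simp add: N_minus N_c_mult_eq R_intros norm_power)
    also have "N (- ?E) = N ?E" by (rule N_minus[OF ER])
    finally have "n * \<nu> \<mu> \<le> N H + (cmod t ^ n * N (h \<mu> ^ n * H) + N ?E)"
      using hR by (simp add: N_c_mult_eq \<nu>_def)
    moreover have "N (h \<mu> ^ n * H) \<le> \<nu> \<mu> ^ n * N H"
      using N_mult[OF R_power[OF hR] H, of \<mu> n] N_power[OF hR, of \<mu> "n - 1"] n N_nonneg[OF H]
        mult_right_mono[of "N (h \<mu> ^ n)" "\<nu> \<mu> ^ n" "N H"] by (simp add: \<nu>_def)
    then have "cmod t ^ n * N (h \<mu> ^ n * H) \<le> cmod t ^ n * (\<nu> \<mu> ^ n * N H)"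
      by (intro mult_left_mono) auto
    ultimately have "n * \<nu> \<mu> \<le> N H * (1 + (cmod t * \<nu> \<mu>) ^ n)"
      using 0 by (simp add: algebra_simps power_mult_distrib)
    also have "\<dots> \<le> (\<Sum>j<n. \<nu> (\<mu> + s j)) * (1 + (cmod t * \<nu> \<mu>) ^ n)"
      using \<nu>_pos[of \<mu>] N_sum[of "{..<n}" "\<lambda>j. h (\<mu> + s j)"] hR
      unfolding H_def \<nu>_def by (intro mult_right_mono) (auto intro: add_nonneg_nonneg)
    finally show ?thesis unfolding s_def .
  qed
  have \<nu>_diff: "\<bar>\<nu> (\<mu> + s) - \<nu> \<mu>\<bar> \<le> cmod s * \<nu> \<mu> * \<nu> (\<mu> + s)" for \<mu> s
  proof -
    let ?d = "h (\<mu> + s) - h \<mu>"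
    have "N ?d \<le> N (c s * (h \<mu> * h (\<mu> + s))) + N (?d - c s * (h \<mu> * h (\<mu> + s)))"
      by (intro N_le R_intros hR)
    also have "N (?d - c s * (h \<mu> * h (\<mu> + s))) = 0"
      using resolvent[of \<mu> s] by (simp add: mult.assoc)
    also have "N (c s * (h \<mu> * h (\<mu> + s))) = cmod s * N (h \<mu> * h (\<mu> + s))"
      by (intro N_c_mult_eq R_intros hR)
    also have "\<dots> \<le> cmod s * (\<nu> \<mu> * \<nu> (\<mu> + s))"
      unfolding \<nu>_def by (intro mult_left_mono N_mult hR) auto
    finally have "N ?d \<le> cmod s * \<nu> \<mu> * \<nu> (\<mu> + s)" by simp
    moreover have "\<nu> (\<mu> + s) \<le> \<nu> \<mu> + N ?d" "\<nu> \<mu> \<le> \<nu> (\<mu> + s) + N ?d"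
      using N_le[OF hR hR, of "\<mu> + s" \<mu>] N_le[OF hR hR, of \<mu> "\<mu> + s"] N_minus[of ?d] hR
      by (simp_all add: \<nu>_def R_intros)
    ultimately show ?thesis by linarith
  qed
  have \<nu>_cont: "continuous_on UNIV \<nu>"
  proof (rule continuous_at_imp_continuous_on, rule ballI)
    fix \<mu>
    have ev: "eventually (\<lambda>s. norm (\<nu> (\<mu> + s) - \<nu> \<mu>) \<le> cmod s * (2 * \<nu> \<mu> * \<nu> \<mu>)) (at 0)"
    proof -
      have "eventually (\<lambda>s::complex. dist s 0 < 1 / (2 * \<nu> \<mu>)) (at 0)"
        by (rule eventually_at_ball'[THEN eventually_mono, of "1 / (2 * \<nu> \<mu>)" 0 UNIV])
           (use \<nu>_pos[of \<mu>] in \<open>auto simp: dist_commute\<close>)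
      then show ?thesis
      proof eventually_elim
        case (elim s)
        then have "cmod s * \<nu> \<mu> \<le> 1 / 2" using \<nu>_pos[of \<mu>] by (simp add: field_simps)
        then have "cmod s * \<nu> \<mu> * \<nu> (\<mu> + s) \<le> (1 / 2) * \<nu> (\<mu> + s)"
          using \<nu>_pos[of "\<mu> + s"] by (intro mult_right_mono) auto
        then have "\<nu> (\<mu> + s) \<le> 2 * \<nu> \<mu>"
          using \<nu>_diff[of \<mu> s] by linarith
        then have "cmod s * \<nu> \<mu> * \<nu> (\<mu> + s) \<le> cmod s * \<nu> \<mu> * (2 * \<nu> \<mu>)"
          using \<nu>_pos[of \<mu>] by (intro mult_left_mono) auto
        then show ?case using \<nu>_diff[of \<mu> s] by (simp add: mult_ac)
      qed
    qed
    have "((\<lambda>s::complex. cmod s * (2 * \<nu> \<mu> * \<nu> \<mu>)) \<longlongrightarrow> 0) (at 0)"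
      by (auto intro!: tendsto_eq_intros)
    from Lim_null_comparison[OF ev this]
    have "((\<lambda>s. \<nu> (\<mu> + s)) \<longlongrightarrow> \<nu> \<mu>) (at 0)"
      by (simp add: LIM_zero_iff)
    then show "isCont \<nu> \<mu>"
      by (simp add: isCont_iff)
  qed
  have decay: "\<nu> \<mu> * (cmod \<mu> - N f) \<le> 1" for \<mu>
  proof -
    have "N (c \<mu> * h \<mu>) \<le> N (f * h \<mu> - 1) + N (c \<mu> * h \<mu> - (f * h \<mu> - 1))"
      by (intro N_le R_intros hR f)
    also have "c \<mu> * h \<mu> - (f * h \<mu> - 1) = 1 - h \<mu> * (f - c \<mu>)"
      by (simp add: algebra_simps)
    also have "N (f * h \<mu> - 1) \<le> N (f * h \<mu>) + N 1"
      using N_add[of "f * h \<mu>" "- 1"] N_minus[OF R_1] hR f by (simp add: R_intros)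
    also have "N (f * h \<mu>) \<le> N f * \<nu> \<mu>"
      unfolding \<nu>_def by (intro N_mult hR f)
    finally show ?thesis
      using N1(2) h'[of \<mu>] N_c_mult_eq[OF hR, of \<mu> \<mu>] by (simp add: \<nu>_def algebra_simps)
  qed
  \<comment> \<open>Beyond the radius \<open>B\<close> the values are smaller than \<open>\<nu> 0\<close>.\<close>
  define B where "B = N f + 2 / \<nu> 0"
  have B: "B \<ge> 0" using N_nonneg[OF f] \<nu>_pos[of 0] by (simp add: B_def)
  have far: "\<nu> \<mu> < \<nu> 0" if "cmod \<mu> > B" for \<mu>
  proof -
    have "\<nu> \<mu> * (2 / \<nu> 0) < \<nu> \<mu> * (cmod \<mu> - N f)"
      using that \<nu>_pos[of \<mu>] by (intro mult_strict_left_mono) (auto simp: B_def)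
    then have "\<nu> \<mu> * (2 / \<nu> 0) < 1" using decay[of \<mu>] by linarith
    then show ?thesis using \<nu>_pos[of 0] \<nu>_pos[of \<mu>] by (simp add: field_simps)
  qed
  obtain \<mu>\<^sub>m where \<mu>\<^sub>m: "\<mu>\<^sub>m \<in> cball 0 B" and max_ball: "\<And>\<mu>. \<mu> \<in> cball 0 B \<Longrightarrow> \<nu> \<mu> \<le> \<nu> \<mu>\<^sub>m"
    using continuous_attains_sup[of "cball 0 B" \<nu>] B continuous_on_subset[OF \<nu>_cont] by auto
  define m where "m = \<nu> \<mu>\<^sub>m"
  have le_m: "\<nu> \<mu> \<le> m" for \<mu>
    using max_ball[of \<mu>] max_ball[of 0] far[of \<mu>] B unfolding m_def by (cases "cmod \<mu> > B") auto
  define S where "S = cball 0 B \<inter> {\<mu>. \<nu> \<mu> = m}"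
  have "compact S"
  proof -
    have "closed {\<mu>. \<nu> \<mu> = m}"
      using \<nu>_cont by (intro closed_Collect_eq continuous_on_const)
    then show ?thesis
      unfolding S_def by (intro compact_Int_closed compact_cball)
  qed
  moreover have "S \<noteq> {}" using \<mu>\<^sub>m by (auto simp: S_def m_def)
  ultimately obtain \<mu>\<^sub>0 where \<mu>\<^sub>0: "\<mu>\<^sub>0 \<in> S" and outer: "\<And>\<mu>. \<mu> \<in> S \<Longrightarrow> cmod \<mu> \<le> cmod \<mu>\<^sub>0"
    using continuous_attains_sup[of S cmod] continuous_on_norm_id by blast
  have m: "\<nu> \<mu>\<^sub>0 = m" "m > 0" using \<mu>\<^sub>0 \<nu>_pos[of \<mu>\<^sub>0] by (auto simp: S_def)
  \<comment> \<open>On the circle of radius \<open>1 / (2 m)\<close> about \<open>\<mu>\<^sub>0\<close> the point \<open>\<mu>\<^sub>0 + t\<close> is farthest from the origin, so \<open>\<nu> < m\<close> there.\<close>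
  define e where "e = (if \<mu>\<^sub>0 = 0 then 1 else sgn \<mu>\<^sub>0)"
  define t where "t = e / (2 * m)"
  have t: "cmod t = 1 / (2 * m)"
    using m by (auto simp: t_def e_def norm_divide norm_sgn)
  have "cmod (\<mu>\<^sub>0 + t) = cmod \<mu>\<^sub>0 + 1 / (2 * m)"
  proof (cases "\<mu>\<^sub>0 = 0")
    case False
    have "\<mu>\<^sub>0 + t = (cmod \<mu>\<^sub>0 + 1 / (2 * m)) *\<^sub>R sgn \<mu>\<^sub>0"
      using False m by (simp add: t_def e_def sgn_eq scaleR_conv_of_real field_simps)
    then show ?thesis using False m by (simp add: norm_sgn add_nonneg_nonneg)
  qed (use t in auto)
  then have "\<mu>\<^sub>0 + t \<notin> S" using outer[of "\<mu>\<^sub>0 + t"] m by auto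
  then have lt: "\<nu> (\<mu>\<^sub>0 + t) < m"
    using far[of "\<mu>\<^sub>0 + t"] le_m[of "\<mu>\<^sub>0 + t"] le_m[of 0] by (cases "\<mu>\<^sub>0 + t \<in> cball 0 B") (auto simp: S_def)
  define \<epsilon> where "\<epsilon> = (m - \<nu> (\<mu>\<^sub>0 + t)) / 2"
  have \<epsilon>: "\<epsilon> > 0" using lt by (simp add: \<epsilon>_def)
  have "continuous_on UNIV (\<lambda>\<theta>. \<nu> (\<mu>\<^sub>0 + t * cis \<theta>))"
    by (rule continuous_on_compose2[OF \<nu>_cont]) (auto intro!: continuous_intros)
  then have "isCont (\<lambda>\<theta>. \<nu> (\<mu>\<^sub>0 + t * cis \<theta>)) 0"
    by (simp add: continuous_on_eq_continuous_at)
  then obtain \<delta> where \<delta>: "\<delta> > 0" and close: "\<And>\<theta>. \<bar>\<theta>\<bar> < \<delta> \<Longrightarrow> \<bar>\<nu> (\<mu>\<^sub>0 + t * cis \<theta>) - \<nu> (\<mu>\<^sub>0 + t)\<bar> < \<epsilon>"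
    using \<epsilon> unfolding continuous_at_eps_delta by (fastforce simp: dist_real_def)
  obtain L :: nat where "2 * pi / \<delta> < L" using reals_Archimedean2 by blast
  then have "real L > 0" using \<delta> by (metis divide_pos_pos less_trans pi_gt_zero mult_pos_pos zero_less_numeral)
  then have L: "2 * pi / L < \<delta>" "L > 0"
    using \<delta> \<open>2 * pi / \<delta> < L\<close> by (auto simp: field_simps)
  \<comment> \<open>Among the \<open>L q\<close>-th roots of unity the first \<open>q\<close> have arguments below \<open>\<delta>\<close>; there \<open>\<nu>\<close> is at most \<open>m - \<epsilon>\<close>.\<close>
  have bound: "\<epsilon> \<le> (1/2) ^ q * (L * m)" if q: "q > 0" for q :: nat
  proof -
    let ?n = "L * q"
    have n: "?n > 0" using L q by simp
    let ?g = "\<lambda>j. \<nu> (\<mu>\<^sub>0 + t * cis (2 * pi * real j / ?n))"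
    have near: "?g j \<le> m - \<epsilon>" if "j < q" for j
    proof -
      have "2 * pi * real j / ?n \<le> 2 * pi * real q / ?n"
        using that n by (intro divide_right_mono mult_left_mono) auto
      also have "\<dots> = 2 * pi / L" using q by simp
      finally have "\<bar>2 * pi * real j / ?n\<bar> < \<delta>" using L by simp
      from close[OF this] have "?g j < \<nu> (\<mu>\<^sub>0 + t) + \<epsilon>" by linarith
      then show ?thesis unfolding \<epsilon>_def by argo
    qed
    have "q \<le> ?n" using L by simp
    then have "(\<Sum>j<?n. ?g j) = (\<Sum>j<q. ?g j) + (\<Sum>j=q..<?n. ?g j)"
      by (metis lessThan_atLeast0 sum.atLeastLessThan_concat zero_le)
    also have "\<dots> \<le> (\<Sum>j<q. m - \<epsilon>) + (\<Sum>j=q..<?n. m)"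
      using near le_m by (intro add_mono sum_mono) auto
    also have "\<dots> = ?n * m - q * \<epsilon>"
      using \<open>q \<le> ?n\<close> by (simp add: of_nat_diff algebra_simps)
    finally have S: "(\<Sum>j<?n. ?g j) \<le> ?n * m - q * \<epsilon>" .
    moreover have "q * \<epsilon> \<ge> 0" using \<epsilon> by simp
    ultimately have S': "(\<Sum>j<?n. ?g j) \<le> ?n * m" by linarith
    have "?n * m \<le> (\<Sum>j<?n. ?g j) * (1 + (1/2) ^ ?n)"
      using average[OF n, of \<mu>\<^sub>0 t] m t by simp
    also have "\<dots> = (\<Sum>j<?n. ?g j) + (\<Sum>j<?n. ?g j) * (1/2) ^ ?n" by (simp add: algebra_simps)
    also have "\<dots> \<le> (?n * m - q * \<epsilon>) + (?n * m) * (1/2) ^ ?n"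
      using S S' by (intro add_mono mult_right_mono) auto
    finally have "q * \<epsilon> \<le> q * (L * m) * (1/2) ^ ?n" by (simp add: algebra_simps)
    then have "\<epsilon> \<le> (L * m) * (1/2) ^ ?n" using q by (simp add: mult.assoc)
    also have "\<dots> \<le> (L * m) * (1/2) ^ q"
      using m L \<open>q \<le> ?n\<close> by (intro mult_left_mono power_decreasing) auto
    finally show ?thesis by (simp add: mult.commute)
  qed
  have "(\<lambda>q. (1/2) ^ q * (L * m)) \<longlonglongrightarrow> 0 * (L * m)"
    by (intro tendsto_intros) (auto intro: LIMSEQ_realpow_zero)
  moreover have "\<exists>q0. \<forall>q\<ge>q0. \<epsilon> \<le> (1/2) ^ q * (L * m)"
    by (intro exI[of _ 1]) (auto intro!: bound simp: Suc_le_eq)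
  ultimately have "\<epsilon> \<le> 0 * (L * m)" by (rule LIMSEQ_le_const)
  then show False using \<epsilon> by simp
qed

end


section \<open>Invariant polynomials and the trace algebra\<close>

lemma generated_algebra_incl: "S \<subseteq> generated_algebra A S"
  unfolding generated_algebra_def by blast

lemma generated_algebra_least: "S \<subseteq> B \<Longrightarrow> unital_subalgebra B A \<Longrightarrow> generated_algebra A S \<subseteq> B"
  unfolding generated_algebra_def by blast

lemma unital_subalgebra_generated:
  assumes "unital_subalgebra (carrier A) A" "S \<subseteq> carrier A"
  shows "unital_subalgebra (generated_algebra A S) A"
  using assms unfolding unital_subalgebra_def generated_algebra_def by blast

lemma unital_subalgebra_fun:
  "unital_subalgebra (carrier (fun_alg complex_alg)) (fun_alg complex_alg)"
  "unital_subalgebra (carrier (fun_alg mat_alg)) (fun_alg mat_alg)"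
  by (auto simp: unital_subalgebra_def fun_alg_def complex_alg_def mat_alg_def)

lemma polynomial_functions_closed:
  shows polynomial_coord: "(\<lambda>z. z $ k $ i $ j) \<in> polynomial_functions"
    and polynomial_const: "(\<lambda>z. a) \<in> polynomial_functions"
    and polynomial_add: "p \<in> polynomial_functions \<Longrightarrow> q \<in> polynomial_functions \<Longrightarrow> (\<lambda>z. p z + q z) \<in> polynomial_functions"
    and polynomial_mult: "p \<in> polynomial_functions \<Longrightarrow> q \<in> polynomial_functions \<Longrightarrow> (\<lambda>z. p z * q z) \<in> polynomial_functions"
proof -
  have sub: "unital_subalgebra polynomial_functions (fun_alg complex_alg)"
    unfolding polynomial_functions_def
    by (rule unital_subalgebra_generated[OF unital_subalgebra_fun(1)]) (auto simp: fun_alg_def complex_alg_def)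
  show "(\<lambda>z. z $ k $ i $ j) \<in> polynomial_functions"
    unfolding polynomial_functions_def by (rule subsetD[OF generated_algebra_incl]) blast
  have 1: "(\<lambda>z. 1) \<in> polynomial_functions" and sm: "p \<in> polynomial_functions \<Longrightarrow> (\<lambda>z. a * p z) \<in> polynomial_functions" for a p
    using sub by (auto simp: unital_subalgebra_def fun_alg_def complex_alg_def)
  show "(\<lambda>z. a) \<in> polynomial_functions" using sm[OF 1, of a] by simp
  show "p \<in> polynomial_functions \<Longrightarrow> q \<in> polynomial_functions \<Longrightarrow> (\<lambda>z. p z + q z) \<in> polynomial_functions"
    and "p \<in> polynomial_functions \<Longrightarrow> q \<in> polynomial_functions \<Longrightarrow> (\<lambda>z. p z * q z) \<in> polynomial_functions"
    using sub by (auto simp: unital_subalgebra_def fun_alg_def complex_alg_def)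
qed

lemma polynomial_sum: "(\<And>i. i \<in> S \<Longrightarrow> f i \<in> polynomial_functions) \<Longrightarrow> (\<lambda>z. \<Sum>i\<in>S. f i z) \<in> polynomial_functions"
  by (induction S rule: infinite_finite_induct) (auto intro: polynomial_const polynomial_add)

lemma polynomial_continuous:
  assumes "p \<in> polynomial_functions" shows "continuous_on UNIV p"
proof -
  have "polynomial_functions \<subseteq> {p. continuous_on UNIV p}"
    unfolding polynomial_functions_def
    by (rule generated_algebra_least)
      (auto simp: unital_subalgebra_def fun_alg_def complex_alg_def intro!: continuous_intros)
  then show ?thesis using assms by blast
qed

lemma I0_const: "(\<lambda>z. a) \<in> I0"
  and I0_add: "p \<in> I0 \<Longrightarrow> q \<in> I0 \<Longrightarrow> (\<lambda>z. p z + q z) \<in> I0"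
  and I0_mult: "p \<in> I0 \<Longrightarrow> q \<in> I0 \<Longrightarrow> (\<lambda>z. p z * q z) \<in> I0"
  by (auto simp: I0_def polynomial_functions_closed)

lemma I0_sum: "(\<And>i. i \<in> S \<Longrightarrow> f i \<in> I0) \<Longrightarrow> (\<lambda>z. \<Sum>i\<in>S. f i z) \<in> I0"
  by (induction S rule: infinite_finite_induct) (auto intro: I0_const I0_add)

lemma I0_prod: "(\<And>i. i \<in> S \<Longrightarrow> f i \<in> I0) \<Longrightarrow> (\<lambda>z. \<Prod>i\<in>S. f i z) \<in> I0"
  by (induction S rule: infinite_finite_induct) (auto intro: I0_const I0_mult)

lemma I0_det:
  fixes G :: "('n::finite, 'd::finite) tuple \<Rightarrow> complex^'k^'k"
  assumes "\<And>i j. (\<lambda>z. G z $ i $ j) \<in> I0"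
  shows "(\<lambda>z. det (G z)) \<in> I0"
  unfolding det_def by (intro I0_sum I0_mult I0_prod I0_const assms)

lemma I0_continuous: "p \<in> I0 \<Longrightarrow> continuous_on S p"
  using polynomial_continuous[of p] continuous_on_subset[of UNIV p S] by (simp add: I0_def)

lemma S0_closed:
  shows S0_I0: "p \<in> I0 \<Longrightarrow> (\<lambda>z. cscale (p z) (mat 1)) \<in> S0"
    and S0_G0: "F \<in> G0 \<Longrightarrow> F \<in> S0"
    and S0_one: "(\<lambda>z. mat 1) \<in> S0"
    and S0_add: "F \<in> S0 \<Longrightarrow> H \<in> S0 \<Longrightarrow> (\<lambda>z. F z + H z) \<in> S0"
    and S0_mult: "F \<in> S0 \<Longrightarrow> H \<in> S0 \<Longrightarrow> (\<lambda>z. F z ** H z) \<in> S0"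
    and S0_scale: "F \<in> S0 \<Longrightarrow> (\<lambda>z. cscale c (F z)) \<in> S0"
proof -
  have sub: "unital_subalgebra S0 (fun_alg mat_alg)"
    unfolding S0_def
    by (rule unital_subalgebra_generated[OF unital_subalgebra_fun(2)]) (auto simp: fun_alg_def mat_alg_def)
  show "p \<in> I0 \<Longrightarrow> (\<lambda>z. cscale (p z) (mat 1)) \<in> S0" "F \<in> G0 \<Longrightarrow> F \<in> S0"
    unfolding S0_def by (rule subsetD[OF generated_algebra_incl], blast)+
  show "(\<lambda>z. mat 1) \<in> S0"
    "F \<in> S0 \<Longrightarrow> H \<in> S0 \<Longrightarrow> (\<lambda>z. F z + H z) \<in> S0"
    "F \<in> S0 \<Longrightarrow> H \<in> S0 \<Longrightarrow> (\<lambda>z. F z ** H z) \<in> S0"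
    "F \<in> S0 \<Longrightarrow> (\<lambda>z. cscale c (F z)) \<in> S0"
    using sub by (auto simp: unital_subalgebra_def fun_alg_def mat_alg_def)
qed

lemma cscale_component [simp]: "cscale c A $ i $ j = c * A $ i $ j"
  by (simp add: cscale_def)

lemma mat_mult_component: "(A ** B) $ i $ j = (\<Sum>k\<in>UNIV. A $ i $ k * B $ k $ j)"
  by (simp add: matrix_matrix_mult_def)

lemma matrix_inv_mult:
  fixes s :: "complex^'n^'n"
  assumes "invertible s"
  shows "s ** matrix_inv s = mat 1" "matrix_inv s ** s = mat 1"
  using someI_ex[OF assms[unfolded invertible_def]] unfolding matrix_inv_def by auto

lemma conj_mat_add: "conj_mat s (A + B) = conj_mat s A + conj_mat s B"
  by (simp add: conj_mat_def vec_eq_iff mat_mult_component algebra_simps sum.distrib)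

lemma conj_mat_cscale: "conj_mat s (cscale c A) = cscale c (conj_mat s A)"
  by (simp add: conj_mat_def vec_eq_iff mat_mult_component sum_distrib_left sum_distrib_right mult_ac)

lemma conj_mat_mult:
  assumes "invertible s"
  shows "conj_mat s (A ** B) = conj_mat s A ** conj_mat s B"
proof -
  have "conj_mat s A ** conj_mat s B = matrix_inv s ** A ** (s ** matrix_inv s) ** B ** s"
    by (simp add: conj_mat_def matrix_mul_assoc)
  then show ?thesis
    by (simp add: matrix_inv_mult[OF assms] conj_mat_def matrix_mul_assoc)
qed

lemma conj_mat_one:
  assumes "invertible s" shows "conj_mat s (mat 1) = mat 1"
  by (simp add: conj_mat_def matrix_inv_mult[OF assms])

lemma trace_conj_mat:
  fixes A :: "complex^'n^'n"
  assumes "invertible s" shows "trace (conj_mat s A) = trace A"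
proof -
  have "trace (conj_mat s A) = trace (s ** (matrix_inv s ** A))"
    unfolding conj_mat_def by (rule trace_mul_sym)
  then show ?thesis by (simp add: matrix_mul_assoc matrix_inv_mult[OF assms])
qed

text \<open>The matrix functions with polynomial entries that are equivariant under conjugation form an algebra that contains
  the generators of \<open>S0\<close>.\<close>

lemma S0_polynomial_equivariant:
  assumes "F \<in> S0"
  shows "(\<lambda>z. F z $ i $ j) \<in> polynomial_functions"
    and "invertible s \<Longrightarrow> F (conj_tuple s z) = conj_mat s (F z)"
proof -
  let ?B = "{F :: ('a, 'b) tuple \<Rightarrow> complex^'a^'a. (\<forall>i j. (\<lambda>z. F z $ i $ j) \<in> polynomial_functions) \<and>
     (\<forall>s z. invertible s \<longrightarrow> F (conj_tuple s z) = conj_mat s (F z))}"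
  have const: "(\<lambda>z. (mat 1 :: complex^'a^'a) $ i $ j) \<in> polynomial_functions" for i j
    by (rule polynomial_const)
  have alg: "unital_subalgebra ?B (fun_alg mat_alg)"
    by (auto simp: unital_subalgebra_def fun_alg_def mat_alg_def mat_mult_component conj_mat_add conj_mat_mult
        conj_mat_one conj_mat_cscale intro!: polynomial_add polynomial_sum polynomial_mult polynomial_const)
  have "G0 \<subseteq> ?B"
    unfolding G0_def
    by (rule generated_algebra_least[OF _ alg]) (auto simp: conj_tuple_def polynomial_coord)
  moreover have "(\<lambda>z. cscale (p z) (mat 1)) \<in> ?B" if "p \<in> I0" for p
    using that by (auto simp: I0_def conj_mat_one conj_mat_cscale intro!: polynomial_mult const)
  ultimately have "S0 \<subseteq> ?B"
    unfolding S0_def by (intro generated_algebra_least[OF _ alg]) auto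
  then show "(\<lambda>z. F z $ i $ j) \<in> polynomial_functions"
    and "invertible s \<Longrightarrow> F (conj_tuple s z) = conj_mat s (F z)"
    using assms by blast+
qed

lemma I0_trace_S0:
  assumes "F \<in> S0" shows "(\<lambda>z. trace (F z)) \<in> I0"
proof -
  have "(\<lambda>z. trace (F z)) \<in> polynomial_functions"
    unfolding trace_def by (intro polynomial_sum S0_polynomial_equivariant(1) assms)
  then show ?thesis
    by (simp add: I0_def S0_polynomial_equivariant(2)[OF assms] trace_conj_mat)
qed

text \<open>At a generating tuple the coordinate functions generate all matrices.\<close>

lemma G0_value:
  assumes z: "z \<in> generating_tuples"
  shows "\<exists>F\<in>G0. F z = A"
proof -
  have sub: "unital_subalgebra G0 (fun_alg mat_alg)"
    unfolding G0_def
    by (rule unital_subalgebra_generated[OF unital_subalgebra_fun(2)]) (auto simp: fun_alg_def mat_alg_def)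
  have "unital_subalgebra ((\<lambda>F. F z) ` G0) mat_alg"
    using sub unfolding unital_subalgebra_def fun_alg_def mat_alg_def
    by (auto intro!: image_eqI[where f = "\<lambda>F. F z"])
  moreover have "range (\<lambda>k. z $ k) \<subseteq> (\<lambda>F. F z) ` G0"
    using generated_algebra_incl[of "range (\<lambda>k z. z $ k)" "fun_alg mat_alg"] unfolding G0_def by auto
  ultimately have "generated_algebra mat_alg (range (\<lambda>k. z $ k)) \<subseteq> (\<lambda>F. F z) ` G0"
    by (intro generated_algebra_least)
  then have "A \<in> (\<lambda>F. F z) ` G0" using z by (auto simp: generating_tuples_def)
  then show ?thesis by blast
qed

section \<open>Uniform limits of invariant polynomials\<close>

text \<open>The algebra of uniform limits on \<open>P\<close> of invariant polynomials. Its elements are functions on all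
  tuples, of which only the values on \<open>P\<close> matter.\<close>

definition I0_limits :: "('n::finite, 'd::finite) tuple set \<Rightarrow> (('n, 'd) tuple \<Rightarrow> complex) set" where
  "I0_limits P = {f. \<forall>\<epsilon>>0. \<exists>p\<in>I0. \<forall>z\<in>P. cmod (f z - p z) \<le> \<epsilon>}"

lemma I0_limitsI: "(\<And>\<epsilon>. \<epsilon> > 0 \<Longrightarrow> \<exists>p\<in>I0. \<forall>z\<in>P. cmod (f z - p z) \<le> \<epsilon>) \<Longrightarrow> f \<in> I0_limits P"
  by (simp add: I0_limits_def)

lemma I0_limitsD:
  assumes "f \<in> I0_limits P" "\<epsilon> > 0"
  obtains p where "p \<in> I0" "\<And>z. z \<in> P \<Longrightarrow> cmod (f z - p z) \<le> \<epsilon>"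
  using assms by (auto simp: I0_limits_def)

lemma I0_limits_I0: "p \<in> I0 \<Longrightarrow> p \<in> I0_limits P"
  by (rule I0_limitsI) (auto intro!: bexI[of _ p])

lemma I0_limits_cong: "f \<in> I0_limits P \<Longrightarrow> (\<And>z. z \<in> P \<Longrightarrow> g z = f z) \<Longrightarrow> g \<in> I0_limits P"
  by (simp add: I0_limits_def)

lemma I0_limits_closed:
  assumes "\<And>\<epsilon>. \<epsilon> > 0 \<Longrightarrow> \<exists>g\<in>I0_limits P. \<forall>z\<in>P. cmod (f z - g z) \<le> \<epsilon>"
  shows "f \<in> I0_limits P"
proof (rule I0_limitsI)
  fix \<epsilon> :: real assume "\<epsilon> > 0"
  then have e: "\<epsilon> / 2 > 0" by simp
  obtain g where g: "g \<in> I0_limits P" "\<forall>z\<in>P. cmod (f z - g z) \<le> \<epsilon> / 2" using assms[OF e] by blast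
  obtain p where p: "p \<in> I0" "\<And>z. z \<in> P \<Longrightarrow> cmod (g z - p z) \<le> \<epsilon> / 2" using I0_limitsD[OF g(1) e] by blast
  have "cmod (f z - p z) \<le> \<epsilon>" if "z \<in> P" for z
    using norm_triangle_ineq[of "f z - g z" "g z - p z"] g(2) p(2)[OF that] that by (simp add: field_simps) (smt (verit))
  then show "\<exists>p\<in>I0. \<forall>z\<in>P. cmod (f z - p z) \<le> \<epsilon>" using p(1) by blast
qed

lemma I0_bounded:
  assumes "compact P" "p \<in> I0"
  obtains b where "b > 0" "\<And>z. z \<in> P \<Longrightarrow> cmod (p z) \<le> b"
proof -
  have "bounded (p ` P)"
    using assms I0_continuous compact_continuous_image compact_imp_bounded by blast
  then show thesis using that by (auto simp: bounded_pos)
qed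

lemma I0_limits_bounded:
  assumes "compact P" "f \<in> I0_limits P"
  obtains b where "b > 0" "\<And>z. z \<in> P \<Longrightarrow> cmod (f z) \<le> b"
proof -
  obtain p where p: "p \<in> I0" "\<And>z. z \<in> P \<Longrightarrow> cmod (f z - p z) \<le> 1"
    using I0_limitsD[OF assms(2), of 1] by auto
  obtain b where b: "b > 0" "\<And>z. z \<in> P \<Longrightarrow> cmod (p z) \<le> b" using I0_bounded[OF assms(1) p(1)] by blast
  have "cmod (f z) \<le> b + 1" if "z \<in> P" for z
    using norm_triangle_ineq[of "f z - p z" "p z"] p(2)[OF that] b(2)[OF that] by simp
  then show thesis using that[of "b + 1"] b(1) by simp
qed

lemma I0_limits_add:
  assumes "f \<in> I0_limits P" "g \<in> I0_limits P"
  shows "(\<lambda>z. f z + g z) \<in> I0_limits P"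
proof (rule I0_limitsI)
  fix \<epsilon> :: real assume "\<epsilon> > 0"
  then have e: "\<epsilon> / 2 > 0" by simp
  obtain p where p: "p \<in> I0" "\<And>z. z \<in> P \<Longrightarrow> cmod (f z - p z) \<le> \<epsilon> / 2" using I0_limitsD[OF assms(1) e] by blast
  obtain q where q: "q \<in> I0" "\<And>z. z \<in> P \<Longrightarrow> cmod (g z - q z) \<le> \<epsilon> / 2" using I0_limitsD[OF assms(2) e] by blast
  have "cmod (f z + g z - (p z + q z)) \<le> \<epsilon>" if "z \<in> P" for z
    using norm_triangle_ineq[of "f z - p z" "g z - q z"] p(2)[OF that] q(2)[OF that] by (simp add: algebra_simps)
  then show "\<exists>p\<in>I0. \<forall>z\<in>P. cmod (f z + g z - p z) \<le> \<epsilon>" by (intro bexI[OF _ I0_add[OF p(1) q(1)]]) simp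
qed

lemma I0_limits_mult:
  assumes P: "compact P" and f: "f \<in> I0_limits P" and g: "g \<in> I0_limits P"
  shows "(\<lambda>z. f z * g z) \<in> I0_limits P"
proof (rule I0_limitsI)
  fix \<epsilon> :: real assume e: "\<epsilon> > 0"
  obtain b where b: "b > 0" "\<And>z. z \<in> P \<Longrightarrow> cmod (g z) \<le> b" using I0_limits_bounded[OF P g] by blast
  obtain p where p: "p \<in> I0" "\<And>z. z \<in> P \<Longrightarrow> cmod (f z - p z) \<le> \<epsilon> / (2 * b)"
    using I0_limitsD[OF f, of "\<epsilon> / (2 * b)"] e b by auto
  obtain b' where b': "b' > 0" "\<And>z. z \<in> P \<Longrightarrow> cmod (p z) \<le> b'" using I0_bounded[OF P p(1)] by blast
  obtain q where q: "q \<in> I0" "\<And>z. z \<in> P \<Longrightarrow> cmod (g z - q z) \<le> \<epsilon> / (2 * b')"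
    using I0_limitsD[OF g, of "\<epsilon> / (2 * b')"] e b' by auto
  have "cmod (f z * g z - p z * q z) \<le> \<epsilon>" if z: "z \<in> P" for z
  proof -
    have "f z * g z - p z * q z = (f z - p z) * g z + p z * (g z - q z)" by (simp add: algebra_simps)
    also have "cmod \<dots> \<le> cmod (f z - p z) * cmod (g z) + cmod (p z) * cmod (g z - q z)"
      by (metis norm_mult norm_triangle_ineq)
    also have "\<dots> \<le> \<epsilon> / (2 * b) * b + b' * (\<epsilon> / (2 * b'))"
      using p(2)[OF z] b(2)[OF z] q(2)[OF z] b'(2)[OF z] e b(1) b'(1) by (intro add_mono mult_mono) auto
    also have "\<dots> = \<epsilon>" using b(1) b'(1) by simp
    finally show ?thesis .
  qed
  then show "\<exists>p\<in>I0. \<forall>z\<in>P. cmod (f z * g z - p z) \<le> \<epsilon>" by (intro bexI[OF _ I0_mult[OF p(1) q(1)]]) simp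
qed

lemma I0_limits_sum: "(\<And>i. i \<in> S \<Longrightarrow> f i \<in> I0_limits P) \<Longrightarrow> (\<lambda>z. \<Sum>i\<in>S. f i z) \<in> I0_limits P"
  by (induction S rule: infinite_finite_induct) (auto intro: I0_limits_add I0_limits_I0 I0_const)

lemma I0_limits_diff:
  assumes "compact P" "f \<in> I0_limits P" "g \<in> I0_limits P"
  shows "(\<lambda>z. f z - g z) \<in> I0_limits P"
  using I0_limits_add[OF assms(2) I0_limits_mult[OF assms(1) I0_limits_I0[OF I0_const[of "-1"]] assms(3)]] by simp

lemma I0_limits_power: "compact P \<Longrightarrow> f \<in> I0_limits P \<Longrightarrow> (\<lambda>z. f z ^ k) \<in> I0_limits P"
  by (induction k) (auto intro: I0_limits_mult I0_limits_I0 I0_const)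

text \<open>The inverse is a uniformly convergent geometric series.\<close>

lemma I0_limits_inverse:
  assumes P: "compact P" and f: "f \<in> I0_limits P"
    and r: "\<And>z. z \<in> P \<Longrightarrow> cmod (f z - a) \<le> r" "r < cmod a"
  shows "(\<lambda>z. 1 / f z) \<in> I0_limits P"
proof (cases "P = {}")
  case True
  then show ?thesis by (auto simp: I0_limits_def intro: I0_const)
next
  case False
  then have r0: "0 \<le> r" using r(1) norm_ge_zero order_trans by blast
  have a: "a \<noteq> 0" using r(2) r0 by auto
  define \<rho> where "\<rho> = r / cmod a"
  have \<rho>: "0 \<le> \<rho>" "\<rho> < 1" using r0 r(2) a by (auto simp: \<rho>_def divide_less_eq)
  define u where "u z = 1 - f z / a" for z
  have u: "u \<in> I0_limits P"
    unfolding u_def using I0_limits_diff[OF P I0_limits_I0[OF I0_const[of 1]] I0_limits_mult[OF P f I0_limits_I0[OF I0_const[of "1 / a"]]]] by simp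
  have ub: "cmod (u z) \<le> \<rho>" if "z \<in> P" for z
  proof -
    have "u z = - ((f z - a) / a)" using a by (simp add: u_def field_simps)
    then have "cmod (u z) = cmod (f z - a) / cmod a" by (simp only: norm_minus_cancel norm_divide)
    then show ?thesis using r(1)[OF that] by (simp add: \<rho>_def divide_right_mono)
  qed
  show ?thesis
  proof (rule I0_limits_closed)
    fix \<epsilon> :: real assume e: "\<epsilon> > 0"
    have "(\<lambda>k. \<rho> ^ k / ((1 - \<rho>) * cmod a)) \<longlonglongrightarrow> 0 / ((1 - \<rho>) * cmod a)"
      by (rule tendsto_divide[OF LIMSEQ_realpow_zero tendsto_const]) (use \<rho> a in auto)
    then have "eventually (\<lambda>k. \<rho> ^ k / ((1 - \<rho>) * cmod a) < \<epsilon>) sequentially"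
      using e by (simp add: order_tendstoD(2))
    then obtain k where k: "\<rho> ^ k / ((1 - \<rho>) * cmod a) < \<epsilon>"
      by (auto simp: eventually_sequentially)
    define g where "g z = (1 / a) * (\<Sum>i<k. u z ^ i)" for z
    have g: "g \<in> I0_limits P"
      unfolding g_def by (intro I0_limits_mult P I0_limits_sum I0_limits_power u I0_limits_I0 I0_const)
    have "cmod (1 / f z - g z) \<le> \<epsilon>" if z: "z \<in> P" for z
    proof -
      have u1: "1 - \<rho> \<le> cmod (1 - u z)"
        using norm_triangle_ineq2[of 1 "u z"] ub[OF z] by simp
      then have "u z \<noteq> 1" using \<rho> by auto
      have fz: "f z = a * (1 - u z)" using a by (simp add: u_def field_simps)
      have "1 / f z - g z = u z ^ k / (a * (1 - u z))"
        using \<open>u z \<noteq> 1\<close> a by (simp add: fz g_def sum_gp_strict field_simps)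
      then have "cmod (1 / f z - g z) = cmod (u z) ^ k / (cmod a * cmod (1 - u z))"
        by (simp only: norm_divide norm_mult norm_power)
      also have "\<dots> \<le> \<rho> ^ k / (cmod a * (1 - \<rho>))"
        using ub[OF z] u1 \<rho> a by (intro frac_le mult_left_mono power_mono mult_pos_pos) auto
      finally show ?thesis using k by (simp add: mult.commute)
    qed
    then show "\<exists>g\<in>I0_limits P. \<forall>z\<in>P. cmod (1 / f z - g z) \<le> \<epsilon>" using g by blast
  qed
qed


section \<open>Ideals of limits of invariants have zeros\<close>

text \<open>Ideals of \<open>I0_limits P\<close>, required to be closed under changes of a function outside \<open>P\<close>.\<close>

definition I0_limits_ideal :: "('n::finite, 'd::finite) tuple set \<Rightarrow> (('n, 'd) tuple \<Rightarrow> complex) set \<Rightarrow> bool" where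
  "I0_limits_ideal P J \<longleftrightarrow> J \<subseteq> I0_limits P \<and> 0 \<in> J \<and> (\<forall>f\<in>J. \<forall>g\<in>J. f + g \<in> J) \<and>
     (\<forall>f\<in>I0_limits P. \<forall>g\<in>J. f * g \<in> J) \<and> (\<forall>f\<in>J. \<forall>g. (\<forall>z\<in>P. g z = f z) \<longrightarrow> g \<in> J)"

lemma I0_limits_idealD:
  assumes "I0_limits_ideal P J"
  shows "f \<in> J \<Longrightarrow> f \<in> I0_limits P"
    and "0 \<in> J"
    and "f \<in> J \<Longrightarrow> g \<in> J \<Longrightarrow> f + g \<in> J"
    and "f \<in> I0_limits P \<Longrightarrow> g \<in> J \<Longrightarrow> f * g \<in> J"
    and "f \<in> J \<Longrightarrow> (\<And>z. z \<in> P \<Longrightarrow> g z = f z) \<Longrightarrow> g \<in> J"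
proof -
  note * = assms[unfolded I0_limits_ideal_def]
  show "f \<in> J \<Longrightarrow> f \<in> I0_limits P" "0 \<in> J"
    using * by blast+
  note add = *[THEN conjunct2, THEN conjunct2, THEN conjunct1]
    and mult = *[THEN conjunct2, THEN conjunct2, THEN conjunct2, THEN conjunct1]
    and cong = *[THEN conjunct2, THEN conjunct2, THEN conjunct2, THEN conjunct2]
  show "f \<in> J \<Longrightarrow> g \<in> J \<Longrightarrow> f + g \<in> J" using add by (drule_tac bspec) (assumption, erule bspec)
  show "f \<in> I0_limits P \<Longrightarrow> g \<in> J \<Longrightarrow> f * g \<in> J" using mult by (drule_tac bspec) (assumption, erule bspec)
  show "f \<in> J \<Longrightarrow> (\<And>z. z \<in> P \<Longrightarrow> g z = f z) \<Longrightarrow> g \<in> J" using cong by blast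
qed

lemma I0_limits_ideal_Union:
  assumes "C \<noteq> {}" and "\<And>J. J \<in> C \<Longrightarrow> I0_limits_ideal P J"
    and chain: "\<And>J J'. J \<in> C \<Longrightarrow> J' \<in> C \<Longrightarrow> J \<subseteq> J' \<or> J' \<subseteq> J"
  shows "I0_limits_ideal P (\<Union>C)"
  unfolding I0_limits_ideal_def
proof (intro conjI ballI allI impI)
  show "\<Union>C \<subseteq> I0_limits P" using I0_limits_idealD(1)[OF assms(2)] by blast
  obtain J where "J \<in> C" using assms(1) by blast
  then show "0 \<in> \<Union>C" using I0_limits_idealD(2)[OF assms(2)] by blast
next
  fix f g assume "f \<in> \<Union>C" "g \<in> \<Union>C"
  then obtain J J' where "J \<in> C" "J' \<in> C" "f \<in> J" "g \<in> J'" by blast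
  then obtain L where L: "L \<in> C" "f \<in> L" "g \<in> L" using chain[of J J'] by blast
  then show "f + g \<in> \<Union>C" using I0_limits_idealD(3)[OF assms(2)[OF L(1)] L(2,3)] by blast
next
  fix f g assume f: "f \<in> I0_limits P" and "g \<in> \<Union>C"
  then obtain L where L: "L \<in> C" "g \<in> L" by blast
  then show "f * g \<in> \<Union>C" using I0_limits_idealD(4)[OF assms(2)[OF L(1)] f L(2)] by blast
next
  fix f g assume "f \<in> \<Union>C" and eq: "\<forall>z\<in>P. g z = f z"
  then obtain L where L: "L \<in> C" "f \<in> L" by blast
  have "g \<in> L" by (rule I0_limits_idealD(5)[OF assms(2)[OF L(1)] L(2)]) (use eq in blast)
  then show "g \<in> \<Union>C" using L(1) by blast
qed

context
  fixes P :: "('n::finite, 'd::finite) tuple set"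
  assumes compact: "compact P" and nonempty: "P \<noteq> {}"
begin

text \<open>The supremum norm on \<open>P\<close>.\<close>

definition sup_on :: "(('n, 'd) tuple \<Rightarrow> complex) \<Rightarrow> real" where
  "sup_on f = (SUP z\<in>P. cmod (f z))"

lemma sup_on_upper:
  assumes "f \<in> I0_limits P" "z \<in> P" shows "cmod (f z) \<le> sup_on f"
proof -
  obtain b where "\<And>z. z \<in> P \<Longrightarrow> cmod (f z) \<le> b" using I0_limits_bounded[OF compact assms(1)] by blast
  then show ?thesis unfolding sup_on_def by (intro cSUP_upper assms(2) bdd_aboveI2)
qed

lemma sup_on_least: "(\<And>z. z \<in> P \<Longrightarrow> cmod (f z) \<le> b) \<Longrightarrow> sup_on f \<le> b"
  unfolding sup_on_def by (rule cSUP_least[OF nonempty])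

lemma sup_on_nonneg: assumes "f \<in> I0_limits P" shows "0 \<le> sup_on f"
proof -
  obtain z where "z \<in> P" using nonempty by blast
  from sup_on_upper[OF assms this] show ?thesis using norm_ge_zero[of "f z"] by linarith
qed

lemma limits_closed:
  shows limits_add: "f \<in> I0_limits P \<Longrightarrow> g \<in> I0_limits P \<Longrightarrow> f + g \<in> I0_limits P"
    and limits_mult: "f \<in> I0_limits P \<Longrightarrow> g \<in> I0_limits P \<Longrightarrow> f * g \<in> I0_limits P"
    and limits_diff: "f \<in> I0_limits P \<Longrightarrow> g \<in> I0_limits P \<Longrightarrow> f - g \<in> I0_limits P"
    and limits_const: "(\<lambda>z. a) \<in> I0_limits P"
    and limits_one: "1 \<in> I0_limits P"
  using I0_limits_add[of f P g] I0_limits_mult[OF compact, of f g] I0_limits_diff[OF compact, of f g]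
    I0_limits_I0[OF I0_const[of a], of P] I0_limits_I0[OF I0_const[of 1], of P]
  by (simp_all add: plus_fun_def times_fun_def fun_diff_def one_fun_def)

context
  fixes m
  assumes ideal: "I0_limits_ideal P m" and proper: "1 \<notin> m"
begin

lemmas m_sub = I0_limits_idealD(1)[OF ideal] and m_0 = I0_limits_idealD(2)[OF ideal]
  and m_add = I0_limits_idealD(3)[OF ideal] and m_mult = I0_limits_idealD(4)[OF ideal]
  and m_cong = I0_limits_idealD(5)[OF ideal]

lemma m_diff: assumes "f \<in> m" "g \<in> m" shows "f - g \<in> m"
proof -
  have "f - g = f + (\<lambda>z. -1) * g" by (simp add: fun_eq_iff)
  then show ?thesis using m_add[OF assms(1) m_mult[OF limits_const assms(2), of "-1"]] by (simp only:)
qed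

text \<open>An element of a proper ideal cannot be uniformly close to a non-zero constant.\<close>

lemma m_not_near_const:
  assumes g: "g \<in> m" and "\<And>z. z \<in> P \<Longrightarrow> cmod (g z - a) \<le> r" shows "cmod a \<le> r"
proof (rule ccontr)
  assume "\<not> cmod a \<le> r"
  then have lt: "r < cmod a" by simp
  have inv: "(\<lambda>z. 1 / g z) \<in> I0_limits P"
    using I0_limits_inverse[OF compact m_sub[OF g] assms(2) lt] .
  have "g z \<noteq> 0" if "z \<in> P" for z
    using assms(2)[OF that] lt by auto
  then have "1 \<in> m"
    using m_cong[OF m_mult[OF inv g], of 1] by simp
  with proper show False ..
qed

text \<open>The quotient norm modulo the ideal \<open>m\<close>.\<close>

definition quot_norm :: "(('n, 'd) tuple \<Rightarrow> complex) \<Rightarrow> real" where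
  "quot_norm f = (INF g\<in>m. sup_on (f - g))"

lemma quot_norm_le:
  assumes "f \<in> I0_limits P" "g \<in> m" shows "quot_norm f \<le> sup_on (f - g)"
  unfolding quot_norm_def
  by (rule cINF_lower[OF _ assms(2)]) (intro bdd_belowI2[of m 0] sup_on_nonneg limits_diff[OF assms(1)] m_sub)

lemma quot_norm_less:
  assumes "f \<in> I0_limits P" "\<epsilon> > 0"
  obtains g where "g \<in> m" "sup_on (f - g) < quot_norm f + \<epsilon>"
proof -
  have "Inf ((\<lambda>g. sup_on (f - g)) ` m) < quot_norm f + \<epsilon>" using assms(2) by (simp add: quot_norm_def)
  then obtain x where "x \<in> (\<lambda>g. sup_on (f - g)) ` m" "x < quot_norm f + \<epsilon>"
    using cInf_lessD[of "(\<lambda>g. sup_on (f - g)) ` m"] m_0 by auto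
  then show thesis using that by blast
qed

lemma quot_norm_nonneg: "f \<in> I0_limits P \<Longrightarrow> 0 \<le> quot_norm f"
  unfolding quot_norm_def using m_0 by (intro cINF_greatest sup_on_nonneg limits_diff) (auto intro: m_sub)

lemma quot_norm_zero: "f \<in> m \<Longrightarrow> quot_norm f = 0"
  using quot_norm_le[of f f] quot_norm_nonneg[of f] sup_on_least[of 0 0] m_sub[of f] by simp

lemma seminormed_quotient: "seminormed_algebra (I0_limits P) (\<lambda>a z. a) quot_norm"
proof
  show "quot_norm (f + g) \<le> quot_norm f + quot_norm g" if f: "f \<in> I0_limits P" and g: "g \<in> I0_limits P" for f g
  proof (rule field_le_epsilon)
    fix e :: real assume "e > 0"
    then have e: "e / 2 > 0" by simp
    obtain f' where f': "f' \<in> m" "sup_on (f - f') < quot_norm f + e / 2" using quot_norm_less[OF f e] by blast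
    obtain g' where g': "g' \<in> m" "sup_on (g - g') < quot_norm g + e / 2" using quot_norm_less[OF g e] by blast
    have "quot_norm (f + g) \<le> sup_on (f + g - (f' + g'))"
      by (intro quot_norm_le limits_add f g m_add f' g')
    also have "\<dots> \<le> sup_on (f - f') + sup_on (g - g')"
    proof (rule sup_on_least)
      fix z assume z: "z \<in> P"
      have "(f + g - (f' + g')) z = (f - f') z + (g - g') z" by simp
      also have "cmod \<dots> \<le> cmod ((f - f') z) + cmod ((g - g') z)" by (rule norm_triangle_ineq)
      also have "\<dots> \<le> sup_on (f - f') + sup_on (g - g')"
        by (intro add_mono sup_on_upper z limits_diff f g m_sub f' g')
      finally show "cmod ((f + g - (f' + g')) z) \<le> sup_on (f - f') + sup_on (g - g')" .
    qed
    finally show "quot_norm (f + g) \<le> quot_norm f + quot_norm g + e" using f'(2) g'(2) by linarith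
  qed
  show "quot_norm (f * g) \<le> quot_norm f * quot_norm g" if f: "f \<in> I0_limits P" and g: "g \<in> I0_limits P" for f g
  proof -
    have *: "quot_norm (f * g) \<le> (quot_norm f + e) * (quot_norm g + e)" if e: "e > 0" for e
    proof -
      obtain f' where f': "f' \<in> m" "sup_on (f - f') < quot_norm f + e" using quot_norm_less[OF f e] by blast
      obtain g' where g': "g' \<in> m" "sup_on (g - g') < quot_norm g + e" using quot_norm_less[OF g e] by blast
      have "g * f' + (f - f') * g' \<in> m"
        by (intro m_add m_mult g limits_diff f m_sub f' g')
      then have "quot_norm (f * g) \<le> sup_on (f * g - (g * f' + (f - f') * g'))"
        by (intro quot_norm_le limits_mult f g)
      also have "\<dots> \<le> sup_on (f - f') * sup_on (g - g')"
      proof (rule sup_on_least)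
        fix z assume z: "z \<in> P"
        have "(f * g - (g * f' + (f - f') * g')) z = (f - f') z * (g - g') z" by (simp add: algebra_simps)
        also have "cmod \<dots> = cmod ((f - f') z) * cmod ((g - g') z)" by (rule norm_mult)
        also have "\<dots> \<le> sup_on (f - f') * sup_on (g - g')"
          by (intro mult_mono sup_on_upper z limits_diff f g m_sub f' g' norm_ge_zero sup_on_nonneg)
        finally show "cmod ((f * g - (g * f' + (f - f') * g')) z) \<le> sup_on (f - f') * sup_on (g - g')" .
      qed
      also have "\<dots> \<le> (quot_norm f + e) * (quot_norm g + e)"
        using f'(2) g'(2) e quot_norm_nonneg[OF f] quot_norm_nonneg[OF g]
          sup_on_nonneg[OF limits_diff[OF f m_sub[OF f'(1)]]] sup_on_nonneg[OF limits_diff[OF g m_sub[OF g'(1)]]]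
        by (intro mult_mono) auto
      finally show ?thesis .
    qed
    have "((\<lambda>e. (quot_norm f + e) * (quot_norm g + e)) \<longlongrightarrow> (quot_norm f + 0) * (quot_norm g + 0)) (at_right 0)"
      by (intro tendsto_intros)
    then have "quot_norm (f * g) \<le> (quot_norm f + 0) * (quot_norm g + 0)"
      by (rule tendsto_lowerbound) (auto simp: eventually_at_right_less intro!: eventually_mono[OF eventually_at_right_less] *)
    then show ?thesis by simp
  qed
  show "quot_norm (\<lambda>z. a) \<le> cmod a" for a
    using quot_norm_le[OF limits_const m_0, of a] sup_on_least[of "\<lambda>z. a" "cmod a"] by (simp add: fun_diff_def)
  show "quot_norm 1 \<noteq> 0"
  proof
    assume "quot_norm 1 = 0"
    then obtain g where g: "g \<in> m" "sup_on (1 - g) < 1 / 2"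
      using quot_norm_less[OF limits_one, of "1 / 2"] by auto
    have "cmod (g z - 1) \<le> 1 / 2" if "z \<in> P" for z
      using sup_on_upper[OF limits_diff[OF limits_one m_sub[OF g(1)]] that] g(2) by (simp add: norm_minus_commute)
    from m_not_near_const[OF g(1) this] show False by simp
  qed
qed (auto simp: fun_eq_iff intro: limits_add limits_mult limits_const quot_norm_nonneg)

context
  assumes maximal: "\<And>m'. I0_limits_ideal P m' \<Longrightarrow> m \<subseteq> m' \<Longrightarrow> 1 \<notin> m' \<Longrightarrow> m' = m"
begin

lemma inverse_mod_m:
  assumes f: "f \<in> I0_limits P" "f \<notin> m"
  shows "\<exists>h\<in>I0_limits P. h * f - 1 \<in> m"
proof -
  define m' where "m' = {h * f + k |h k. h \<in> I0_limits P \<and> k \<in> m}"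
  have "I0_limits_ideal P m'"
    unfolding I0_limits_ideal_def
  proof (intro conjI ballI allI impI)
    show "m' \<subseteq> I0_limits P" unfolding m'_def using f m_sub limits_add limits_mult by blast
    have "0 = (\<lambda>z. 0) * f + 0" by (simp add: fun_eq_iff)
    then show "0 \<in> m'" unfolding m'_def using limits_const m_0 by blast
  next
    fix u v assume "u \<in> m'" "v \<in> m'"
    then obtain h k h' k' where "u = h * f + k" "v = h' * f + k'" "h \<in> I0_limits P" "h' \<in> I0_limits P" "k \<in> m" "k' \<in> m"
      unfolding m'_def by blast
    moreover from this have "u + v = (h + h') * f + (k + k')" by (simp add: algebra_simps)
    ultimately show "u + v \<in> m'" unfolding m'_def using limits_add m_add by blast
  next
    fix u v assume "u \<in> I0_limits P" "v \<in> m'"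
    then obtain h k where "v = h * f + k" "h \<in> I0_limits P" "k \<in> m"
      unfolding m'_def by blast
    moreover from this have "u * v = (u * h) * f + u * k" by (simp add: algebra_simps)
    ultimately show "u * v \<in> m'" unfolding m'_def using \<open>u \<in> I0_limits P\<close> limits_mult m_mult by blast
  next
    fix u v assume "u \<in> m'" and eq: "\<forall>z\<in>P. v z = u z"
    then obtain h k where u: "u = h * f + k" "h \<in> I0_limits P" "k \<in> m"
      unfolding m'_def by blast
    have "k + (v - u) \<in> m" by (rule m_cong[OF u(3)]) (simp add: eq)
    moreover have "v = h * f + (k + (v - u))" by (simp add: u(1))
    ultimately show "v \<in> m'" unfolding m'_def using u(2) by blast
  qed
  moreover have "m \<subseteq> m'"
  proof
    fix k assume "k \<in> m"
    moreover have "k = (\<lambda>z. 0) * f + k" by (simp add: fun_eq_iff)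
    ultimately show "k \<in> m'" unfolding m'_def using limits_const by blast
  qed
  moreover have "f \<in> m'"
  proof -
    have "f = 1 * f + 0" by simp
    then show ?thesis unfolding m'_def using limits_one m_0 by blast
  qed
  ultimately have "1 \<in> m'" using maximal f(2) by blast
  then obtain h k where h: "1 = h * f + k" "h \<in> I0_limits P" "k \<in> m" unfolding m'_def by blast
  have "h * f - 1 = 0 - k" using h(1) by (simp add: algebra_simps)
  then have "h * f - 1 \<in> m" using m_diff[OF m_0 h(3)] by (simp only:)
  then show ?thesis using h(2) by blast
qed

lemma eigenvalue:
  assumes f: "f \<in> I0_limits P"
  shows "\<exists>a. f - (\<lambda>z. a) \<in> m"
proof -
  obtain a where a: "\<forall>h\<in>I0_limits P. quot_norm (h * (f - (\<lambda>z. a)) - 1) \<noteq> 0" 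
    using seminormed_algebra.Gelfand_Mazur[OF seminormed_quotient f] by (elim exE)
  have "f - (\<lambda>z. a) \<in> m"
    using inverse_mod_m[OF limits_diff[OF f limits_const, of a]] bspec[OF a] quot_norm_zero by auto
  then show ?thesis ..
qed

lemma eigenvalue_unique:
  assumes "f - (\<lambda>z. a) \<in> m" "f - (\<lambda>z. b) \<in> m" shows "a = b"
proof -
  have "(f - (\<lambda>z. a)) - (f - (\<lambda>z. b)) \<in> m" by (rule m_diff[OF assms])
  then have "cmod (b - a) \<le> 0" by (rule m_not_near_const) simp
  then show ?thesis by simp
qed

text \<open>The quotient by a maximal ideal is the field of complex numbers; this is the quotient map.\<close>

definition character :: "(('n, 'd) tuple \<Rightarrow> complex) \<Rightarrow> complex" where
  "character f = (THE a. f - (\<lambda>z. a) \<in> m)"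

lemma character:
  assumes "f \<in> I0_limits P" shows "f - (\<lambda>z. character f) \<in> m"
proof -
  obtain a where a: "f - (\<lambda>z. a) \<in> m" using eigenvalue[OF assms] by (elim exE)
  show ?thesis
    unfolding character_def by (rule theI[of _ a]) (rule a, rule eigenvalue_unique[OF _ a])
qed

lemma character_eqI: "f \<in> I0_limits P \<Longrightarrow> f - (\<lambda>z. a) \<in> m \<Longrightarrow> character f = a"
  by (rule eigenvalue_unique[OF character, of f]) 

lemma character_bound: "f \<in> I0_limits P \<Longrightarrow> (\<And>z. z \<in> P \<Longrightarrow> cmod (f z) \<le> b) \<Longrightarrow> cmod (character f) \<le> b"
  using m_not_near_const[OF character, of f "- character f" b] by (simp add: norm_minus_cancel)

text \<open>The character is a point of the spectrum of \<open>I0\<close>.\<close>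

lemma character_alg_hom: "restrict character I0 \<in> Q"
proof -
  have const: "character (\<lambda>z. a) = a" for a
  proof (rule character_eqI[OF limits_const])
    have "(\<lambda>z. a) - (\<lambda>z. a) = (0 :: ('n, 'd) tuple \<Rightarrow> complex)" by (simp add: fun_eq_iff)
    then show "(\<lambda>z. a) - (\<lambda>z. a) \<in> m" using m_0 by (simp only:)
  qed
  have add: "character (\<lambda>z. p z + q z) = character p + character q" if "p \<in> I0_limits P" "q \<in> I0_limits P" for p q
  proof (rule character_eqI)
    have "(\<lambda>z. p z + q z) - (\<lambda>z. character p + character q) = (p - (\<lambda>z. character p)) + (q - (\<lambda>z. character q))"
      by (simp add: fun_eq_iff)
    then show "(\<lambda>z. p z + q z) - (\<lambda>z. character p + character q) \<in> m"
      using m_add[OF character[OF that(1)] character[OF that(2)]] by (simp only:)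
  qed (use that I0_limits_add in auto)
  have mult: "character (\<lambda>z. p z * q z) = character p * character q" if "p \<in> I0_limits P" "q \<in> I0_limits P" for p q
  proof (rule character_eqI)
    have "(\<lambda>z. p z * q z) - (\<lambda>z. character p * character q)
        = p * (q - (\<lambda>z. character q)) + (\<lambda>z. character q) * (p - (\<lambda>z. character p))"
      by (simp add: fun_eq_iff algebra_simps)
    then show "(\<lambda>z. p z * q z) - (\<lambda>z. character p * character q) \<in> m"
      using m_add[OF m_mult[OF that(1) character[OF that(2)]] m_mult[OF limits_const character[OF that(1)]]] by (simp only:)
  qed (use that I0_limits_mult[OF compact] in auto)
  show ?thesis
    by (auto simp: Q_def alg_hom_def ring_hom_def I0_alg_def fun_alg_def complex_alg_def const add mult
        I0_add I0_mult I0_const I0_limits_I0)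
qed

text \<open>If the character is evaluation at a point of \<open>P\<close> on the invariant polynomials, then it is so on their limits.\<close>

lemma common_zero_of_character:
  assumes z: "z \<in> P" "\<And>p. p \<in> I0 \<Longrightarrow> character p = p z" and f: "f \<in> m"
  shows "f z = 0"
proof -
  have "cmod (f z) \<le> 2 * \<epsilon>" if e: "\<epsilon> > 0" for \<epsilon>
  proof -
    obtain p where p: "p \<in> I0" "\<And>z. z \<in> P \<Longrightarrow> cmod (f z - p z) \<le> \<epsilon>" using I0_limitsD[OF m_sub[OF f] e] by blast
    have "f - (p - (\<lambda>z. character p)) \<in> m"
      by (intro m_diff f character I0_limits_I0 p)
    then have "cmod (character p) \<le> \<epsilon>"
      by (rule m_not_near_const) (simp add: p(2))
    then have "cmod (p z) \<le> \<epsilon>" using z(2)[OF p(1)] by simp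
    then show ?thesis using norm_triangle_ineq[of "f z - p z" "p z"] p(2)[OF z(1)] by simp
  qed
  from this[of "cmod (f z) / 4"] show ?thesis by (cases "f z = 0") auto
qed

end
end

text \<open>A proper ideal lies in a maximal one, whose character is bounded by the supremum norm and hence, by convexity,
  is evaluation at a point of \<open>P\<close>.\<close>

theorem I0_limits_nullstellensatz:
  assumes convex: "\<And>w. w \<in> Q \<Longrightarrow> (\<And>p. p \<in> I0 \<Longrightarrow> cmod (w p) \<le> (SUP z\<in>P. cmod (p z))) \<Longrightarrow> w \<in> \<pi>0 ` P"
    and J: "I0_limits_ideal P J" "1 \<notin> J"
  shows "\<exists>z\<in>P. \<forall>f\<in>J. f z = 0"
proof -
  let ?\<A> = "{m. I0_limits_ideal P m \<and> J \<subseteq> m \<and> 1 \<notin> m}"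
  have "\<exists>m\<in>?\<A>. \<forall>m'\<in>?\<A>. m \<subseteq> m' \<longrightarrow> m' = m"
  proof (rule subset_Zorn_nonempty)
    show "?\<A> \<noteq> {}" using J by blast
    fix C assume C: "C \<noteq> {}" "subset.chain ?\<A> C"
    then have ch: "\<And>J J'. J \<in> C \<Longrightarrow> J' \<in> C \<Longrightarrow> J \<subseteq> J' \<or> J' \<subseteq> J" and sub: "C \<subseteq> ?\<A>"
      by (auto simp: subset_chain_def)
    then have "I0_limits_ideal P (\<Union>C)"
      using C(1) by (intro I0_limits_ideal_Union) auto
    then show "\<Union>C \<in> ?\<A>" using sub C(1) by auto
  qed
  then obtain m where m: "I0_limits_ideal P m" "1 \<notin> m" "J \<subseteq> m"
    and max: "\<And>m'. I0_limits_ideal P m' \<Longrightarrow> m \<subseteq> m' \<Longrightarrow> 1 \<notin> m' \<Longrightarrow> m' = m"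
    by (auto dest: subset_trans)
  let ?\<chi> = "character m"
  have "cmod (restrict ?\<chi> I0 p) \<le> (SUP z\<in>P. cmod (p z))" if "p \<in> I0" for p
    using that character_bound[OF m(1,2) max I0_limits_I0[OF that], of "sup_on p"] sup_on_upper[OF I0_limits_I0[OF that]]
    by (simp add: sup_on_def)
  then have "restrict ?\<chi> I0 \<in> \<pi>0 ` P"
    by (intro convex character_alg_hom[OF m(1,2) max])
  then obtain z where z: "z \<in> P" "restrict ?\<chi> I0 = \<pi>0 z" by blast
  have "?\<chi> p = p z" if "p \<in> I0" for p
    using fun_cong[OF z(2), of p] that by (simp add: \<pi>0_def)
  from common_zero_of_character[OF m(1,2) max z(1) this] show ?thesis
    using z(1) m(3) by blast
qed

end


section \<open>The Shilov boundary is a boundary\<close>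

lemma norm_attains_max:
  assumes "compact_space T" "closedin T C" "C \<noteq> {}" "continuous_map T euclidean f"
  shows "\<exists>y\<in>C. \<forall>x\<in>C. cmod (f x) \<le> cmod (f y)"
proof -
  have "continuous_map T euclidean (\<lambda>x. cmod (f x))"
    using assms(4) by (rule continuous_map_norm)
  then have "compactin euclidean ((\<lambda>x. cmod (f x)) ` C)"
    using closedin_compact_space[OF assms(1,2)] image_compactin by blast
  then have "compact ((\<lambda>x. cmod (f x)) ` C)" by simp
  then show ?thesis
    using compact_attains_sup[of "(\<lambda>x. cmod (f x)) ` C"] assms(3) by auto
qed

text \<open>A unital algebra \<open>A\<close> of continuous functions on a compact space whose topology is generated by \<open>A\<close>. The
  algebra operations need only hold on the space itself.\<close>

context
  fixes T :: "'x topology" and A :: "('x \<Rightarrow> complex) set"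
  assumes compact_T: "compact_space T" and T_nonempty: "topspace T \<noteq> {}"
    and cont: "\<And>f. f \<in> A \<Longrightarrow> continuous_map T euclidean f"
    and mult: "\<And>f g. f \<in> A \<Longrightarrow> g \<in> A \<Longrightarrow> \<exists>h\<in>A. \<forall>x\<in>topspace T. h x = f x * g x"
    and one: "\<exists>h\<in>A. \<forall>x\<in>topspace T. h x = 1"
    and weak: "\<And>U x. openin T U \<Longrightarrow> x \<in> U \<Longrightarrow>
      \<exists>G. finite G \<and> G \<subseteq> A \<and> (\<forall>g\<in>G. cmod (g x) < 1) \<and> {y \<in> topspace T. \<forall>g\<in>G. cmod (g y) < 1} \<subseteq> U"
begin

lemma algebra_power: "f \<in> A \<Longrightarrow> \<exists>h\<in>A. \<forall>x\<in>topspace T. h x = f x ^ k"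
proof (induction k)
  case (Suc k)
  then obtain h where "h \<in> A" "\<forall>x\<in>topspace T. h x = f x ^ k" by blast
  with mult[OF Suc.prems this(1)] show ?case by auto
qed (use one in simp)

lemma openin_basic:
  "finite G \<Longrightarrow> G \<subseteq> A \<Longrightarrow> openin T {y \<in> topspace T. \<forall>g\<in>G. cmod (g y) < 1}"
proof (induction G rule: finite_induct)
  case (insert g G)
  have "openin T {y \<in> topspace T. cmod (g y) \<in> {..<1}}"
    by (rule openin_continuous_map_preimage[OF continuous_map_norm[OF cont]]) (use insert.prems in auto)
  moreover have "{y \<in> topspace T. \<forall>h\<in>insert g G. cmod (h y) < 1}
      = {y \<in> topspace T. cmod (g y) \<in> {..<1}} \<inter> {y \<in> topspace T. \<forall>g\<in>G. cmod (g y) < 1}" by auto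
  ultimately show ?case using insert by auto
qed simp

text \<open>A basic open set that misses one boundary can be removed from every boundary: if \<open>f\<close>
  did not attain its maximum off \<open>V\<close>, then for large \<open>k\<close> the products \<open>f\<^sup>k g\<close> with the functions
  \<open>g\<close> defining \<open>V\<close> would be too small to be maximal on the missed boundary.\<close>

lemma boundary_remove:
  assumes E: "boundary_for T A E" and F: "boundary_for T A F" and G: "finite G" "G \<subseteq> A"
    and V: "V = {y \<in> topspace T. \<forall>g\<in>G. cmod (g y) < 1}" and disj: "V \<inter> E = {}"
  shows "boundary_for T A (F - V)"
proof -
  have Fc: "closedin T F" and Ec: "closedin T E" using E F by (auto simp: boundary_for_def)
  have "openin T V" unfolding V by (rule openin_basic[OF G])
  then have FV: "closedin T (F - V)" using Fc by (rule closedin_diff[rotated])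
  show ?thesis
    unfolding boundary_for_def
  proof (intro conjI FV ballI)
    fix f0 assume f0: "f0 \<in> A"
    show "\<exists>y\<in>F - V. \<forall>x\<in>topspace T. cmod (f0 x) \<le> cmod (f0 y)"
    proof (rule ccontr)
      assume neg: "\<not> ?thesis"
      \<comment> \<open>The constant 1 replaces \<open>f0\<close> if \<open>F - V\<close> is empty, so that the maximum of \<open>f\<close> is positive.\<close>
      define f where "f = (if F - V = {} then (SOME h. h \<in> A \<and> (\<forall>x\<in>topspace T. h x = 1)) else f0)"
      have "\<exists>h. h \<in> A \<and> (\<forall>x\<in>topspace T. h x = 1)" using one by blast
      from someI_ex[OF this] have f: "f \<in> A" and f1: "F - V = {} \<Longrightarrow> \<forall>x\<in>topspace T. f x = 1"
        using f0 by (auto simp: f_def)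
      obtain y0 where y0: "y0 \<in> E" "\<And>x. x \<in> topspace T \<Longrightarrow> cmod (f x) \<le> cmod (f y0)"
        using E f unfolding boundary_for_def by blast
      have y0T: "y0 \<in> topspace T" using y0(1) closedin_subset[OF Ec] by blast
      define M where "M = cmod (f y0)"
      have lt: "cmod (f y) < M" if y: "y \<in> F - V" for y
      proof -
        have "f = f0" using y by (auto simp: f_def)
        then obtain x where "x \<in> topspace T" "cmod (f y) < cmod (f x)" using neg y by (auto simp: not_le)
        then show ?thesis using y0(2) unfolding M_def by fastforce
      qed
      have M: "M > 0"
      proof (cases "F - V = {}")
        case True
        then show ?thesis using f1 y0T by (simp add: M_def)
      next
        case False
        then show ?thesis using lt norm_ge_zero order_le_less_trans by blast
      qed
      obtain m where m: "0 \<le> m" "m < M" "\<And>y. y \<in> F - V \<Longrightarrow> cmod (f y) \<le> m"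
      proof (cases "F - V = {}")
        case True
        show ?thesis by (rule that[of 0]) (use M True in blast)+
      next
        case False
        then obtain y where "y \<in> F - V" "\<forall>x\<in>F - V. cmod (f x) \<le> cmod (f y)"
          using norm_attains_max[OF compact_T FV False cont[OF f]] by blast
        then show ?thesis using that[of "cmod (f y)"] lt by auto
      qed
      have "\<exists>b. \<forall>x\<in>topspace T. cmod (g x) \<le> b" if "g \<in> G" for g
        using norm_attains_max[OF compact_T closedin_topspace T_nonempty cont, of g] that G(2) by blast
      then obtain b where b: "\<And>g x. g \<in> G \<Longrightarrow> x \<in> topspace T \<Longrightarrow> cmod (g x) \<le> b g" by metis
      define B where "B = 1 + (\<Sum>g\<in>G. \<bar>b g\<bar>)"
      have B: "cmod (g x) \<le> B" if "g \<in> G" "x \<in> topspace T" for g x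
      proof -
        have "\<bar>b g\<bar> \<le> (\<Sum>g\<in>G. \<bar>b g\<bar>)" using that(1) G(1) by (intro member_le_sum) auto
        then show ?thesis using b[OF that] by (simp add: B_def)
      qed
      have B0: "B > 0" unfolding B_def by (intro add_pos_nonneg sum_nonneg) auto
      have "(\<lambda>k. (m / M) ^ k * B) \<longlonglongrightarrow> 0 * B"
        using m M by (intro tendsto_intros LIMSEQ_realpow_zero) auto
      then have "eventually (\<lambda>k. (m / M) ^ k * B < 1) sequentially"
        by (simp add: order_tendstoD(2))
      then obtain k where "(m / M) ^ k * B < 1" by (auto simp: eventually_sequentially)
      then have k: "m ^ k * B < M ^ k" using M by (simp add: power_divide field_simps)
      obtain fk where fk: "fk \<in> A" "\<And>x. x \<in> topspace T \<Longrightarrow> fk x = f x ^ k" using algebra_power[OF f] by blast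
      have "cmod (g y0) < 1" if g: "g \<in> G" for g
      proof -
        obtain h where h: "h \<in> A" "\<And>x. x \<in> topspace T \<Longrightarrow> h x = f x ^ k * g x"
          using mult[OF fk(1) subsetD[OF G(2) g]] fk(2) by auto
        obtain y where y: "y \<in> F" "\<And>x. x \<in> topspace T \<Longrightarrow> cmod (h x) \<le> cmod (h y)"
          using F h(1) unfolding boundary_for_def by blast
        have yT: "y \<in> topspace T" using y(1) closedin_subset[OF Fc] by blast
        have "cmod (h y) < M ^ k"
        proof (cases "y \<in> V")
          case True
          then have "cmod (g y) < 1" using g by (simp add: V)
          have "cmod (h y) = cmod (f y) ^ k * cmod (g y)" by (simp add: h(2)[OF yT] norm_mult norm_power)
          also have "\<dots> \<le> M ^ k * cmod (g y)"
            using y0(2)[OF yT] by (intro mult_right_mono power_mono) (auto simp: M_def)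
          also have "\<dots> < M ^ k * 1" using \<open>cmod (g y) < 1\<close> M by (intro mult_strict_left_mono) auto
          finally show ?thesis by simp
        next
          case False
          have "cmod (h y) = cmod (f y) ^ k * cmod (g y)" by (simp add: h(2)[OF yT] norm_mult norm_power)
          also have "\<dots> \<le> m ^ k * B"
            using m(3)[of y] False y(1) B[OF g yT] m(1) by (intro mult_mono power_mono) auto
          finally show ?thesis using k by simp
        qed
        then have "cmod (h y0) < M ^ k" using y(2)[OF y0T] by simp
        then have "M ^ k * cmod (g y0) < M ^ k * 1" by (simp add: h(2)[OF y0T] norm_mult norm_power M_def)
        then show ?thesis using M by (simp add: mult_less_cancel_left_pos)
      qed
      then have "y0 \<in> V" using y0T by (simp add: V)
      then show False using disj y0(1) by blast
    qed
  qed
qed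

text \<open>If all points where \<open>f\<close> is maximal were off the Shilov boundary, then finitely many basic open sets that cover
  them could be removed from the whole space, leaving a boundary on which \<open>f\<close> is not maximal.\<close>

theorem shilov_boundary_attains:
  assumes f: "f \<in> A"
  shows "\<exists>y\<in>shilov_boundary T A. \<forall>x\<in>topspace T. cmod (f x) \<le> cmod (f y)"
proof (rule ccontr)
  assume neg: "\<not> ?thesis"
  obtain ym where ym: "ym \<in> topspace T" "\<And>x. x \<in> topspace T \<Longrightarrow> cmod (f x) \<le> cmod (f ym)"
    using norm_attains_max[OF compact_T closedin_topspace T_nonempty cont[OF f]] by blast
  define K where "K = {x \<in> topspace T. cmod (f x) \<in> {cmod (f ym)}}"
  have "closedin T K"
    unfolding K_def by (rule closedin_continuous_map_preimage[OF continuous_map_norm[OF cont[OF f]]]) simp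
  then have K: "compactin T K" by (rule closedin_compact_space[OF compact_T])
  define \<V> where "\<V> = {V. openin T V \<and> (\<exists>G. finite G \<and> G \<subseteq> A \<and> V = {y \<in> topspace T. \<forall>g\<in>G. cmod (g y) < 1})
      \<and> (\<exists>E. boundary_for T A E \<and> V \<inter> E = {})}"
  have "\<exists>V\<in>\<V>. x \<in> V" if x: "x \<in> K" for x
  proof -
    have "x \<notin> shilov_boundary T A" using neg x ym(2) by (auto simp: K_def)
    then obtain E where E: "boundary_for T A E" "x \<notin> E" by (auto simp: shilov_boundary_def)
    then have "openin T (topspace T - E)" by (auto simp: boundary_for_def)
    moreover have "x \<in> topspace T - E" using x E by (auto simp: K_def)
    ultimately obtain G where G: "finite G" "G \<subseteq> A" "\<forall>g\<in>G. cmod (g x) < 1"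
      "{y \<in> topspace T. \<forall>g\<in>G. cmod (g y) < 1} \<subseteq> topspace T - E" using weak by meson
    have "openin T {y \<in> topspace T. \<forall>g\<in>G. cmod (g y) < 1}" by (rule openin_basic[OF G(1,2)])
    then have "{y \<in> topspace T. \<forall>g\<in>G. cmod (g y) < 1} \<in> \<V>" unfolding \<V>_def using G E by blast
    moreover have "x \<in> {y \<in> topspace T. \<forall>g\<in>G. cmod (g y) < 1}" using G(3) x by (simp add: K_def)
    ultimately show ?thesis by (rule rev_bexI)
  qed
  then have "K \<subseteq> \<Union>\<V>" by blast
  moreover have "\<And>V. V \<in> \<V> \<Longrightarrow> openin T V" by (simp add: \<V>_def)
  ultimately obtain \<W> where \<W>: "finite \<W>" "\<W> \<subseteq> \<V>" "K \<subseteq> \<Union>\<W>"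
    using K unfolding compactin_def by meson
  have "boundary_for T A (topspace T - \<Union>\<W>)"
    using \<W>(1,2)
  proof (induction \<W> rule: finite_induct)
    case empty
    show ?case
      using norm_attains_max[OF compact_T closedin_topspace T_nonempty cont]
      by (auto simp: boundary_for_def)
  next
    case (insert V \<W>)
    then obtain G E where "finite G" "G \<subseteq> A" "V = {y \<in> topspace T. \<forall>g\<in>G. cmod (g y) < 1}"
      "boundary_for T A E" "V \<inter> E = {}" by (auto simp: \<V>_def)
    from boundary_remove[OF this(4) _ this(1,2,3,5)] insert
    have "boundary_for T A (topspace T - \<Union>\<W> - V)" by blast
    then show ?case by (rule back_subst[of "boundary_for T A"]) auto
  qed
  then obtain y where y: "y \<in> topspace T - \<Union>\<W>" "\<And>x. x \<in> topspace T \<Longrightarrow> cmod (f x) \<le> cmod (f y)"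
    using f unfolding boundary_for_def by blast
  have "cmod (f y) = cmod (f ym)" using ym(2)[of y] y ym(1) by (intro antisym) auto
  then have "y \<in> K" using y(1) by (simp add: K_def)
  then show False using y(1) \<W>(3) by blast
qed

end

section \<open>The function algebra of a domain, pulled back to a reduction\<close>

lemma topspace_Qtop: "topspace Qtop = Q"
  by (auto simp: Qtop_def Q_def PiE_def)

lemma Q_hom:
  assumes "w \<in> Q"
  shows Q_add: "p \<in> I0 \<Longrightarrow> q \<in> I0 \<Longrightarrow> w (\<lambda>z. p z + q z) = w p + w q"
    and Q_scale: "p \<in> I0 \<Longrightarrow> w (\<lambda>z. c * p z) = c * w p"
    and Q_const: "w (\<lambda>z. c) = c"
proof -
  have h: "w \<in> ring_hom I0_alg complex_alg" and sc: "\<And>c p. p \<in> I0 \<Longrightarrow> w (\<lambda>z. c * p z) = c * w p"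
    using assms by (auto simp: Q_def alg_hom_def I0_alg_def fun_alg_def complex_alg_def)
  show "p \<in> I0 \<Longrightarrow> q \<in> I0 \<Longrightarrow> w (\<lambda>z. p z + q z) = w p + w q"
    using ring_hom_add[OF h, of p q] by (simp add: I0_alg_def fun_alg_def complex_alg_def)
  show "p \<in> I0 \<Longrightarrow> w (\<lambda>z. c * p z) = c * w p" by (rule sc)
  have "w (\<lambda>z. 1) = 1"
    using ring_hom_one[OF h] by (simp add: I0_alg_def fun_alg_def complex_alg_def)
  then show "w (\<lambda>z. c) = c"
    using sc[OF I0_const[of 1], of c] by simp
qed

text \<open>The analytic topology is generated by the regular functions.\<close>

lemma Qtop_weak:
  assumes "openin Qtop U" "w \<in> U"
  shows "\<exists>G. finite G \<and> G \<subseteq> I0 \<and> (\<forall>p\<in>G. w p = 0) \<and> {v \<in> Q. \<forall>p\<in>G. cmod (v p) < 1} \<subseteq> U"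
proof -
  obtain U' where U': "openin (product_topology (\<lambda>_. euclidean) I0) U'" "U = U' \<inter> Q"
    using assms(1) by (auto simp: Qtop_def openin_subtopology)
  then obtain B where B: "finite {p \<in> I0. B p \<noteq> (UNIV :: complex set)}" "\<And>p. p \<in> I0 \<Longrightarrow> open (B p)"
      "w \<in> Pi\<^sub>E I0 B" "Pi\<^sub>E I0 B \<subseteq> U'"
    using assms(2) unfolding openin_product_topology_alt by auto
  have "\<exists>e>0. ball (w p) e \<subseteq> B p" if "p \<in> I0" for p
    using B(2)[OF that] B(3) that by (auto simp: open_contains_ball)
  then obtain e where e: "\<And>p. p \<in> I0 \<Longrightarrow> e p > 0" "\<And>p. p \<in> I0 \<Longrightarrow> ball (w p) (e p) \<subseteq> B p" by metis
  define J where "J = {p \<in> I0. B p \<noteq> (UNIV :: complex set)}"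
  define g where "g p = (\<lambda>z. (1 / of_real (e p)) * p z + (- w p / of_real (e p)))" for p :: "('a, 'b) tuple \<Rightarrow> complex"
  have wQ: "w \<in> Q" using assms(2) U' by blast
  have gI: "g p \<in> I0" if "p \<in> I0" for p
    unfolding g_def using that by (intro I0_add I0_mult I0_const)
  have val: "v (g p) = (v p - w p) / of_real (e p)" if "v \<in> Q" "p \<in> I0" for v p
  proof -
    have "v (g p) = v (\<lambda>z. (1 / of_real (e p)) * p z) + v (\<lambda>z. - w p / of_real (e p))"
      unfolding g_def by (rule Q_add[OF that(1) I0_mult[OF I0_const that(2)] I0_const])
    also have "\<dots> = (1 / of_real (e p)) * v p + (- w p / of_real (e p))"
      by (simp only: Q_scale[OF that] Q_const[OF that(1)])
    finally show ?thesis by (simp add: diff_divide_distrib)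
  qed
  have "{v \<in> Q. \<forall>q\<in>g ` J. cmod (v q) < 1} \<subseteq> U"
  proof
    fix v assume v: "v \<in> {v \<in> Q. \<forall>q\<in>g ` J. cmod (v q) < 1}"
    have "v p \<in> B p" if p: "p \<in> I0" for p
    proof (cases "p \<in> J")
      case True
      then have "cmod ((v p - w p) / of_real (e p)) < 1" using v val[of v p] p by auto
      then have "cmod (v p - w p) < e p" using e(1)[OF p] by (simp add: norm_divide field_simps)
      then show ?thesis using e(2)[OF p] by (auto simp: dist_norm norm_minus_commute)
    qed (use p in \<open>simp add: J_def\<close>)
    then have "v \<in> Pi\<^sub>E I0 B" using v by (auto simp: PiE_def Q_def)
    then show "v \<in> U" using B(4) U'(2) v by blast
  qed
  moreover have "finite (g ` J)" "g ` J \<subseteq> I0" "\<forall>q\<in>g ` J. w q = 0"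
    using B(1) gI val[OF wQ] by (auto simp: J_def)
  ultimately show ?thesis by blast
qed

lemma continuous_on_uniform_approx:
  fixes f :: "'x::topological_space \<Rightarrow> complex"
  assumes "\<And>\<epsilon>. \<epsilon> > 0 \<Longrightarrow> \<exists>p. continuous_on S p \<and> (\<forall>z\<in>S. cmod (f z - p z) \<le> \<epsilon>)"
  shows "continuous_on S f"
proof -
  have "\<forall>n. \<exists>p. continuous_on S p \<and> (\<forall>z\<in>S. cmod (f z - p z) \<le> inverse (real (Suc n)))"
    using assms by (auto simp del: of_nat_Suc)
  from choice[OF this] obtain p where p: "\<And>n. continuous_on S (p n)"
    "\<And>n z. z \<in> S \<Longrightarrow> cmod (f z - p n z) \<le> inverse (real (Suc n))" by blast
  have "uniform_limit S p f sequentially"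
    unfolding uniform_limit_iff
  proof (intro allI impI)
    fix e :: real assume "e > 0"
    then obtain N where N: "inverse (real (Suc N)) < e" using reals_Archimedean by blast
    have "\<forall>z\<in>S. dist (p n z) (f z) < e" if "n \<ge> N" for n
    proof
      fix z assume "z \<in> S"
      then have "dist (p n z) (f z) \<le> inverse (real (Suc n))" using p(2) by (simp add: dist_norm norm_minus_commute)
      also have "\<dots> \<le> inverse (real (Suc N))" using that by (intro le_imp_inverse_le) auto
      finally show "dist (p n z) (f z) < e" using N by simp
    qed
    then show "eventually (\<lambda>n. \<forall>z\<in>S. dist (p n z) (f z) < e) sequentially"
      by (auto simp: eventually_sequentially)
  qed
  then show ?thesis
    by (rule uniform_limit_theorem[rotated]) (auto intro!: always_eventually p)
qed

lemma I0_limits_continuous: "f \<in> I0_limits P \<Longrightarrow> continuous_on P f"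
  by (rule continuous_on_uniform_approx) (auto elim!: I0_limitsD intro: I0_continuous)

text \<open>A set \<open>D\<close> with compact and convex closure and a reduction \<open>P\<close> over this closure.\<close>

locale reduced_domain =
  fixes D :: "('n::finite, 'd::finite) qpoint set" and P :: "('n, 'd) tuple set"
  assumes D_nonempty: "D \<noteq> {}" and D_subset: "D \<subseteq> topspace Qtop"
    and compact_clos: "compactin Qtop (clos D)"
    and reduction: "reduction P (clos D)"
    and convex: "I0_convex (clos D)"
begin

lemma compact_P: "compact P"
  and P_generating: "z \<in> P \<Longrightarrow> z \<in> generating_tuples"
  and P_invariant: "z \<in> P \<Longrightarrow> k \<in> unitary_group \<Longrightarrow> conj_tuple k z \<in> P"
  and quotient_\<pi>0: "quotient_map (top_of_set P) (subtopology Qtop (clos D)) \<pi>0"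
  and \<pi>0_eq_iff: "z \<in> P \<Longrightarrow> w \<in> P \<Longrightarrow> \<pi>0 z = \<pi>0 w \<longleftrightarrow> (\<exists>k\<in>unitary_group. w = conj_tuple k z)"
  using reduction unfolding reduction_def by blast+

lemma clos_sub: "clos D \<subseteq> Q"
  unfolding clos_def using closure_of_subset_topspace[of Qtop D] by (simp add: topspace_Qtop)

lemma topspace_clos: "topspace (subtopology Qtop (clos D)) = clos D"
  using clos_sub by (auto simp: topspace_Qtop)

lemma \<pi>0_image: "\<pi>0 ` P = clos D"
  using quotient_imp_surjective_map[OF quotient_\<pi>0] topspace_clos by simp

lemma P_nonempty: "P \<noteq> {}"
  using closure_of_subset[OF D_subset] D_nonempty \<pi>0_image unfolding clos_def by blast

lemma \<pi>0_apply: "p \<in> I0 \<Longrightarrow> \<pi>0 z p = p z"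
  by (simp add: \<pi>0_def)

text \<open>The function algebra of \<open>D\<close> consists of the functions whose pullbacks to \<open>P\<close> are limits of invariants.\<close>

lemma I_carrier_iff:
  "f \<in> I_carrier D \<longleftrightarrow> f \<in> extensional (clos D) \<and> (\<lambda>z. f (\<pi>0 z)) \<in> I0_limits P"
proof -
  have approx: "(\<forall>\<epsilon>>0. \<exists>p\<in>I0. \<forall>u\<in>clos D. cmod (f u - u p) \<le> \<epsilon>) \<longleftrightarrow> (\<lambda>z. f (\<pi>0 z)) \<in> I0_limits P"
    unfolding \<pi>0_image[symmetric] by (simp add: I0_limits_def \<pi>0_apply cong: bex_cong)
  have "continuous_map (subtopology Qtop (clos D)) euclidean f" if "(\<lambda>z. f (\<pi>0 z)) \<in> I0_limits P"
  proof (rule continuous_compose_quotient_map[OF quotient_\<pi>0])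
    show "continuous_map (top_of_set P) euclidean (f \<circ> \<pi>0)"
      using I0_limits_continuous[OF that] by (simp add: o_def)
  qed
  then show ?thesis
    using approx by (auto simp: I_carrier_def)
qed

lemma I0_limits_nullstellensatz_reduced:
  assumes "I0_limits_ideal P J" "1 \<notin> J"
  shows "\<exists>z\<in>P. \<forall>f\<in>J. f z = 0"
proof (rule I0_limits_nullstellensatz[OF compact_P P_nonempty _ assms])
  fix w :: "('n, 'd) qpoint"
  assume w: "w \<in> Q" "\<And>p. p \<in> I0 \<Longrightarrow> cmod (w p) \<le> (SUP z\<in>P. cmod (p z))"
  have "(SUP z\<in>P. cmod (p z)) = (SUP u\<in>clos D. cmod (u p))" if "p \<in> I0" for p
    unfolding \<pi>0_image[symmetric] image_image using that by (simp add: \<pi>0_apply)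
  then have "w \<in> I0_hull (clos D)" using w by (simp add: I0_hull_def)
  then show "w \<in> \<pi>0 ` P" using convex \<pi>0_image by (simp add: I0_convex_def)
qed

text \<open>The part of \<open>P\<close> over the Shilov boundary.\<close>

definition Pb :: "('n, 'd) tuple set" where
  "Pb = {z \<in> P. \<pi>0 z \<in> bdry D}"

lemma bdry_sub: "bdry D \<subseteq> clos D" and closedin_bdry: "closedin (subtopology Qtop (clos D)) (bdry D)"
  and maximum_on_bdry: "f \<in> I_carrier D \<Longrightarrow> \<exists>y\<in>bdry D. \<forall>x\<in>clos D. cmod (f x) \<le> cmod (f y)"
proof -
  let ?T = "subtopology Qtop (clos D)"
  have cT: "compact_space ?T" using compact_clos by (simp add: compactin_subspace)
  have ne: "topspace ?T \<noteq> {}" unfolding topspace_clos using P_nonempty \<pi>0_image by blast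
  have cont: "\<And>f. f \<in> I_carrier D \<Longrightarrow> continuous_map ?T euclidean f" by (simp add: I_carrier_def)
  have res: "(\<lambda>u\<in>clos D. h u) \<in> I_carrier D" if "(\<lambda>z. h (\<pi>0 z)) \<in> I0_limits P" for h
    unfolding I_carrier_iff using that \<pi>0_image by (auto elim!: I0_limits_cong)
  have T: "boundary_for ?T (I_carrier D) (topspace ?T)"
    unfolding boundary_for_def using norm_attains_max[OF cT closedin_topspace ne cont] closedin_topspace by blast
  show "bdry D \<subseteq> clos D"
    unfolding bdry_def shilov_boundary_def using T topspace_clos by blast
  show "closedin ?T (bdry D)"
    unfolding bdry_def shilov_boundary_def
    by (rule closedin_Inter) (use T in \<open>auto simp: boundary_for_def\<close>)
  assume f: "f \<in> I_carrier D"
  have "\<exists>y\<in>shilov_boundary ?T (I_carrier D). \<forall>x\<in>topspace ?T. cmod (f x) \<le> cmod (f y)"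
  proof (rule shilov_boundary_attains[OF cT ne cont _ _ _ f])
    fix f g assume fg: "f \<in> I_carrier D" "g \<in> I_carrier D"
    then have "(\<lambda>u\<in>clos D. f u * g u) \<in> I_carrier D"
      by (intro res I0_limits_mult[OF compact_P]) (auto simp: I_carrier_iff)
    then show "\<exists>h\<in>I_carrier D. \<forall>x\<in>topspace ?T. h x = f x * g x"
      unfolding topspace_clos by (rule bexI[rotated]) simp
  next
    have "(\<lambda>u\<in>clos D. 1) \<in> I_carrier D"
      by (intro res I0_limits_I0 I0_const)
    then show "\<exists>h\<in>I_carrier D. \<forall>x\<in>topspace ?T. h x = 1"
      unfolding topspace_clos by (rule bexI[rotated]) simp
  next
    fix U x assume U: "openin ?T U" "x \<in> U"
    then obtain U' where U': "openin Qtop U'" "U = U' \<inter> clos D" by (auto simp: openin_subtopology)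
    then obtain G where G: "finite G" "G \<subseteq> I0" "\<forall>p\<in>G. x p = 0" "{v \<in> Q. \<forall>p\<in>G. cmod (v p) < 1} \<subseteq> U'"
      using Qtop_weak[of U' x] U(2) by blast
    let ?G = "(\<lambda>p. \<lambda>u\<in>clos D. u p) ` G"
    have "?G \<subseteq> I_carrier D"
      using G(2) by (auto intro!: res I0_limits_I0 simp: \<pi>0_apply elim!: I0_limits_cong[OF I0_limits_I0])
    moreover have "{y \<in> topspace ?T. \<forall>g\<in>?G. cmod (g y) < 1} \<subseteq> U"
      unfolding topspace_clos using G(4) clos_sub U'(2) by auto
    moreover have "\<forall>g\<in>?G. cmod (g x) < 1" using G(3) U(2) U'(2) by auto
    ultimately show "\<exists>G. finite G \<and> G \<subseteq> I_carrier D \<and> (\<forall>g\<in>G. cmod (g x) < 1) \<and> {y \<in> topspace ?T. \<forall>g\<in>G. cmod (g y) < 1} \<subseteq> U"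
      using G(1) by blast
  qed
  then show "\<exists>y\<in>bdry D. \<forall>x\<in>clos D. cmod (f x) \<le> cmod (f y)"
    unfolding bdry_def topspace_clos .
qed

lemma \<pi>0_Pb: "\<pi>0 ` Pb = bdry D"
  using \<pi>0_image bdry_sub by (auto simp: Pb_def)

lemma Pb_sub: "z \<in> Pb \<Longrightarrow> z \<in> P"
  by (simp add: Pb_def)

lemma I0_limits_factor:
  assumes "f \<in> I0_limits P" "z \<in> P" "w \<in> P" "\<pi>0 z = \<pi>0 w" shows "f z = f w"
proof -
  have "cmod (f z - f w) \<le> 2 * \<epsilon>" if e: "\<epsilon> > 0" for \<epsilon>
  proof -
    obtain p where p: "p \<in> I0" "\<And>z. z \<in> P \<Longrightarrow> cmod (f z - p z) \<le> \<epsilon>" using I0_limitsD[OF assms(1) e] by blast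
    have "p z = p w" using fun_cong[OF assms(4), of p] p(1) by (simp add: \<pi>0_def)
    then have "cmod (f z - f w) \<le> cmod (f z - p z) + cmod (f w - p w)"
      using norm_triangle_ineq4[of "f z - p z" "f w - p w"] by simp
    then show ?thesis using p(2)[OF assms(2)] p(2)[OF assms(3)] by linarith
  qed
  from this[of "cmod (f z - f w) / 4"] show ?thesis by (cases "f z = f w") auto
qed

lemma I0_limits_descend:
  assumes "f \<in> I0_limits P"
  shows "\<exists>g\<in>I_carrier D. \<forall>z\<in>P. g (\<pi>0 z) = f z"
proof -
  define g where "g = (\<lambda>u\<in>clos D. f (SOME z. z \<in> P \<and> \<pi>0 z = u))"
  have g: "g (\<pi>0 z) = f z" if "z \<in> P" for z
  proof -
    have "\<exists>w. w \<in> P \<and> \<pi>0 w = \<pi>0 z" using that by blast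
    from someI_ex[OF this]
    have "f (SOME w. w \<in> P \<and> \<pi>0 w = \<pi>0 z) = f z"
      by (intro I0_limits_factor[OF assms _ that]) (elim conjE, assumption)+
    moreover have "\<pi>0 z \<in> clos D" using that \<pi>0_image by blast
    ultimately show ?thesis unfolding g_def by simp
  qed
  have "g \<in> I_carrier D"
    unfolding I_carrier_iff using I0_limits_cong[OF assms g] by (simp add: g_def)
  then show ?thesis using g by blast
qed

text \<open>The maximum principle, pulled back to \<open>P\<close>.\<close>

lemma maximum_on_Pb:
  assumes "f \<in> I0_limits P"
  shows "\<exists>y\<in>Pb. \<forall>z\<in>P. cmod (f z) \<le> cmod (f y)"
proof -
  obtain g where g: "g \<in> I_carrier D" "\<And>z. z \<in> P \<Longrightarrow> g (\<pi>0 z) = f z"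
    using I0_limits_descend[OF assms] by blast
  from maximum_on_bdry[OF g(1)] obtain y where y: "y \<in> bdry D" "\<forall>x\<in>clos D. cmod (g x) \<le> cmod (g y)" by blast
  then obtain w where w: "w \<in> Pb" "\<pi>0 w = y" unfolding \<pi>0_Pb[symmetric] by blast
  have "cmod (f z) \<le> cmod (f w)" if "z \<in> P" for z
    using bspec[OF y(2), of "\<pi>0 z"] g(2)[OF that] g(2)[OF Pb_sub[OF w(1)]] w(2) \<pi>0_image that by auto
  then show ?thesis using w(1) by blast
qed

end


section \<open>Uniform limits of the trace algebra\<close>

text \<open>The sum of the moduli of the entries, a submultiplicative norm equivalent to the operator norm.\<close>

definition entry_norm :: "complex^'n^'n \<Rightarrow> real" where
  "entry_norm A = (\<Sum>i\<in>UNIV. \<Sum>j\<in>UNIV. cmod (A $ i $ j))"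

lemma entry_norm_nonneg [simp]: "0 \<le> entry_norm A"
  by (simp add: entry_norm_def sum_nonneg)

lemma entry_norm_triangle: "entry_norm (A + B) \<le> entry_norm A + entry_norm B"
  by (auto simp: entry_norm_def sum.distrib[symmetric] intro!: sum_mono norm_triangle_ineq)

lemma entry_norm_minus_commute: "entry_norm (A - B) = entry_norm (B - A)"
  by (simp add: entry_norm_def norm_minus_commute)

lemma entry_norm_cscale: "entry_norm (cscale c A) = cmod c * entry_norm A"
  by (simp add: entry_norm_def norm_mult sum_distrib_left)

lemma entry_norm_component: "cmod (A $ i $ j) \<le> entry_norm A"
proof -
  have "cmod (A $ i $ j) \<le> (\<Sum>j\<in>UNIV. cmod (A $ i $ j))" by (rule member_le_sum) auto
  also have "\<dots> \<le> entry_norm A"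
    unfolding entry_norm_def by (rule member_le_sum[of i UNIV "\<lambda>i. \<Sum>j\<in>UNIV. cmod (A $ i $ j)"]) (auto intro: sum_nonneg)
  finally show ?thesis .
qed

lemma entry_norm_zeroD: assumes "entry_norm A \<le> 0" shows "A = 0"
proof -
  have "cmod (A $ i $ j) \<le> 0" for i j using entry_norm_component[of A i j] assms by linarith
  then show ?thesis by (simp add: vec_eq_iff)
qed

lemma entry_norm_trace: "cmod (trace A) \<le> entry_norm A"
proof -
  have "cmod (trace A) \<le> (\<Sum>i\<in>UNIV. cmod (A $ i $ i))" unfolding trace_def by (rule norm_sum)
  also have "\<dots> \<le> entry_norm A"
    unfolding entry_norm_def by (rule sum_mono) (rule member_le_sum, auto)
  finally show ?thesis .
qed

lemma entry_norm_mult: "entry_norm (A ** B) \<le> entry_norm A * entry_norm B"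
proof -
  have "entry_norm (A ** B) \<le> (\<Sum>i\<in>UNIV. \<Sum>j\<in>UNIV. \<Sum>k\<in>UNIV. cmod (A $ i $ k) * cmod (B $ k $ j))"
    unfolding entry_norm_def mat_mult_component
    by (intro sum_mono order_trans[OF norm_sum]) (simp add: norm_mult)
  also have "\<dots> = (\<Sum>i\<in>UNIV. \<Sum>k\<in>UNIV. \<Sum>j\<in>UNIV. cmod (A $ i $ k) * cmod (B $ k $ j))"
    by (rule sum.cong[OF refl]) (rule sum.swap)
  also have "\<dots> = (\<Sum>i\<in>UNIV. \<Sum>k\<in>UNIV. cmod (A $ i $ k) * (\<Sum>j\<in>UNIV. cmod (B $ k $ j)))"
    by (simp add: sum_distrib_left)
  also have "\<dots> \<le> (\<Sum>i\<in>UNIV. \<Sum>k\<in>UNIV. cmod (A $ i $ k) * entry_norm B)"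
    unfolding entry_norm_def[of B]
    by (intro sum_mono mult_left_mono member_le_sum) (auto intro: sum_nonneg)
  also have "\<dots> = entry_norm A * entry_norm B"
    by (simp add: entry_norm_def[of A] sum_distrib_right)
  finally show ?thesis .
qed

lemma entry_norm_one: "entry_norm (mat 1 :: complex^'n^'n) = CARD('n)"
  by (simp add: entry_norm_def mat_def if_distrib[of cmod] cong: if_cong)

text \<open>Uniform limits on \<open>P\<close> of the trace algebra. Again only the values on \<open>P\<close> matter.\<close>

definition S0_limits :: "('n::finite, 'd::finite) tuple set \<Rightarrow> (('n, 'd) tuple \<Rightarrow> complex^'n^'n) set" where
  "S0_limits P = {F. \<forall>\<epsilon>>0. \<exists>\<phi>\<in>S0. \<forall>z\<in>P. entry_norm (F z - \<phi> z) \<le> \<epsilon>}"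

lemma S0_limitsI: "(\<And>\<epsilon>. \<epsilon> > 0 \<Longrightarrow> \<exists>\<phi>\<in>S0. \<forall>z\<in>P. entry_norm (F z - \<phi> z) \<le> \<epsilon>) \<Longrightarrow> F \<in> S0_limits P"
  by (simp add: S0_limits_def)

lemma S0_limitsD:
  assumes "F \<in> S0_limits P" "\<epsilon> > 0"
  obtains \<phi> where "\<phi> \<in> S0" "\<And>z. z \<in> P \<Longrightarrow> entry_norm (F z - \<phi> z) \<le> \<epsilon>"
  using assms by (auto simp: S0_limits_def)

lemma S0_limits_S0: "\<phi> \<in> S0 \<Longrightarrow> \<phi> \<in> S0_limits P"
  by (rule S0_limitsI) (auto intro!: bexI[of _ \<phi>] simp: entry_norm_def)

lemma S0_bounded:
  assumes "compact P" "\<phi> \<in> S0"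
  obtains b where "b > 0" "\<And>z. z \<in> P \<Longrightarrow> entry_norm (\<phi> z) \<le> b"
proof -
  have "continuous_on P (\<lambda>z. \<phi> z $ i $ j)" for i j
    using polynomial_continuous[OF S0_polynomial_equivariant(1)[OF assms(2)]] continuous_on_subset by blast
  then have "continuous_on P (\<lambda>z. entry_norm (\<phi> z))"
    unfolding entry_norm_def by (intro continuous_on_sum continuous_on_norm)
  then have "bounded ((\<lambda>z. entry_norm (\<phi> z)) ` P)"
    using assms(1) compact_continuous_image compact_imp_bounded by blast
  then show thesis using that by (auto simp: bounded_pos)
qed

lemma S0_limits_bounded:
  assumes "compact P" "F \<in> S0_limits P"
  obtains b where "b > 0" "\<And>z. z \<in> P \<Longrightarrow> entry_norm (F z) \<le> b"
proof -
  obtain \<phi> where \<phi>: "\<phi> \<in> S0" "\<And>z. z \<in> P \<Longrightarrow> entry_norm (F z - \<phi> z) \<le> 1"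
    using S0_limitsD[OF assms(2) zero_less_one] by blast
  obtain b where b: "b > 0" "\<And>z. z \<in> P \<Longrightarrow> entry_norm (\<phi> z) \<le> b" using S0_bounded[OF assms(1) \<phi>(1)] by blast
  have "entry_norm (F z) \<le> b + 1" if "z \<in> P" for z
    using entry_norm_triangle[of "F z - \<phi> z" "\<phi> z"] \<phi>(2)[OF that] b(2)[OF that] by simp
  then show thesis using that[of "b + 1"] b(1) by simp
qed

lemma S0_limits_add:
  assumes "F \<in> S0_limits P" "H \<in> S0_limits P"
  shows "(\<lambda>z. F z + H z) \<in> S0_limits P"
proof (rule S0_limitsI)
  fix \<epsilon> :: real assume "\<epsilon> > 0"
  then have e: "\<epsilon> / 2 > 0" by simp
  obtain \<phi> where \<phi>: "\<phi> \<in> S0" "\<And>z. z \<in> P \<Longrightarrow> entry_norm (F z - \<phi> z) \<le> \<epsilon> / 2" using S0_limitsD[OF assms(1) e] by blast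
  obtain \<psi> where \<psi>: "\<psi> \<in> S0" "\<And>z. z \<in> P \<Longrightarrow> entry_norm (H z - \<psi> z) \<le> \<epsilon> / 2" using S0_limitsD[OF assms(2) e] by blast
  have "entry_norm (F z + H z - (\<phi> z + \<psi> z)) \<le> \<epsilon>" if "z \<in> P" for z
    using entry_norm_triangle[of "F z - \<phi> z" "H z - \<psi> z"] \<phi>(2)[OF that] \<psi>(2)[OF that] by (simp add: algebra_simps)
  then show "\<exists>\<theta>\<in>S0. \<forall>z\<in>P. entry_norm (F z + H z - \<theta> z) \<le> \<epsilon>"
    by (intro bexI[OF _ S0_add[OF \<phi>(1) \<psi>(1)]]) simp
qed

lemma matrix_mult_diff_left: "(A - B) ** C = A ** C - B ** C"
  and matrix_mult_diff_right: "C ** (A - B) = C ** A - C ** B" for A B C :: "complex^'n^'n"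
  by (simp_all add: vec_eq_iff mat_mult_component sum_subtractf[symmetric] algebra_simps)

lemma matrix_diff_mult: "A ** B - C ** E = (A - C) ** B + C ** (B - E)" for A B C E :: "complex^'n^'n"
  by (simp add: matrix_mult_diff_left matrix_mult_diff_right)

lemma S0_limits_mult:
  assumes P: "compact P" and F: "F \<in> S0_limits P" and H: "H \<in> S0_limits P"
  shows "(\<lambda>z. F z ** H z) \<in> S0_limits P"
proof (rule S0_limitsI)
  fix \<epsilon> :: real assume e: "\<epsilon> > 0"
  obtain b where b: "b > 0" "\<And>z. z \<in> P \<Longrightarrow> entry_norm (H z) \<le> b" using S0_limits_bounded[OF P H] by blast
  have e1: "\<epsilon> / (2 * b) > 0" using e b by simp
  obtain \<phi> where \<phi>: "\<phi> \<in> S0" "\<And>z. z \<in> P \<Longrightarrow> entry_norm (F z - \<phi> z) \<le> \<epsilon> / (2 * b)"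
    using S0_limitsD[OF F e1] by blast
  obtain b' where b': "b' > 0" "\<And>z. z \<in> P \<Longrightarrow> entry_norm (\<phi> z) \<le> b'" using S0_bounded[OF P \<phi>(1)] by blast
  have e2: "\<epsilon> / (2 * b') > 0" using e b' by simp
  obtain \<psi> where \<psi>: "\<psi> \<in> S0" "\<And>z. z \<in> P \<Longrightarrow> entry_norm (H z - \<psi> z) \<le> \<epsilon> / (2 * b')"
    using S0_limitsD[OF H e2] by blast
  have "entry_norm (F z ** H z - \<phi> z ** \<psi> z) \<le> \<epsilon>" if z: "z \<in> P" for z
  proof -
    have "entry_norm (F z ** H z - \<phi> z ** \<psi> z) \<le> entry_norm ((F z - \<phi> z) ** H z) + entry_norm (\<phi> z ** (H z - \<psi> z))"
      unfolding matrix_diff_mult by (rule entry_norm_triangle)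
    also have "\<dots> \<le> entry_norm (F z - \<phi> z) * entry_norm (H z) + entry_norm (\<phi> z) * entry_norm (H z - \<psi> z)"
      by (intro add_mono entry_norm_mult)
    also have "\<dots> \<le> \<epsilon> / (2 * b) * b + b' * (\<epsilon> / (2 * b'))"
      using \<phi>(2)[OF z] b(2)[OF z] \<psi>(2)[OF z] b'(2)[OF z] e b(1) b'(1) by (intro add_mono mult_mono) auto
    also have "\<dots> = \<epsilon>" using b(1) b'(1) by simp
    finally show ?thesis .
  qed
  then show "\<exists>\<theta>\<in>S0. \<forall>z\<in>P. entry_norm (F z ** H z - \<theta> z) \<le> \<epsilon>"
    by (intro bexI[OF _ S0_mult[OF \<phi>(1) \<psi>(1)]]) simp
qed

lemma S0_limits_scalar:
  fixes P :: "('n::finite, 'd::finite) tuple set"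
  assumes "f \<in> I0_limits P"
  shows "(\<lambda>z. cscale (f z) (mat 1)) \<in> S0_limits P"
proof (rule S0_limitsI)
  fix \<epsilon> :: real assume e: "\<epsilon> > 0"
  then have e': "\<epsilon> / CARD('n) > 0" by simp
  obtain p where p: "p \<in> I0" "\<And>z. z \<in> P \<Longrightarrow> cmod (f z - p z) \<le> \<epsilon> / CARD('n)" using I0_limitsD[OF assms e'] by blast
  have "entry_norm (cscale (f z) (mat 1) - cscale (p z) (mat 1 :: complex^'n^'n)) \<le> \<epsilon>" if "z \<in> P" for z
  proof -
    have "cscale (f z) (mat 1) - cscale (p z) (mat 1 :: complex^'n^'n) = cscale (f z - p z) (mat 1)"
      by (simp add: vec_eq_iff algebra_simps)
    then show ?thesis using p(2)[OF that] by (simp add: entry_norm_cscale entry_norm_one field_simps)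
  qed
  then show "\<exists>\<theta>\<in>S0. \<forall>z\<in>P. entry_norm (cscale (f z) (mat 1) - \<theta> z) \<le> \<epsilon>"
    by (intro bexI[OF _ S0_I0[OF p(1)]]) simp
qed

lemma cscale_one_mult: "cscale c (mat 1) ** A = cscale c A" "A ** cscale c (mat 1) = cscale c A"
  by (simp_all add: vec_eq_iff mat_mult_component mat_def if_distrib[of "\<lambda>x. x * _"] if_distrib[of "\<lambda>x. _ * x"] mult_ac
      cong: if_cong)

lemma S0_limits_cscale:
  assumes "compact P" "f \<in> I0_limits P" "F \<in> S0_limits P"
  shows "(\<lambda>z. cscale (f z) (F z)) \<in> S0_limits P"
  using S0_limits_mult[OF assms(1) S0_limits_scalar[OF assms(2)] assms(3)] by (simp add: cscale_one_mult)

lemma S0_limits_const: "(\<lambda>z. mat 1) \<in> S0_limits P" "(\<lambda>z. 0) \<in> S0_limits P"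
  using S0_limits_S0[OF S0_one, of P] S0_limits_S0[OF S0_scale[OF S0_one, of 0], of P]
  by (simp_all add: cscale_def zero_vec_def)

lemma S0_limits_sum: "(\<And>i. i \<in> S \<Longrightarrow> F i \<in> S0_limits P) \<Longrightarrow> (\<lambda>z. \<Sum>i\<in>S. F i z) \<in> S0_limits P"
  by (induction S rule: infinite_finite_induct) (auto intro: S0_limits_add S0_limits_const)

lemma S0_sum:
  assumes "finite S" "\<And>i. i \<in> S \<Longrightarrow> F i \<in> S0" shows "(\<lambda>z. \<Sum>i\<in>S. F i z) \<in> S0"
  using assms
proof (induction S rule: finite_induct)
  case empty
  have "(\<lambda>z. cscale 0 (mat 1)) \<in> S0" by (rule S0_scale[OF S0_one])
  then show ?case by (simp add: cscale_def zero_vec_def)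
qed (auto intro: S0_add)

lemma I0_limits_trace:
  assumes "F \<in> S0_limits P" shows "(\<lambda>z. trace (F z)) \<in> I0_limits P"
proof (rule I0_limitsI)
  fix \<epsilon> :: real assume e: "\<epsilon> > 0"
  obtain \<phi> where \<phi>: "\<phi> \<in> S0" "\<And>z. z \<in> P \<Longrightarrow> entry_norm (F z - \<phi> z) \<le> \<epsilon>" using S0_limitsD[OF assms e] by blast
  have "cmod (trace (F z) - trace (\<phi> z)) \<le> \<epsilon>" if "z \<in> P" for z
    using entry_norm_trace[of "F z - \<phi> z"] \<phi>(2)[OF that] by (simp add: trace_sub)
  then show "\<exists>p\<in>I0. \<forall>z\<in>P. cmod (trace (F z) - p z) \<le> \<epsilon>"
    by (intro bexI[OF _ I0_trace_S0[OF \<phi>(1)]]) simp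
qed

lemma unitary_invertible: "k \<in> unitary_group \<Longrightarrow> invertible k"
  by (auto simp: unitary_group_def invertible_def)

lemma S0_limits_equivariant:
  assumes F: "F \<in> S0_limits P" and z: "z \<in> P" "conj_tuple k z \<in> P" and k: "invertible k"
  shows "F (conj_tuple k z) = conj_mat k (F z)"
proof -
  define c where "c = 1 + entry_norm (matrix_inv k) * entry_norm k"
  have c: "c > 0" by (auto simp: c_def intro: add_pos_nonneg)
  let ?E = "F (conj_tuple k z) - conj_mat k (F z)"
  have "entry_norm ?E \<le> c * \<epsilon>" if e: "\<epsilon> > 0" for \<epsilon>
  proof -
    obtain \<phi> where \<phi>: "\<phi> \<in> S0" "\<And>z. z \<in> P \<Longrightarrow> entry_norm (F z - \<phi> z) \<le> \<epsilon>" using S0_limitsD[OF F e] by blast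
    have eq: "\<phi> (conj_tuple k z) = conj_mat k (\<phi> z)" by (rule S0_polynomial_equivariant(2)[OF \<phi>(1) k])
    have "conj_mat k (\<phi> z) - conj_mat k (F z) = matrix_inv k ** (\<phi> z - F z) ** k"
      by (simp add: conj_mat_def matrix_mult_diff_left matrix_mult_diff_right)
    then have "?E = (F (conj_tuple k z) - \<phi> (conj_tuple k z)) + matrix_inv k ** (\<phi> z - F z) ** k"
      using eq by (simp add: algebra_simps)
    then have "entry_norm ?E \<le> entry_norm (F (conj_tuple k z) - \<phi> (conj_tuple k z)) + entry_norm (matrix_inv k ** (\<phi> z - F z) ** k)"
      using entry_norm_triangle by metis
    also have "entry_norm (matrix_inv k ** (\<phi> z - F z) ** k) \<le> entry_norm (matrix_inv k) * entry_norm (\<phi> z - F z) * entry_norm k"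
      by (rule order_trans[OF entry_norm_mult]) (intro mult_right_mono entry_norm_mult entry_norm_nonneg)
    also have "\<dots> \<le> entry_norm (matrix_inv k) * \<epsilon> * entry_norm k"
      using \<phi>(2)[OF z(1)] by (intro mult_right_mono mult_left_mono) (auto simp: entry_norm_minus_commute)
    finally show ?thesis using \<phi>(2)[OF z(2)] by (simp add: c_def algebra_simps)
  qed
  from this[of "entry_norm ?E / (2 * c)"] c have "entry_norm ?E \<le> 0"
    by (cases "entry_norm ?E > 0") (auto simp: not_less)
  then show ?thesis using entry_norm_zeroD by fastforce
qed

section \<open>Dual families\<close>

text \<open>Families with \<open>\<Sum>\<^sub>k x\<^sub>k a y\<^sub>k = f tr a\<close> and \<open>\<Sum>\<^sub>k tr (y\<^sub>k a) x\<^sub>k = f a\<close> for all matrices \<open>a\<close> at every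
  point of \<open>P\<close>. Both identities are equivalent to the one for the matrix entries used here. The families are
  lists of pairs, so that they can be joined.\<close>

definition dual_family :: "('n::finite, 'd::finite) tuple set \<Rightarrow> (('n, 'd) tuple \<Rightarrow> complex) \<Rightarrow>
    ((('n, 'd) tuple \<Rightarrow> complex^'n^'n) \<times> (('n, 'd) tuple \<Rightarrow> complex^'n^'n)) list \<Rightarrow> bool" where
  "dual_family P f xys \<longleftrightarrow> set xys \<subseteq> S0_limits P \<times> S0_limits P \<and>
     (\<forall>z\<in>P. \<forall>a b c d. (\<Sum>(x, y)\<leftarrow>xys. x z $ a $ b * y z $ d $ c) = (if a = c \<and> b = d then f z else 0))"

text \<open>The Gram matrix \<open>G\<close> of functions \<open>w\<^sub>j\<close> whose values at \<open>z\<^sub>0\<close> are the matrix units is inverted by Cramer's rule;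
  squaring its determinant makes the identity hold trivially where \<open>G\<close> is singular.\<close>

lemma local_dual_family:
  fixes z0 :: "('n::finite, 'd::finite) tuple"
  assumes z0: "z0 \<in> generating_tuples"
  shows "\<exists>q\<in>I0. q z0 \<noteq> 0 \<and> (\<exists>xys. dual_family P q xys)"
proof -
  define unit :: "'n \<times> 'n \<Rightarrow> complex^'n^'n"
    where "unit ab = (\<chi> i j. if ab = (i, j) then 1 else 0)" for ab
  have "\<forall>ab. \<exists>F. F \<in> G0 \<and> F z0 = unit ab"
    using G0_value[OF z0] by blast
  from choice[OF this] obtain w where w: "\<And>ab. w ab \<in> G0" "\<And>ab. w ab z0 = unit ab"
    by blast
  define W where "W z = (\<chi> j ab. w j z $ fst ab $ snd ab)" for z
  define W' where "W' z = (\<chi> ab j. w j z $ snd ab $ fst ab)" for z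
  define G where "G z = W z ** W' z" for z
  define adj where "adj z j k = det (\<chi> i l. if l = j then axis k 1 $ i else G z $ i $ l)" for z j k
  define p where "p z = det (G z)" for z
  have G_entry: "G z $ j $ k = trace (w j z ** w k z)" for z j k
  proof -
    have "G z $ j $ k = (\<Sum>ab\<in>UNIV \<times> UNIV. w j z $ fst ab $ snd ab * w k z $ snd ab $ fst ab)"
      by (simp add: G_def W_def W'_def matrix_matrix_mult_def)
    also have "\<dots> = (\<Sum>a\<in>UNIV. \<Sum>b\<in>UNIV. w j z $ a $ b * w k z $ b $ a)"
      by (simp add: sum.cartesian_product case_prod_unfold)
    finally show ?thesis by (simp add: trace_def mat_mult_component)
  qed
  have G_I0: "(\<lambda>z. G z $ j $ k) \<in> I0" for j k
    unfolding G_entry by (intro I0_trace_S0 S0_mult S0_G0 w)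
  have p_I0: "p \<in> I0" unfolding p_def by (rule I0_det[OF G_I0])
  have adj_I0: "(\<lambda>z. adj z j k) \<in> I0" for j k
    unfolding adj_def
  proof (rule I0_det)
    fix i l
    show "(\<lambda>z. (\<chi> i l. if l = j then axis k 1 $ i else G z $ i $ l) $ i $ l) \<in> I0"
      by (cases "l = j") (simp_all add: I0_const G_I0)
  qed
  have p_z0: "p z0 \<noteq> 0"
  proof -
    have W1: "W z0 = mat 1"
      by (simp add: W_def w(2) unit_def mat_def vec_eq_iff)
    have W'1: "W' z0 $ ab $ k = (if k = (snd ab, fst ab) then 1 else 0)" for ab k
      by (simp add: W'_def w(2) unit_def)
    have "(W' z0 ** W' z0) $ ab $ cd = (if ab = cd then 1 else 0)" for ab cd
      by (cases ab; cases cd) (simp add: matrix_matrix_mult_def W'1 if_distrib[of "\<lambda>x. x * _"] cong: if_cong)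
    then have "W' z0 ** W' z0 = mat 1" by (simp add: vec_eq_iff mat_def)
    then have "det (W' z0) * det (W' z0) = 1" by (metis det_mul det_I)
    then show ?thesis by (auto simp: p_def G_def W1)
  qed
  have inverse: "(\<Sum>k\<in>UNIV. \<Sum>j\<in>UNIV. w j z $ b $ a * adj z j k * w k z $ c $ d) = (if a = c \<and> b = d then p z else 0)"
    if "p z \<noteq> 0" for z a b c d
  proof -
    define B where "B = (\<chi> j k. adj z j k / p z)"
    have col: "G z *v (\<chi> j. adj z j k / p z) = axis k 1" for k
      using cramer[of "G z" "\<chi> j. adj z j k / p z" "axis k 1"] that by (simp add: p_def adj_def)
    have "(G z ** B) $ i $ k = (if i = k then 1 else 0)" for i k
    proof -
      have "(G z ** B) $ i $ k = (G z *v (\<chi> j. adj z j k / p z)) $ i"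
        by (simp add: matrix_vector_mult_def matrix_matrix_mult_def B_def)
      then show ?thesis by (simp add: col axis_def)
    qed
    then have "G z ** B = mat 1" by (simp add: vec_eq_iff mat_def)
    then have "W z ** (W' z ** B) = mat 1" by (simp add: G_def matrix_mul_assoc)
    then have 1: "(W' z ** B) ** W z = mat 1" by (simp add: matrix_left_right_inverse)
    have "(\<Sum>k\<in>UNIV. \<Sum>j\<in>UNIV. w j z $ b $ a * (adj z j k / p z) * w k z $ c $ d) = (mat 1 :: complex^('n\<times>'n)^('n\<times>'n)) $ (a, b) $ (c, d)"
      unfolding 1[symmetric] by (simp add: matrix_matrix_mult_def B_def W_def W'_def sum_distrib_right)
    then have "(\<Sum>k\<in>UNIV. \<Sum>j\<in>UNIV. w j z $ b $ a * adj z j k * w k z $ c $ d) / p z = (if a = c \<and> b = d then 1 else 0)"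
      by (simp add: sum_divide_distrib mat_def)
    then show ?thesis using that by (auto simp: divide_simps split: if_splits)
  qed
  define y where "y k z = cscale (p z) (\<Sum>j\<in>UNIV. cscale (adj z j k) (w j z))" for k z
  have y_S0: "y k \<in> S0" for k
  proof -
    have "(\<lambda>z. cscale (p z) (mat 1) ** (\<Sum>j\<in>UNIV. cscale (adj z j k) (mat 1) ** w j z)) \<in> S0"
      by (intro S0_mult S0_I0 p_I0 adj_I0 S0_sum S0_G0 w) auto
    then show ?thesis unfolding y_def cscale_one_mult .
  qed
  obtain ks :: "('n \<times> 'n) list" where ks: "set ks = UNIV" "distinct ks"
    using finite_distinct_list[of "UNIV :: ('n \<times> 'n) set"] by auto
  have "dual_family P (\<lambda>z. p z * p z) (map (\<lambda>k. (w k, y k)) ks)"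
    unfolding dual_family_def
  proof (intro conjI ballI allI)
    show "set (map (\<lambda>k. (w k, y k)) ks) \<subseteq> S0_limits P \<times> S0_limits P"
      using S0_limits_S0[OF y_S0] S0_limits_S0[OF S0_G0[OF w(1)]] by auto
    fix z a b c d
    have "(\<Sum>(x, y)\<leftarrow>map (\<lambda>k. (w k, y k)) ks. x z $ a $ b * y z $ d $ c) = (\<Sum>k\<in>UNIV. w k z $ a $ b * y k z $ d $ c)"
      using ks by (simp add: o_def sum_list_distinct_conv_sum_set)
    also have "\<dots> = p z * (\<Sum>k\<in>UNIV. \<Sum>j\<in>UNIV. w j z $ d $ c * adj z j k * w k z $ a $ b)"
      by (simp add: y_def sum_distrib_left mult_ac)
    also have "\<dots> = (if a = c \<and> b = d then p z * p z else 0)"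
      using inverse[of z d c a b] by (cases "p z = 0") auto
    finally show "(\<Sum>(x, y)\<leftarrow>map (\<lambda>k. (w k, y k)) ks. x z $ a $ b * y z $ d $ c) = (if a = c \<and> b = d then p z * p z else 0)" .
  qed
  then show ?thesis
    using p_z0 by (intro bexI[OF _ I0_mult[OF p_I0 p_I0]]) auto
qed

context reduced_domain
begin

text \<open>The \<open>f\<close> that have a dual family form an ideal: families can be joined and multiplied by a function. This ideal has
  no zero on \<open>P\<close>.\<close>

theorem global_dual_family: "\<exists>xys. dual_family P (\<lambda>z. 1) xys"
proof -
  let ?J = "{f \<in> I0_limits P. \<exists>xys. dual_family P f xys}"
  have "I0_limits_ideal P ?J"
    unfolding I0_limits_ideal_def
  proof (intro conjI ballI allI impI)
    show "?J \<subseteq> I0_limits P" by blast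
    have "dual_family P 0 []" by (simp add: dual_family_def)
    then show "0 \<in> ?J" using I0_limits_I0[OF I0_const[of 0], of P] by (auto simp: zero_fun_def)
  next
    fix f g assume f: "f \<in> ?J" and g: "g \<in> ?J"
    then obtain xs ys where "dual_family P f xs" "dual_family P g ys" by blast
    then have "dual_family P (f + g) (xs @ ys)" by (simp add: dual_family_def)
    moreover have "f + g \<in> I0_limits P" using f g by (simp add: plus_fun_def I0_limits_add)
    ultimately show "f + g \<in> ?J" by blast
  next
    fix f g assume f: "f \<in> I0_limits P" and g: "g \<in> ?J"
    then obtain xs where xs: "dual_family P g xs" by blast
    have "(\<Sum>(x, y)\<leftarrow>map (\<lambda>(x, y). (\<lambda>z. cscale (f z) (x z), y)) xs. x z $ a $ b * y z $ d $ c)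
      = f z * (\<Sum>(x, y)\<leftarrow>xs. x z $ a $ b * y z $ d $ c)" for z a b c d
      by (induction xs) (auto simp: algebra_simps)
    then have "dual_family P (f * g) (map (\<lambda>(x, y). (\<lambda>z. cscale (f z) (x z), y)) xs)"
      using xs f by (auto simp: dual_family_def intro!: S0_limits_cscale[OF compact_P])
    moreover have "f * g \<in> I0_limits P" using f g by (simp add: times_fun_def I0_limits_mult[OF compact_P])
    ultimately show "f * g \<in> ?J" by blast
  next
    fix f g assume f: "f \<in> ?J" and eq: "\<forall>z\<in>P. g z = f z"
    then have "dual_family P f xs \<Longrightarrow> dual_family P g xs" for xs by (simp add: dual_family_def)
    then show "g \<in> ?J" using f eq I0_limits_cong[of f P g] by blast
  qed
  moreover have "\<not> (\<exists>z\<in>P. \<forall>f\<in>?J. f z = 0)"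
  proof
    assume "\<exists>z\<in>P. \<forall>f\<in>?J. f z = 0"
    then obtain z where z: "z \<in> P" "\<forall>f\<in>?J. f z = 0" by blast
    obtain q xys where "q \<in> I0" "q z \<noteq> 0" "dual_family P q xys"
      using local_dual_family[OF P_generating[OF z(1)], of P] by blast
    then show False using z(2) I0_limits_I0 by blast
  qed
  ultimately have "1 \<in> ?J" using I0_limits_nullstellensatz_reduced[of ?J] by blast
  then show ?thesis by (simp add: one_fun_def)
qed

text \<open>A fixed dual family for the constant 1, consisting of \<open>dx k\<close> and \<open>dy k\<close> for \<open>k < N\<close>. At each point of \<open>P\<close> it plays the
  part of two bases of the matrix algebra that are dual for the trace form.\<close>

definition dual_list where
  "dual_list = (SOME xys. dual_family P (\<lambda>z. 1) xys)"

definition N :: nat where "N = length dual_list"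
definition dx where "dx k = fst (dual_list ! k)"
definition dy where "dy k = snd (dual_list ! k)"

lemma dx_limits: "k < N \<Longrightarrow> dx k \<in> S0_limits P" and dy_limits: "k < N \<Longrightarrow> dy k \<in> S0_limits P"
  and dual_sum: "z \<in> P \<Longrightarrow> (\<Sum>k<N. dx k z $ a $ b * dy k z $ d $ c) = (if a = c \<and> b = d then 1 else 0)"
proof -
  have d: "dual_family P (\<lambda>z. 1) dual_list"
    unfolding dual_list_def by (rule someI_ex[OF global_dual_family])
  then have sub: "set dual_list \<subseteq> S0_limits P \<times> S0_limits P" by (simp add: dual_family_def)
  show "dx k \<in> S0_limits P" "dy k \<in> S0_limits P" if "k < N"
    using subsetD[OF sub nth_mem] that by (auto simp: N_def dx_def dy_def mem_Times_iff)
  show "(\<Sum>k<N. dx k z $ a $ b * dy k z $ d $ c) = (if a = c \<and> b = d then 1 else 0)" if "z \<in> P"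
    using d that by (simp add: dual_family_def N_def dx_def dy_def sum_list_sum_nth split_def atLeast0LessThan)
qed

lemma casimir: "z \<in> P \<Longrightarrow> (\<Sum>k<N. dx k z ** A ** dy k z) = cscale (trace A) (mat 1)"
proof -
  assume z: "z \<in> P"
  have "(\<Sum>k<N. dx k z ** A ** dy k z) $ a $ c = (cscale (trace A) (mat 1)) $ a $ c" for a c
  proof -
    have "(\<Sum>k<N. dx k z ** A ** dy k z) $ a $ c = (\<Sum>k<N. \<Sum>d\<in>UNIV. \<Sum>b\<in>UNIV. A $ b $ d * (dx k z $ a $ b * dy k z $ d $ c))"
      by (simp add: mat_mult_component sum_distrib_left sum_distrib_right mult_ac)
    also have "\<dots> = (\<Sum>d\<in>UNIV. \<Sum>k<N. \<Sum>b\<in>UNIV. A $ b $ d * (dx k z $ a $ b * dy k z $ d $ c))"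
      by (rule sum.swap)
    also have "\<dots> = (\<Sum>d\<in>UNIV. \<Sum>b\<in>UNIV. \<Sum>k<N. A $ b $ d * (dx k z $ a $ b * dy k z $ d $ c))"
      by (rule sum.cong[OF refl]) (rule sum.swap)
    also have "\<dots> = (\<Sum>d\<in>UNIV. \<Sum>b\<in>UNIV. if b = d then (if a = c then A $ b $ d else 0) else 0)"
      by (simp only: sum_distrib_left[symmetric] dual_sum[OF z]) (intro sum.cong refl, auto)
    also have "\<dots> = (\<Sum>d\<in>UNIV. if a = c then A $ d $ d else 0)" by simp
    also have "\<dots> = (cscale (trace A) (mat 1)) $ a $ c" by (auto simp: trace_def mat_def)
    finally show ?thesis .
  qed
  then show ?thesis by (simp add: vec_eq_iff)
qed

lemma expansion: "z \<in> P \<Longrightarrow> (\<Sum>k<N. cscale (trace (dy k z ** A)) (dx k z)) = A"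
proof -
  assume z: "z \<in> P"
  have "(\<Sum>k<N. cscale (trace (dy k z ** A)) (dx k z)) $ a $ b = A $ a $ b" for a b
  proof -
    have "(\<Sum>k<N. cscale (trace (dy k z ** A)) (dx k z)) $ a $ b
       = (\<Sum>k<N. \<Sum>d\<in>UNIV. \<Sum>c\<in>UNIV. A $ c $ d * (dx k z $ a $ b * dy k z $ d $ c))"
      by (simp add: mat_mult_component trace_def sum_distrib_left sum_distrib_right mult_ac)
    also have "\<dots> = (\<Sum>d\<in>UNIV. \<Sum>k<N. \<Sum>c\<in>UNIV. A $ c $ d * (dx k z $ a $ b * dy k z $ d $ c))"
      by (rule sum.swap)
    also have "\<dots> = (\<Sum>d\<in>UNIV. \<Sum>c\<in>UNIV. \<Sum>k<N. A $ c $ d * (dx k z $ a $ b * dy k z $ d $ c))"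
      by (rule sum.cong[OF refl]) (rule sum.swap)
    also have "\<dots> = (\<Sum>d\<in>UNIV. \<Sum>c\<in>UNIV. if c = a then (if d = b then A $ c $ d else 0) else 0)"
      by (simp only: sum_distrib_left[symmetric] dual_sum[OF z]) (intro sum.cong refl, auto)
    also have "\<dots> = A $ a $ b" by simp
    finally show ?thesis .
  qed
  then show ?thesis by (simp add: vec_eq_iff)
qed

lemma I0_limits_zero:
  assumes "f \<in> I0_limits P" "\<And>z. z \<in> Pb \<Longrightarrow> f z = 0" "z \<in> P" shows "f z = 0"
proof -
  obtain y where "y \<in> Pb" "\<forall>z\<in>P. cmod (f z) \<le> cmod (f y)" using maximum_on_Pb[OF assms(1)] by blast
  then show ?thesis using assms(2)[of y] assms(3) by auto
qed

text \<open>By the maximum principle on the Shilov boundary, limits on the part of \<open>P\<close> over the boundary extend to \<open>P\<close>.\<close>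

lemma scalar_extension:
  assumes g: "\<And>\<epsilon>. \<epsilon> > 0 \<Longrightarrow> \<exists>p\<in>I0_limits P. \<forall>z\<in>Pb. cmod (g z - p z) \<le> \<epsilon>"
  shows "\<exists>f\<in>I0_limits P. \<forall>z\<in>Pb. f z = g z"
proof -
  define e where "e n = inverse (real (Suc n))" for n
  have e: "e n > 0" "n \<le> m \<Longrightarrow> e m \<le> e n" for n m by (auto simp: e_def intro!: le_imp_inverse_le)
  have small: "\<exists>n. e n < \<epsilon>" if "\<epsilon> > 0" for \<epsilon> using reals_Archimedean[OF that] by (simp add: e_def)
  obtain p where p: "\<And>n. p n \<in> I0_limits P" "\<And>n z. z \<in> Pb \<Longrightarrow> cmod (g z - p n z) \<le> e n"
    using g[OF e(1)] by metis
  have close: "cmod (p n z - p m z) \<le> 2 * e n" if "n \<le> m" "z \<in> P" for n m z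
  proof -
    obtain y where y: "y \<in> Pb" "\<forall>z\<in>P. cmod (p n z - p m z) \<le> cmod (p n y - p m y)"
      using maximum_on_Pb[OF I0_limits_diff[OF compact_P p(1)[of n] p(1)[of m]]] by blast
    have "cmod (p n y - p m y) \<le> cmod (g y - p m y) + cmod (g y - p n y)"
      using norm_triangle_ineq4[of "g y - p m y" "g y - p n y"] by simp
    then show ?thesis using p(2)[OF y(1), of n] p(2)[OF y(1), of m] e(2)[OF that(1)] y(2) that(2) by fastforce
  qed
  have "\<exists>l. (\<lambda>n. p n z) \<longlonglongrightarrow> l" if z: "z \<in> P" for z
  proof -
    have "Cauchy (\<lambda>n. p n z)"
      unfolding Cauchy_altdef
    proof (intro allI impI)
      fix \<epsilon> :: real assume "\<epsilon> > 0"
      then obtain n where n: "e n < \<epsilon> / 2" using small[of "\<epsilon> / 2"] by auto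
      have "dist (p m z) (p k z) < \<epsilon>" if mk: "m \<ge> n" "k > m" for m k
      proof -
        have "cmod (p m z - p k z) \<le> 2 * e m" by (rule close) (use mk z in auto)
        also have "\<dots> \<le> 2 * e n" using e(2)[OF mk(1)] by simp
        finally show ?thesis using n by (simp add: dist_norm)
      qed
      then show "\<exists>M. \<forall>m\<ge>M. \<forall>k>m. dist (p m z) (p k z) < \<epsilon>" by (intro exI[of _ n]) simp
    qed
    then show ?thesis by (simp add: Cauchy_convergent_iff convergent_def)
  qed
  then obtain f where f: "\<And>z. z \<in> P \<Longrightarrow> (\<lambda>n. p n z) \<longlonglongrightarrow> f z" by metis
  have fp: "cmod (f z - p n z) \<le> 2 * e n" if z: "z \<in> P" for z n
  proof (rule LIMSEQ_le_const2)
    show "(\<lambda>m. cmod (p m z - p n z)) \<longlonglongrightarrow> cmod (f z - p n z)" by (intro tendsto_intros f z)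
    show "\<exists>M. \<forall>m\<ge>M. cmod (p m z - p n z) \<le> 2 * e n"
      using close[of n _ z] z by (auto simp: norm_minus_commute)
  qed
  have "f \<in> I0_limits P"
  proof (rule I0_limits_closed)
    fix \<epsilon> :: real assume "\<epsilon> > 0"
    then obtain n where n: "e n < \<epsilon> / 2" using small[of "\<epsilon> / 2"] by auto
    then have "\<forall>z\<in>P. cmod (f z - p n z) \<le> \<epsilon>" using fp[of _ n] by fastforce
    then show "\<exists>g\<in>I0_limits P. \<forall>z\<in>P. cmod (f z - g z) \<le> \<epsilon>" using p(1) by blast
  qed
  moreover have "f z = g z" if z: "z \<in> Pb" for z
  proof -
    have "cmod (f z - g z) \<le> \<epsilon>" if e0: "\<epsilon> > 0" for \<epsilon>
    proof -
      have "\<epsilon> / 3 > 0" using e0 by simp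
      from small[OF this] obtain n where n: "e n < \<epsilon> / 3" by blast
      have "cmod (f z - g z) \<le> cmod (f z - p n z) + cmod (g z - p n z)"
        using norm_triangle_ineq4[of "f z - p n z" "g z - p n z"] by simp
      then show ?thesis using fp[OF Pb_sub[OF z], of n] p(2)[OF z, of n] n by simp
    qed
    then have "cmod (f z - g z) \<le> 0" by (rule field_le_epsilon[of _ 0, simplified])
    then show ?thesis by simp
  qed
  ultimately show ?thesis by blast
qed

lemma S0_limits_expansion:
  assumes "F \<in> S0_limits P" "k < N" shows "(\<lambda>z. trace (dy k z ** F z)) \<in> I0_limits P"
  by (intro I0_limits_trace S0_limits_mult[OF compact_P] dy_limits assms)

lemma S0_limits_zero:
  assumes F: "F \<in> S0_limits P" "\<And>z. z \<in> Pb \<Longrightarrow> F z = 0" and z: "z \<in> P" shows "F z = 0"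
proof -
  have "trace (dy k z ** F z) = 0" if "k < N" for k
    by (rule I0_limits_zero[OF S0_limits_expansion[OF F(1) that] _ z])
      (simp add: F(2) trace_def mat_mult_component)
  then have "(\<Sum>k<N. cscale (trace (dy k z ** F z)) (dx k z)) = 0"
    by (intro sum.neutral) (simp add: cscale_def vec_eq_iff)
  then show ?thesis using expansion[OF z] by simp
qed

text \<open>The coefficients of \<open>H\<close> with respect to the dual family extend, hence so does \<open>H\<close>.\<close>

lemma S0_limits_extension:
  assumes H: "\<And>\<epsilon>. \<epsilon> > 0 \<Longrightarrow> \<exists>\<phi>\<in>S0. \<forall>z\<in>Pb. entry_norm (H z - \<phi> z) \<le> \<epsilon>"
  shows "\<exists>F\<in>S0_limits P. \<forall>z\<in>Pb. F z = H z"
proof -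
  have "\<exists>f\<in>I0_limits P. \<forall>z\<in>Pb. f z = trace (dy k z ** H z)" if k: "k < N" for k
  proof (rule scalar_extension)
    fix \<epsilon> :: real assume e: "\<epsilon> > 0"
    obtain b where b: "b > 0" "\<And>z. z \<in> P \<Longrightarrow> entry_norm (dy k z) \<le> b"
      using S0_limits_bounded[OF compact_P dy_limits[OF k]] by blast
    have "\<epsilon> / b > 0" using e b by simp
    then obtain \<phi> where \<phi>: "\<phi> \<in> S0" "\<forall>z\<in>Pb. entry_norm (H z - \<phi> z) \<le> \<epsilon> / b" using H by blast
    have "cmod (trace (dy k z ** H z) - trace (dy k z ** \<phi> z)) \<le> \<epsilon>" if z: "z \<in> Pb" for z
    proof -
      have "trace (dy k z ** H z) - trace (dy k z ** \<phi> z) = trace (dy k z ** (H z - \<phi> z))"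
        by (simp add: trace_def mat_mult_component sum_subtractf[symmetric] algebra_simps)
      also have "cmod \<dots> \<le> entry_norm (dy k z) * entry_norm (H z - \<phi> z)"
        by (rule order_trans[OF entry_norm_trace entry_norm_mult])
      also have "\<dots> \<le> b * (\<epsilon> / b)"
        using b(2)[OF Pb_sub[OF z]] \<phi>(2) z b(1) by (intro mult_mono) auto
      finally show ?thesis using b(1) by simp
    qed
    then show "\<exists>p\<in>I0_limits P. \<forall>z\<in>Pb. cmod (trace (dy k z ** H z) - p z) \<le> \<epsilon>"
      by (intro bexI[OF _ S0_limits_expansion[OF S0_limits_S0[OF \<phi>(1)] k]]) simp
  qed
  then obtain f where f: "\<And>k. k < N \<Longrightarrow> f k \<in> I0_limits P" "\<And>k z. k < N \<Longrightarrow> z \<in> Pb \<Longrightarrow> f k z = trace (dy k z ** H z)"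
    by metis
  have "(\<lambda>z. \<Sum>k<N. cscale (f k z) (dx k z)) \<in> S0_limits P"
    by (intro S0_limits_sum S0_limits_cscale[OF compact_P] f dx_limits) auto
  moreover have "(\<Sum>k<N. cscale (f k z) (dx k z)) = H z" if z: "z \<in> Pb" for z
    using expansion[OF Pb_sub[OF z], of "H z"] f(2)[OF _ z] by simp
  ultimately show ?thesis by (intro bexI) auto
qed

end


section \<open>Points of the matrix bundle\<close>

lemma matrix_inv_unique:
  fixes s :: "complex^'n^'n"
  assumes "s ** t = mat 1" "t ** s = mat 1"
  shows "matrix_inv s = t"
proof -
  have inv: "invertible s" using assms by (auto simp: invertible_def)
  have "matrix_inv s = matrix_inv s ** (s ** t)" by (simp add: assms(1))
  also have "\<dots> = t" by (simp add: matrix_mul_assoc matrix_inv_mult[OF inv])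
  finally show ?thesis .
qed

lemma unitary_inv: "k \<in> unitary_group \<Longrightarrow> matrix_inv k = conj_transpose k"
  by (rule matrix_inv_unique) (auto simp: unitary_group_def)

lemma conj_transpose_mult: "conj_transpose (A ** B) = conj_transpose B ** conj_transpose A"
  by (simp add: conj_transpose_def vec_eq_iff mat_mult_component mult.commute)

lemma conj_transpose_twice: "conj_transpose (conj_transpose A) = A"
  by (simp add: conj_transpose_def vec_eq_iff)

lemma unitary_one: "mat 1 \<in> unitary_group"
proof -
  have "conj_transpose (mat 1) = (mat 1 :: complex^'n^'n)"
    by (simp add: conj_transpose_def mat_def vec_eq_iff)
  then show ?thesis by (simp add: unitary_group_def)
qed

lemma unitary_mult:
  assumes "k \<in> unitary_group" "l \<in> unitary_group" shows "k ** l \<in> unitary_group"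
proof -
  have "conj_transpose l ** conj_transpose k ** (k ** l) = conj_transpose l ** (conj_transpose k ** k) ** l"
    "k ** l ** (conj_transpose l ** conj_transpose k) = k ** (l ** conj_transpose l) ** conj_transpose k"
    by (simp_all only: matrix_mul_assoc)
  then show ?thesis using assms by (simp add: unitary_group_def conj_transpose_mult)
qed

lemma unitary_conj_transpose: "k \<in> unitary_group \<Longrightarrow> conj_transpose k \<in> unitary_group"
  by (simp add: unitary_group_def conj_transpose_twice)

lemma conj_mat_conj_mat:
  assumes "k \<in> unitary_group" "l \<in> unitary_group"
  shows "conj_mat l (conj_mat k A) = conj_mat (k ** l) A"
  using assms unitary_mult[OF assms]
  by (simp add: conj_mat_def unitary_inv conj_transpose_mult matrix_mul_assoc)

lemma conj_mat_unit: "conj_mat (mat 1) A = A"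
  by (simp add: conj_mat_def matrix_inv_unique[of "mat 1" "mat 1"])

lemma conj_tuple_conj_tuple:
  "k \<in> unitary_group \<Longrightarrow> l \<in> unitary_group \<Longrightarrow> conj_tuple l (conj_tuple k z) = conj_tuple (k ** l) z"
  by (simp add: conj_tuple_def conj_mat_conj_mat)

lemma conj_tuple_unit: "conj_tuple (mat 1) z = z"
  by (simp add: conj_tuple_def conj_mat_unit)

text \<open>Conjugation by \<open>k\<close> is determined by its effect on a generating tuple.\<close>

lemma conj_mat_eq_of_conj_tuple_eq:
  assumes z: "z \<in> generating_tuples" and k: "invertible k" "invertible l"
    and eq: "conj_tuple k z = conj_tuple l z"
  shows "conj_mat k A = conj_mat l A"
proof -
  let ?B = "{A. conj_mat k A = conj_mat l A}"
  have "unital_subalgebra ?B mat_alg"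
    using k by (auto simp: unital_subalgebra_def mat_alg_def conj_mat_add conj_mat_mult conj_mat_one conj_mat_cscale)
  moreover have "range (\<lambda>i. z $ i) \<subseteq> ?B"
    using eq by (auto simp: conj_tuple_def vec_eq_iff)
  ultimately have "generated_algebra mat_alg (range (\<lambda>i. z $ i)) \<subseteq> ?B"
    by (intro generated_algebra_least)
  then show ?thesis using z by (auto simp: generating_tuples_def)
qed

lemma in_bundle_point_iff:
  "(w, B) \<in> bundle_point z A \<longleftrightarrow> (\<exists>k\<in>unitary_group. w = conj_tuple k z \<and> B = conj_mat k A)"
  by (auto simp: bundle_point_def)

lemma bundle_point_self: "(z, A) \<in> bundle_point z A"
  unfolding in_bundle_point_iff by (rule bexI[OF _ unitary_one]) (simp add: conj_tuple_unit conj_mat_unit)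

lemma bundle_point_fibre_iff:
  assumes "z \<in> generating_tuples" shows "(z, B) \<in> bundle_point z A \<longleftrightarrow> B = A"
proof
  assume "(z, B) \<in> bundle_point z A"
  then obtain k where k: "k \<in> unitary_group" "z = conj_tuple k z" "B = conj_mat k A"
    unfolding in_bundle_point_iff by blast
  have "conj_mat k A = conj_mat (mat 1) A"
    using conj_mat_eq_of_conj_tuple_eq[OF assms unitary_invertible[OF k(1)] unitary_invertible[OF unitary_one]] k(2)
    by (simp add: conj_tuple_unit)
  then show "B = A" using k(3) by (simp add: conj_mat_unit)
qed (simp add: bundle_point_self)

lemma bundle_point_inject:
  assumes "z \<in> generating_tuples" "bundle_point z A = bundle_point z B" shows "A = B"
  using bundle_point_fibre_iff[OF assms(1), of A B] bundle_point_self[of z A] assms(2) by simp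

lemma bundle_point_conj:
  assumes k: "k \<in> unitary_group" shows "bundle_point (conj_tuple k z) (conj_mat k A) = bundle_point z A"
proof -
  have "\<exists>l'\<in>unitary_group. conj_tuple l (conj_tuple k z) = conj_tuple l' z \<and> conj_mat l (conj_mat k A) = conj_mat l' A"
    if l: "l \<in> unitary_group" for l
    by (rule bexI[OF _ unitary_mult[OF k l]]) (simp add: conj_tuple_conj_tuple k l conj_mat_conj_mat)
  moreover have "\<exists>l'\<in>unitary_group. conj_tuple l z = conj_tuple l' (conj_tuple k z) \<and> conj_mat l A = conj_mat l' (conj_mat k A)"
    if l: "l \<in> unitary_group" for l
  proof -
    have kl: "conj_transpose k ** l \<in> unitary_group" using k l by (intro unitary_mult unitary_conj_transpose)
    have "k ** (conj_transpose k ** l) = l" using k by (simp add: matrix_mul_assoc unitary_group_def)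
    then show ?thesis
      by (intro bexI[OF _ kl]) (simp add: conj_tuple_conj_tuple k kl conj_mat_conj_mat)
  qed
  ultimately show ?thesis
    by (auto simp: set_eq_iff in_bundle_point_iff)
qed

lemma bundle_proj_point: "bundle_proj (bundle_point z A) = \<pi>0 z"
proof -
  have "\<pi>0 (conj_tuple k z) = \<pi>0 z" if k: "k \<in> unitary_group" for k
  proof -
    have "p (conj_tuple k z) = p z" if "p \<in> I0" for p
      using that unitary_invertible[OF k] by (simp add: I0_def)
    then show ?thesis by (simp add: \<pi>0_def restrict_def fun_eq_iff)
  qed
  then have "(\<lambda>(z, A). \<pi>0 z) ` bundle_point z A = {\<pi>0 z}"
    using unitary_one by (auto simp: bundle_point_def image_image)
  then show ?thesis by (simp add: bundle_proj_def)
qed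

lemma fibre_op2_point:
  assumes z: "z \<in> generating_tuples"
    and g: "\<And>k. k \<in> unitary_group \<Longrightarrow> conj_mat k (g A B) = g (conj_mat k A) (conj_mat k B)"
  shows "fibre_op2 g (bundle_point z A) (bundle_point z B) = bundle_point z (g A B)"
proof (rule subset_antisym; rule subsetI)
    fix e assume "e \<in> fibre_op2 g (bundle_point z A) (bundle_point z B)"
    then obtain w A' B' where e: "e = (w, g A' B')" "(w, A') \<in> bundle_point z A" "(w, B') \<in> bundle_point z B"
      by (auto simp: fibre_op2_def)
    then obtain k l where k: "k \<in> unitary_group" "w = conj_tuple k z" "A' = conj_mat k A"
      and l: "l \<in> unitary_group" "w = conj_tuple l z" "B' = conj_mat l B"
      unfolding in_bundle_point_iff by blast
    have "B' = conj_mat k B"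
      using conj_mat_eq_of_conj_tuple_eq[OF z unitary_invertible[OF k(1)] unitary_invertible[OF l(1)]] k(2) l(2,3) by simp
    then have "g A' B' = conj_mat k (g A B)" using g[OF k(1)] k(3) by simp
    then show "e \<in> bundle_point z (g A B)" unfolding e(1) in_bundle_point_iff using k by blast
  next
    fix e assume "e \<in> bundle_point z (g A B)"
    then obtain k where k: "k \<in> unitary_group" "e = (conj_tuple k z, conj_mat k (g A B))"
      by (auto simp: bundle_point_def)
    then have "e = (conj_tuple k z, g (conj_mat k A) (conj_mat k B))" using g by simp
    then show "e \<in> fibre_op2 g (bundle_point z A) (bundle_point z B)"
      unfolding fibre_op2_def using in_bundle_point_iff k(1) by blast
qed

lemma fibre_op1_point:
  assumes g: "\<And>k. k \<in> unitary_group \<Longrightarrow> conj_mat k (g A) = g (conj_mat k A)"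
  shows "fibre_op1 g (bundle_point z A) = bundle_point z (g A)"
proof -
  have "fibre_op1 g (bundle_point z A) = (\<lambda>(w, B). (w, g B)) ` bundle_point z A"
    by (auto simp: fibre_op1_def)
  also have "\<dots> = (\<lambda>k. (conj_tuple k z, g (conj_mat k A))) ` unitary_group"
    by (simp add: bundle_point_def image_image)
  also have "\<dots> = bundle_point z (g A)"
    unfolding bundle_point_def by (rule image_cong) (simp_all add: g)
  finally show ?thesis .
qed

lemma norm_unitary:
  fixes k :: "complex^'n^'n" and v :: "complex^'n"
  assumes "k \<in> unitary_group" shows "norm (k *v v) = norm v"
proof -
  have sq: "of_real ((norm u)\<^sup>2) = (\<Sum>i\<in>UNIV. cnj (u $ i) * u $ i)" for u :: "complex^'n"
    by (simp add: norm_vec_def L2_set_def sum_nonneg complex_norm_square mult.commute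
        del: of_real_power)
  have ortho: "(\<Sum>i\<in>UNIV. cnj (k $ i $ j) * k $ i $ l) = (if j = l then 1 else 0)" for j l
  proof -
    have "(conj_transpose k ** k) $ j $ l = (mat 1 :: complex^'n^'n) $ j $ l" using assms by (simp add: unitary_group_def)
    then show ?thesis by (simp add: mat_mult_component conj_transpose_def mat_def)
  qed
  have "of_real ((norm (k *v v))\<^sup>2) = (\<Sum>i\<in>UNIV. (\<Sum>j\<in>UNIV. cnj (k $ i $ j) * cnj (v $ j)) * (\<Sum>l\<in>UNIV. k $ i $ l * v $ l))"
    unfolding sq by (simp add: matrix_vector_mult_def)
  also have "\<dots> = (\<Sum>i\<in>UNIV. \<Sum>j\<in>UNIV. \<Sum>l\<in>UNIV. cnj (v $ j) * v $ l * (cnj (k $ i $ j) * k $ i $ l))"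
    unfolding sum_product by (intro sum.cong refl) (simp add: mult_ac)
  also have "\<dots> = (\<Sum>j\<in>UNIV. \<Sum>i\<in>UNIV. \<Sum>l\<in>UNIV. cnj (v $ j) * v $ l * (cnj (k $ i $ j) * k $ i $ l))"
    by (rule sum.swap)
  also have "\<dots> = (\<Sum>j\<in>UNIV. \<Sum>l\<in>UNIV. \<Sum>i\<in>UNIV. cnj (v $ j) * v $ l * (cnj (k $ i $ j) * k $ i $ l))"
    by (rule sum.cong[OF refl]) (rule sum.swap)
  also have "\<dots> = (\<Sum>j\<in>UNIV. \<Sum>l\<in>UNIV. if l = j then cnj (v $ j) * v $ l else 0)"
    by (simp only: sum_distrib_left[symmetric] ortho) (intro sum.cong refl, auto)
  also have "\<dots> = of_real ((norm v)\<^sup>2)" unfolding sq by simp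
  finally have "(norm (k *v v))\<^sup>2 = (norm v)\<^sup>2" by (simp only: of_real_eq_iff)
  then show ?thesis by simp
qed

lemma onorm_conj_mat:
  assumes k: "k \<in> unitary_group"
  shows "onorm (\<lambda>v. conj_mat k A *v v) = onorm (\<lambda>v. A *v v)"
proof -
  have "norm (conj_mat k A *v v) / norm v = (\<lambda>v. norm (A *v v) / norm v) (k *v v)" for v
  proof -
    have "conj_mat k A *v v = conj_transpose k *v (A *v (k *v v))"
      by (simp add: conj_mat_def unitary_inv[OF k] matrix_vector_mul_assoc matrix_mul_assoc)
    then show ?thesis using norm_unitary[OF k] norm_unitary[OF unitary_conj_transpose[OF k]] by simp
  qed
  moreover have "range (\<lambda>v. k *v v) = UNIV"
  proof (rule surjI)
    show "k *v (conj_transpose k *v v) = v" for v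
      using k by (simp add: matrix_vector_mul_assoc unitary_group_def)
  qed
  ultimately have "range (\<lambda>v. norm (conj_mat k A *v v) / norm v) = range (\<lambda>v. norm (A *v v) / norm v)"
    by (metis (no_types, lifting) image_cong image_image)
  then show ?thesis by (simp add: onorm_def)
qed

lemma fibre_norm_point: "fibre_norm (bundle_point z A) = onorm (\<lambda>v. A *v v)"
proof -
  have "(\<lambda>(z, A). onorm (\<lambda>v. A *v v)) ` bundle_point z A = {onorm (\<lambda>v. A *v v)}"
    using onorm_conj_mat unitary_one by (auto simp: bundle_point_def image_image)
  then show ?thesis by (simp add: fibre_norm_def)
qed

lemma norm_le_sum_cmod: "norm v \<le> (\<Sum>i\<in>UNIV. cmod (v $ i))" for v :: "complex^'n"
  unfolding norm_vec_def by (rule L2_set_le_sum) simp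

lemma onorm_le_entry_norm: "onorm (\<lambda>v. A *v v) \<le> entry_norm A"
proof (rule onorm_bound)
  fix v
  have "norm (A *v v) \<le> (\<Sum>i\<in>UNIV. cmod ((A *v v) $ i))" by (rule norm_le_sum_cmod)
  also have "\<dots> \<le> (\<Sum>i\<in>UNIV. \<Sum>j\<in>UNIV. cmod (A $ i $ j) * norm v)"
  proof (rule sum_mono)
    fix i
    have "cmod ((A *v v) $ i) \<le> (\<Sum>j\<in>UNIV. cmod (A $ i $ j * v $ j))"
      by (simp add: matrix_vector_mult_def norm_sum)
    also have "\<dots> \<le> (\<Sum>j\<in>UNIV. cmod (A $ i $ j) * norm v)"
      unfolding norm_mult by (intro sum_mono mult_left_mono Finite_Cartesian_Product.norm_nth_le) auto
    finally show "cmod ((A *v v) $ i) \<le> (\<Sum>j\<in>UNIV. cmod (A $ i $ j) * norm v)" .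
  qed
  also have "\<dots> = entry_norm A * norm v" by (simp add: entry_norm_def sum_distrib_right)
  finally show "norm (A *v v) \<le> entry_norm A * norm v" .
qed simp

lemma component_le_onorm: "cmod (A $ i $ j) \<le> onorm (\<lambda>v. A *v v)" for A :: "complex^'n^'n"
proof -
  have lin: "linear (\<lambda>v. A *v v)"
    by (rule linearI) (simp_all add: matrix_vector_mult_def vec_eq_iff algebra_simps sum.distrib scaleR_sum_right)
  have "cmod (A $ i $ j) = cmod ((A *v axis j 1) $ i)"
    by (simp add: matrix_vector_mult_def axis_def if_distrib[of "\<lambda>x. _ * x"] cong: if_cong)
  also have "\<dots> \<le> norm (A *v axis j 1)" by (rule Finite_Cartesian_Product.norm_nth_le)
  also have "\<dots> \<le> onorm (\<lambda>v. A *v v) * norm (axis j 1 :: complex^'n)"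
    using lin by (intro onorm) (simp add: linear_conv_bounded_linear)
  also have "norm (axis j 1 :: complex^'n) = 1"
    by (simp add: norm_vec_def L2_set_def axis_def if_distrib[of norm] if_distrib[of "\<lambda>x. x\<^sup>2"] cong: if_cong)
  finally show ?thesis by simp
qed

lemma entry_norm_le_onorm:
  "entry_norm A \<le> (real CARD('n))\<^sup>2 * onorm (\<lambda>v. A *v v)" for A :: "complex^'n^'n"
proof -
  have "entry_norm A \<le> (\<Sum>i\<in>(UNIV::'n set). \<Sum>j\<in>(UNIV::'n set). onorm (\<lambda>v. A *v v))"
    unfolding entry_norm_def by (intro sum_mono component_le_onorm)
  then show ?thesis by (simp add: power2_eq_square)
qed

section \<open>Sections of the matrix bundle\<close>

lemma topspace_quotient_topology: "topspace (quotient_topology T q) = q ` topspace T"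
proof
  have "{x \<in> topspace T. q x \<in> q ` topspace T} = topspace T" by blast
  then have "openin (quotient_topology T q) (q ` topspace T)" by (simp add: openin_quotient_topology)
  then show "q ` topspace T \<subseteq> topspace (quotient_topology T q)" by (rule openin_subset)
  show "topspace (quotient_topology T q) \<subseteq> q ` topspace T"
    using openin_topspace[of "quotient_topology T q"] unfolding openin_quotient_topology by blast
qed

context reduced_domain
begin

text \<open>The section over the Shilov boundary given by an equivariant function on \<open>P\<close>.\<close>

definition sec :: "(('n, 'd) tuple \<Rightarrow> complex^'n^'n) \<Rightarrow> ('n, 'd) qpoint \<Rightarrow> ('n, 'd) bpoint" where
  "sec F = section_of P (bdry D) F"

lemma equivariant:
  "F \<in> S0_limits P \<Longrightarrow> z \<in> P \<Longrightarrow> k \<in> unitary_group \<Longrightarrow> F (conj_tuple k z) = conj_mat k (F z)"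
  using S0_limits_equivariant[of F P z k] P_invariant[of z k] unitary_invertible[of k] by blast

lemma sec_apply:
  assumes F: "F \<in> S0_limits P" and z: "z \<in> Pb"
  shows "sec F (\<pi>0 z) = bundle_point z (F z)"
proof -
  let ?w = "SOME w. w \<in> P \<and> \<pi>0 w = \<pi>0 z"
  have "\<exists>w. w \<in> P \<and> \<pi>0 w = \<pi>0 z" using Pb_sub[OF z] by blast
  from someI_ex[OF this] have w: "?w \<in> P" "\<pi>0 ?w = \<pi>0 z" by blast+
  then obtain k where k: "k \<in> unitary_group" "?w = conj_tuple k z"
    using \<pi>0_eq_iff[OF Pb_sub[OF z] w(1)] by auto
  have "bundle_point ?w (F ?w) = bundle_point z (F z)"
    unfolding k(2) equivariant[OF F Pb_sub[OF z] k(1)] by (rule bundle_point_conj[OF k(1)])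
  moreover have "\<pi>0 z \<in> bdry D" using z by (simp add: Pb_def)
  ultimately show ?thesis by (simp add: sec_def section_of_def Let_def)
qed

lemma sec_outside: "u \<notin> bdry D \<Longrightarrow> sec F u = undefined"
  by (simp add: sec_def section_of_def)

lemma bdry_cases: assumes "u \<in> bdry D" obtains z where "z \<in> Pb" "u = \<pi>0 z"
  using assms unfolding \<pi>0_Pb[symmetric] by blast

lemma sec_eqI:
  assumes "F \<in> S0_limits P" "H \<in> S0_limits P" "\<And>z. z \<in> P \<Longrightarrow> F z = H z"
  shows "sec F = sec H"
proof
  fix u show "sec F u = sec H u"
  proof (cases "u \<in> bdry D")
    case True
    then obtain z where z: "z \<in> Pb" "u = \<pi>0 z" by (rule bdry_cases)
    then show ?thesis using assms(3)[OF Pb_sub[OF z(1)]] by (simp add: sec_apply assms(1,2))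
  qed (simp add: sec_outside)
qed

lemma S0_limits_diff:
  assumes "F \<in> S0_limits P" "H \<in> S0_limits P" shows "(\<lambda>z. F z - H z) \<in> S0_limits P"
proof -
  have "(\<lambda>z. F z + cscale (-1) (H z)) \<in> S0_limits P"
    by (intro S0_limits_add assms S0_limits_cscale[OF compact_P I0_limits_I0[OF I0_const]])
  moreover have "F z + cscale (-1) (H z) = F z - H z" for z by (simp add: vec_eq_iff)
  ultimately show ?thesis by simp
qed

text \<open>The section determines the function on all of \<open>P\<close>, not only over the Shilov boundary.\<close>

lemma sec_inject:
  assumes F: "F \<in> S0_limits P" and H: "H \<in> S0_limits P" and eq: "sec F = sec H" and z: "z \<in> P"
  shows "F z = H z"
proof -
  have "F w - H w = 0" if w: "w \<in> Pb" for w
    using bundle_point_inject[OF P_generating[OF Pb_sub[OF w]], of "F w" "H w"] fun_cong[OF eq, of "\<pi>0 w"]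
    by (simp add: sec_apply F H w)
  then have "F z - H z = 0" by (rule S0_limits_zero[OF S0_limits_diff[OF F H] _ z])
  then show ?thesis by simp
qed

lemma S0_limits_continuous:
  assumes F: "F \<in> S0_limits P" shows "continuous_on P F"
proof -
  have "continuous_on P (\<lambda>z. F z $ i $ j)" for i j
  proof (rule continuous_on_uniform_approx)
    fix \<epsilon> :: real assume e: "\<epsilon> > 0"
    obtain \<phi> where \<phi>: "\<phi> \<in> S0" "\<And>z. z \<in> P \<Longrightarrow> entry_norm (F z - \<phi> z) \<le> \<epsilon>" using S0_limitsD[OF F e] by blast
    have "continuous_on P (\<lambda>z. \<phi> z $ i $ j)"
      using polynomial_continuous[OF S0_polynomial_equivariant(1)[OF \<phi>(1)]] continuous_on_subset by blast
    moreover have "cmod (F z $ i $ j - \<phi> z $ i $ j) \<le> \<epsilon>" if "z \<in> P" for z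
      using entry_norm_component[of "F z - \<phi> z" i j] \<phi>(2)[OF that] by simp
    ultimately show "\<exists>p. continuous_on P p \<and> (\<forall>z\<in>P. cmod (F z $ i $ j - p z) \<le> \<epsilon>)" by (intro exI) auto
  qed
  then have "continuous_on P (\<lambda>z. \<chi> i j. F z $ i $ j)" by (intro continuous_on_vec_lambda)
  then show ?thesis by (simp add: vec_lambda_eta)
qed

lemma quotient_\<pi>0_Pb: "quotient_map (top_of_set Pb) (subtopology Qtop (bdry D)) \<pi>0"
proof -
  have "quotient_map (subtopology (top_of_set P) Pb) (subtopology (subtopology Qtop (clos D)) (bdry D)) \<pi>0"
    by (rule quotient_map_restriction[OF quotient_\<pi>0]) (auto simp: Pb_def closedin_bdry)
  moreover have "P \<inter> Pb = Pb" "clos D \<inter> bdry D = bdry D" using Pb_sub bdry_sub by auto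
  ultimately show ?thesis by (simp add: subtopology_subtopology)
qed

lemma topspace_bundle: "topspace (bundle_top P) = (\<lambda>(z, A). bundle_point z A) ` (P \<times> UNIV)"
  unfolding bundle_top_def topspace_quotient_topology by simp

lemma sec_sections:
  assumes F: "F \<in> S0_limits P" shows "sec F \<in> sections P (bdry D)"
  unfolding sections_def
proof (intro CollectI conjI ballI)
  show "sec F \<in> extensional (bdry D)" by (simp add: extensional_def sec_outside)
  show "bundle_proj (sec F u) = u" if u: "u \<in> bdry D" for u
  proof -
    obtain z where "z \<in> Pb" "u = \<pi>0 z" using u by (rule bdry_cases)
    then show ?thesis by (simp add: sec_apply F bundle_proj_point)
  qed
  let ?q = "\<lambda>(z, A). bundle_point z A :: ('n, 'd) bpoint"
  have "continuous_map (top_of_set (P \<times> UNIV)) (bundle_top P) ?q"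
    unfolding continuous_map_def topspace_bundle
    by (auto simp: bundle_top_def openin_quotient_topology)
  moreover have "continuous_map (top_of_set Pb) (top_of_set (P \<times> UNIV)) (\<lambda>z. (z, F z))"
  proof -
    have "continuous_on Pb F" using S0_limits_continuous[OF F] Pb_sub continuous_on_subset by blast
    then show ?thesis using Pb_sub by (auto simp: continuous_map_in_subtopology intro!: continuous_intros)
  qed
  ultimately have "continuous_map (top_of_set Pb) (bundle_top P) (?q \<circ> (\<lambda>z. (z, F z)))"
    by (rule continuous_map_compose[rotated])
  then have "continuous_map (top_of_set Pb) (bundle_top P) (sec F \<circ> \<pi>0)"
    by (rule continuous_map_eq) (simp add: sec_apply[OF F])
  then show "continuous_map (subtopology Qtop (bdry D)) (bundle_top P) (sec F)"
    by (rule continuous_compose_quotient_map[OF quotient_\<pi>0_Pb])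
qed

lemma fibre_op2_sec:
  assumes "F \<in> S0_limits P" "H \<in> S0_limits P" "z \<in> Pb"
    and "\<And>k A B. k \<in> unitary_group \<Longrightarrow> conj_mat k (g A B) = g (conj_mat k A) (conj_mat k B)"
  shows "fibre_op2 g (sec F (\<pi>0 z)) (sec H (\<pi>0 z)) = bundle_point z (g (F z) (H z))"
  unfolding sec_apply[OF assms(1,3)] sec_apply[OF assms(2,3)]
  using P_generating[OF Pb_sub[OF assms(3)]] assms(4) by (rule fibre_op2_point[of z g "F z" "H z"])

lemma conj_mat_diff: "conj_mat k (A - B) = conj_mat k A - conj_mat k B"
  by (simp add: conj_mat_def matrix_mult_diff_left matrix_mult_diff_right)

text \<open>By the maximum principle the sections that are limits of the trace algebra over the boundary are those given by
  its limits on all of \<open>P\<close>.\<close>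

lemma carrier_S_alg: "carrier (S_alg D P) = sec ` S0_limits P"
proof (intro subset_antisym subsetI)
  fix \<sigma> assume "\<sigma> \<in> sec ` S0_limits P"
  then obtain F where F: "F \<in> S0_limits P" "\<sigma> = sec F" by blast
  have "\<exists>\<phi>\<in>S0. \<forall>u\<in>bdry D. fibre_norm (fibre_op2 (-) (\<sigma> u) (section_of P (bdry D) \<phi> u)) \<le> \<epsilon>" if e: "\<epsilon> > 0" for \<epsilon>
  proof -
    obtain \<phi> where \<phi>: "\<phi> \<in> S0" "\<And>z. z \<in> P \<Longrightarrow> entry_norm (F z - \<phi> z) \<le> \<epsilon>" using S0_limitsD[OF F(1) e] by blast
    have "fibre_norm (fibre_op2 (-) (\<sigma> u) (section_of P (bdry D) \<phi> u)) \<le> \<epsilon>" if u: "u \<in> bdry D" for u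
    proof -
      obtain z where z: "z \<in> Pb" "u = \<pi>0 z" using u by (rule bdry_cases)
      have "fibre_op2 (-) (\<sigma> u) (section_of P (bdry D) \<phi> u) = bundle_point z (F z - \<phi> z)"
        unfolding F(2) z(2) sec_def[symmetric] using fibre_op2_sec[OF F(1) S0_limits_S0[OF \<phi>(1)] z(1), of "(-)"]
        by (simp add: conj_mat_diff)
      then show ?thesis
        using onorm_le_entry_norm[of "F z - \<phi> z"] \<phi>(2)[OF Pb_sub[OF z(1)]] by (simp add: fibre_norm_point)
    qed
    then show ?thesis using \<phi>(1) by blast
  qed
  then show "\<sigma> \<in> carrier (S_alg D P)"
    using sec_sections[OF F(1)] F(2) by (simp add: S_alg_def)
next
  fix \<sigma> assume \<sigma>: "\<sigma> \<in> carrier (S_alg D P)"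
  then have \<sigma>s: "\<sigma> \<in> sections P (bdry D)" by (simp add: S_alg_def)
  have ex: "\<exists>A. \<sigma> (\<pi>0 z) = bundle_point z A" if z: "z \<in> Pb" for z
  proof -
    have u: "\<pi>0 z \<in> bdry D" using z by (simp add: Pb_def)
    have "topspace (subtopology Qtop (bdry D)) = bdry D" using bdry_sub clos_sub by (auto simp: topspace_Qtop)
    then have "\<sigma> (\<pi>0 z) \<in> topspace (bundle_top P)"
      using \<sigma>s u by (auto simp: sections_def continuous_map_def)
    then obtain w B where w: "w \<in> P" "\<sigma> (\<pi>0 z) = bundle_point w B" by (auto simp: topspace_bundle)
    then have "\<pi>0 w = \<pi>0 z" using \<sigma>s u bundle_proj_point[of w B] by (auto simp: sections_def)
    then obtain k where k: "k \<in> unitary_group" "z = conj_tuple k w"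
      using \<pi>0_eq_iff[OF w(1) Pb_sub[OF z]] by auto
    then have "\<sigma> (\<pi>0 z) = bundle_point z (conj_mat k B)" using w(2) bundle_point_conj[OF k(1), of w B, folded k(2)] by simp
    then show ?thesis by blast
  qed
  \<comment> \<open>The value of the section over \<open>\<pi>0 z\<close>, read off in the fibre coordinate given by \<open>z\<close>.\<close>
  define H where "H z = (SOME A. \<sigma> (\<pi>0 z) = bundle_point z A)" for z
  have H: "\<sigma> (\<pi>0 z) = bundle_point z (H z)" if "z \<in> Pb" for z
    unfolding H_def by (rule someI_ex[OF ex[OF that]])
  have "\<exists>\<phi>\<in>S0. \<forall>z\<in>Pb. entry_norm (H z - \<phi> z) \<le> \<epsilon>" if e: "\<epsilon> > 0" for \<epsilon>
  proof -
    have "\<epsilon> / (real CARD('n))\<^sup>2 > 0" using e by simp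
    then obtain \<phi> where \<phi>: "\<phi> \<in> S0"
      "\<forall>u\<in>bdry D. fibre_norm (fibre_op2 (-) (\<sigma> u) (section_of P (bdry D) \<phi> u)) \<le> \<epsilon> / (real CARD('n))\<^sup>2"
      using \<sigma> unfolding S_alg_def by auto
    have "entry_norm (H z - \<phi> z) \<le> \<epsilon>" if z: "z \<in> Pb" for z
    proof -
      have "fibre_op2 (-) (\<sigma> (\<pi>0 z)) (section_of P (bdry D) \<phi> (\<pi>0 z)) = bundle_point z (H z - \<phi> z)"
        unfolding sec_def[symmetric] H[OF z] sec_apply[OF S0_limits_S0[OF \<phi>(1)] z]
        by (rule fibre_op2_point) (auto simp: conj_mat_diff P_generating Pb_sub z)
      moreover have "\<pi>0 z \<in> bdry D" using z by (simp add: Pb_def)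
      ultimately have "onorm (\<lambda>v. (H z - \<phi> z) *v v) \<le> \<epsilon> / (real CARD('n))\<^sup>2"
        using \<phi>(2) fibre_norm_point[of z "H z - \<phi> z"] by auto
      then have "(real CARD('n))\<^sup>2 * onorm (\<lambda>v. (H z - \<phi> z) *v v) \<le> (real CARD('n))\<^sup>2 * (\<epsilon> / (real CARD('n))\<^sup>2)"
        by (rule mult_left_mono) simp
      then show ?thesis using entry_norm_le_onorm[of "H z - \<phi> z"] by simp
    qed
    then show ?thesis using \<phi>(1) by blast
  qed
  from S0_limits_extension[OF this] obtain F where F: "F \<in> S0_limits P" "\<forall>z\<in>Pb. F z = H z" by blast
  have "\<sigma> = sec F"
  proof
    fix u show "\<sigma> u = sec F u"
    proof (cases "u \<in> bdry D")
      case True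
      then obtain z where z: "z \<in> Pb" "u = \<pi>0 z" by (rule bdry_cases)
      then show ?thesis using H[OF z(1)] bspec[OF F(2) z(1)] by (simp add: sec_apply F(1))
    qed (use \<sigma>s in \<open>simp add: sec_outside sections_def extensional_def\<close>)
  qed
  then show "\<sigma> \<in> sec ` S0_limits P" using F(1) by blast
qed

abbreviation "R \<equiv> S_alg D P"

lemma S_alg_simps:
  "monoid.mult R = (\<lambda>\<sigma> \<tau>. \<lambda>u\<in>bdry D. fibre_op2 (**) (\<sigma> u) (\<tau> u))"
  "\<one>\<^bsub>R\<^esub> = sec (\<lambda>z. mat 1)" "\<zero>\<^bsub>R\<^esub> = sec (\<lambda>z. 0)"
  "add R = (\<lambda>\<sigma> \<tau>. \<lambda>u\<in>bdry D. fibre_op2 (+) (\<sigma> u) (\<tau> u))"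
  "smult R = (\<lambda>c \<sigma>. \<lambda>u\<in>bdry D. fibre_op1 (cscale c) (\<sigma> u))"
  by (simp_all add: S_alg_def section_alg_def sec_def)

lemma sec_mult:
  assumes "F \<in> S0_limits P" "H \<in> S0_limits P"
  shows "sec F \<otimes>\<^bsub>R\<^esub> sec H = sec (\<lambda>z. F z ** H z)"
proof
  fix u
  show "(sec F \<otimes>\<^bsub>R\<^esub> sec H) u = sec (\<lambda>z. F z ** H z) u"
  proof (cases "u \<in> bdry D")
    case True
    then obtain z where z: "z \<in> Pb" "u = \<pi>0 z" by (rule bdry_cases)
    then show ?thesis
      using True fibre_op2_sec[OF assms z(1), of "(**)"]
      by (simp add: S_alg_simps sec_apply S0_limits_mult[OF compact_P] assms conj_mat_mult unitary_invertible)
  qed (simp add: S_alg_simps sec_outside)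
qed

lemma sec_add:
  assumes "F \<in> S0_limits P" "H \<in> S0_limits P"
  shows "sec F \<oplus>\<^bsub>R\<^esub> sec H = sec (\<lambda>z. F z + H z)"
proof
  fix u
  show "(sec F \<oplus>\<^bsub>R\<^esub> sec H) u = sec (\<lambda>z. F z + H z) u"
  proof (cases "u \<in> bdry D")
    case True
    then obtain z where z: "z \<in> Pb" "u = \<pi>0 z" by (rule bdry_cases)
    then show ?thesis
      using True fibre_op2_sec[OF assms z(1), of "(+)"]
      by (simp add: S_alg_simps sec_apply S0_limits_add assms conj_mat_add)
  qed (simp add: S_alg_simps sec_outside)
qed

lemma S0_limits_scale: "F \<in> S0_limits P \<Longrightarrow> (\<lambda>z. cscale c (F z)) \<in> S0_limits P"
  by (rule S0_limits_cscale[OF compact_P I0_limits_I0[OF I0_const]])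

lemma sec_smult:
  assumes "F \<in> S0_limits P"
  shows "c \<odot>\<^bsub>R\<^esub> sec F = sec (\<lambda>z. cscale c (F z))"
proof
  fix u
  show "(c \<odot>\<^bsub>R\<^esub> sec F) u = sec (\<lambda>z. cscale c (F z)) u"
  proof (cases "u \<in> bdry D")
    case True
    then obtain z where z: "z \<in> Pb" "u = \<pi>0 z" by (rule bdry_cases)
    then show ?thesis
      using True by (simp add: S_alg_simps sec_apply S0_limits_scale assms fibre_op1_point conj_mat_cscale)
  qed (simp add: S_alg_simps sec_outside)
qed

end


section \<open>The tracial function algebra is an Azumaya algebra\<close>

lemma cring_complex_alg: "cring complex_alg"
proof (intro cringI abelian_groupI comm_monoidI)
  fix a assume "a \<in> carrier complex_alg"
  then show "\<exists>b\<in>carrier complex_alg. b \<oplus>\<^bsub>complex_alg\<^esub> a = \<zero>\<^bsub>complex_alg\<^esub>"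
    by (intro bexI[of _ "- a"]) (simp_all add: complex_alg_def)
qed (simp_all add: complex_alg_def algebra_simps)

lemma cscale_simps:
  "cscale (a + b) A = cscale a A + cscale b A" "cscale a (A + B) = cscale a A + cscale a B"
  "cscale (a * b) A = cscale a (cscale b A)" "cscale 1 A = A" "cscale 0 A = 0" "cscale (- 1) A + A = 0"
  "cscale a A ** B = cscale a (A ** B)" "A ** cscale a B = cscale a (A ** B)"
  by (simp_all add: vec_eq_iff mat_mult_component algebra_simps sum_distrib_left)

lemma cscale_left_commute: "cscale a (cscale b A) = cscale b (cscale a A)"
  by (simp add: vec_eq_iff)

lemma matrix_mult_add_left: "(A + B) ** C = A ** C + B ** C"
  and matrix_mult_add_right: "C ** (A + B) = C ** A + C ** B" for A B C :: "complex^'n^'n"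
  by (simp_all add: vec_eq_iff mat_mult_component sum.distrib[symmetric] algebra_simps)

lemma matrix_mult_sum_right: "C ** (\<Sum>k\<in>S. f k) = (\<Sum>k\<in>S. C ** f k)"
  for C :: "complex^'n^'n" and f :: "'k \<Rightarrow> complex^'n^'n"
proof (induction S rule: infinite_finite_induct)
  case (insert k S)
  then show ?case by (simp add: matrix_mult_add_right)
qed (simp_all add: vec_eq_iff mat_mult_component)

lemma mat_alg_simps [simp]:
  "carrier mat_alg = UNIV" "monoid.mult mat_alg = (**)" "\<one>\<^bsub>mat_alg\<^esub> = mat 1" "\<zero>\<^bsub>mat_alg\<^esub> = 0"
  "add mat_alg = (+)" "smult mat_alg = cscale"
  by (simp_all add: mat_alg_def)

lemma ring_mat_alg: "ring mat_alg"
proof (intro ringI abelian_groupI monoidI)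
  fix A :: "complex^'n^'n"
  show "\<exists>B\<in>carrier mat_alg. B \<oplus>\<^bsub>mat_alg\<^esub> A = \<zero>\<^bsub>mat_alg\<^esub>"
    by (intro bexI[of _ "- A"]) simp_all
qed (simp_all add: matrix_mult_add_left matrix_mult_add_right matrix_mul_assoc add.assoc add.commute)

context reduced_domain
begin

lemma sec_cases:
  assumes "\<sigma> \<in> carrier R" obtains F where "F \<in> S0_limits P" "\<sigma> = sec F"
  using assms unfolding carrier_S_alg by blast

lemma sec_closed: "F \<in> S0_limits P \<Longrightarrow> sec F \<in> carrier R"
  unfolding carrier_S_alg by blast

lemmas S0_limits_intros = S0_limits_mult[OF compact_P] S0_limits_add S0_limits_scale S0_limits_const S0_limits_scalar
lemmas sec_ops = sec_mult sec_add sec_smult S_alg_simps(2,3)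

lemma ring_R: "ring R"
proof (intro ringI abelian_groupI monoidI)
  fix a assume "a \<in> carrier R"
  then obtain F where F: "F \<in> S0_limits P" "a = sec F" by (rule sec_cases)
  show "\<exists>b\<in>carrier R. b \<oplus>\<^bsub>R\<^esub> a = \<zero>\<^bsub>R\<^esub>"
    by (rule bexI[of _ "sec (\<lambda>z. cscale (-1) (F z))"])
      (simp_all add: F sec_ops S0_limits_intros sec_closed cscale_simps)
qed ((elim sec_cases, simp add: sec_ops S0_limits_intros sec_closed ac_simps matrix_mul_assoc
      matrix_mult_add_left matrix_mult_add_right) | simp add: sec_ops S0_limits_intros sec_closed)+

lemma unital_algebra_R: "unital_algebra complex_alg R"
  unfolding unital_algebra_def
proof (intro conjI ballI)
  show "ring R" by (rule ring_R)
  have carr: "carrier complex_alg = UNIV" "a \<oplus>\<^bsub>complex_alg\<^esub> b = a + b" "a \<otimes>\<^bsub>complex_alg\<^esub> b = a * b" "\<one>\<^bsub>complex_alg\<^esub> = 1" for a b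
    by (simp_all add: complex_alg_def)
  show "Module.module complex_alg R"
  proof (rule moduleI)
    show "cring complex_alg" by (rule cring_complex_alg)
    show "abelian_group R" using ring_R by (simp add: ring_def)
  qed (elim sec_cases, simp add: carr sec_ops S0_limits_intros sec_closed cscale_simps)+
  fix c a b assume "a \<in> carrier R" "b \<in> carrier R"
  then obtain F H where "F \<in> S0_limits P" "a = sec F" "H \<in> S0_limits P" "b = sec H" by (elim sec_cases)
  then show "c \<odot>\<^bsub>R\<^esub> a \<otimes>\<^bsub>R\<^esub> b = c \<odot>\<^bsub>R\<^esub> (a \<otimes>\<^bsub>R\<^esub> b)" "a \<otimes>\<^bsub>R\<^esub> (c \<odot>\<^bsub>R\<^esub> b) = c \<odot>\<^bsub>R\<^esub> (a \<otimes>\<^bsub>R\<^esub> b)"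
    by (simp_all add: sec_ops S0_limits_intros cscale_simps)
qed

lemma finsum_sec:
  assumes "finite S" "\<And>k. k \<in> S \<Longrightarrow> F k \<in> S0_limits P"
  shows "finsum R (\<lambda>k. sec (F k)) S = sec (\<lambda>z. \<Sum>k\<in>S. F k z)"
proof -
  interpret ring R by (rule ring_R)
  show ?thesis using assms
  proof (induction S rule: finite_induct)
    case empty
    then show ?case by (simp add: S_alg_simps)
  next
    case (insert k S)
    have "finsum R (\<lambda>k. sec (F k)) (insert k S) = sec (F k) \<oplus>\<^bsub>R\<^esub> finsum R (\<lambda>k. sec (F k)) S"
      by (rule finsum_insert) (use insert sec_closed in auto)
    also have "\<dots> = sec (\<lambda>z. F k z + (\<Sum>k\<in>S. F k z))"
      using insert by (simp add: sec_add S0_limits_sum)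
    finally show ?case using insert by simp
  qed
qed

text \<open>The section of scalar matrices given by an invariant function.\<close>

definition scal :: "(('n, 'd) tuple \<Rightarrow> complex) \<Rightarrow> ('n, 'd) qpoint \<Rightarrow> ('n, 'd) bpoint" where
  "scal f = sec (\<lambda>z. cscale (f z) (mat 1))"

lemma scal_mult_sec:
  assumes "f \<in> I0_limits P" "F \<in> S0_limits P"
  shows "scal f \<otimes>\<^bsub>R\<^esub> sec F = sec (\<lambda>z. cscale (f z) (F z))" "sec F \<otimes>\<^bsub>R\<^esub> scal f = sec (\<lambda>z. cscale (f z) (F z))"
  using assms by (simp_all add: scal_def sec_mult S0_limits_scalar cscale_one_mult)

lemma scal_centre:
  assumes f: "f \<in> I0_limits P" shows "scal f \<in> centre R"
proof -
  have "scal f \<otimes>\<^bsub>R\<^esub> a = a \<otimes>\<^bsub>R\<^esub> scal f" if "a \<in> carrier R" for a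
    using that by (rule sec_cases) (simp add: scal_mult_sec f)
  moreover have "scal f \<in> carrier R" unfolding scal_def by (intro sec_closed S0_limits_scalar f)
  ultimately show ?thesis by (simp add: centre_def)
qed

lemma casimir_sec:
  assumes F: "F \<in> S0_limits P"
  shows "(\<Oplus>\<^bsub>R\<^esub>k\<in>{..<N}. sec (dx k) \<otimes>\<^bsub>R\<^esub> sec F \<otimes>\<^bsub>R\<^esub> sec (dy k)) = scal (\<lambda>z. trace (F z))"
proof -
  interpret ring R by (rule ring_R)
  have SP: "(\<lambda>z. dx k z ** F z ** dy k z) \<in> S0_limits P" if "k < N" for k
    using that F by (intro S0_limits_mult[OF compact_P] dx_limits dy_limits)
  have "(\<Oplus>\<^bsub>R\<^esub>k\<in>{..<N}. sec (dx k) \<otimes>\<^bsub>R\<^esub> sec F \<otimes>\<^bsub>R\<^esub> sec (dy k)) = (\<Oplus>\<^bsub>R\<^esub>k\<in>{..<N}. sec (\<lambda>z. dx k z ** F z ** dy k z))"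
    by (rule finsum_cong') (auto simp: sec_mult S0_limits_mult[OF compact_P] dx_limits dy_limits F intro!: sec_closed SP)
  also have "\<dots> = sec (\<lambda>z. \<Sum>k<N. dx k z ** F z ** dy k z)"
    by (rule finsum_sec) (use SP in auto)
  also have "\<dots> = scal (\<lambda>z. trace (F z))"
    unfolding scal_def
    by (rule sec_eqI) (use SP casimir in \<open>auto intro!: S0_limits_sum S0_limits_scalar I0_limits_trace F\<close>)
  finally show ?thesis .
qed

lemma casimir_algebra_R: "casimir_algebra R {..<N} (\<lambda>k. sec (dx k)) (\<lambda>k. sec (dy k))"
proof
  interpret ring R by (rule ring_R)
  show "unital_algebra complex_alg R" by (rule unital_algebra_R)
  show "finite {..<N}" by simp
  show "sec (dx k) \<in> carrier R" "sec (dy k) \<in> carrier R" if "k \<in> {..<N}" for k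
    using that by (auto intro!: sec_closed dx_limits dy_limits)
  fix a assume "a \<in> carrier R"
  then obtain F where F: "F \<in> S0_limits P" "a = sec F" by (rule sec_cases)
  show "(\<Oplus>\<^bsub>R\<^esub>k\<in>{..<N}. sec (dx k) \<otimes>\<^bsub>R\<^esub> a \<otimes>\<^bsub>R\<^esub> sec (dy k)) \<in> centre R"
    unfolding F(2) casimir_sec[OF F(1)] by (intro scal_centre I0_limits_trace F)
  have SP: "(\<lambda>z. cscale (trace (dy k z ** F z)) (dx k z)) \<in> S0_limits P" if "k < N" for k
    using that by (intro S0_limits_cscale[OF compact_P] S0_limits_expansion F dx_limits)
  have "(\<Oplus>\<^bsub>R\<^esub>k\<in>{..<N}. (\<Oplus>\<^bsub>R\<^esub>l\<in>{..<N}. sec (dx l) \<otimes>\<^bsub>R\<^esub> (sec (dy k) \<otimes>\<^bsub>R\<^esub> sec F) \<otimes>\<^bsub>R\<^esub> sec (dy l)) \<otimes>\<^bsub>R\<^esub> sec (dx k))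
     = (\<Oplus>\<^bsub>R\<^esub>k\<in>{..<N}. sec (\<lambda>z. cscale (trace (dy k z ** F z)) (dx k z)))"
  proof (rule finsum_cong')
    fix k assume "k \<in> {..<N}"
    then have k: "k < N" by simp
    have "(\<Oplus>\<^bsub>R\<^esub>l\<in>{..<N}. sec (dx l) \<otimes>\<^bsub>R\<^esub> (sec (dy k) \<otimes>\<^bsub>R\<^esub> sec F) \<otimes>\<^bsub>R\<^esub> sec (dy l)) = scal (\<lambda>z. trace (dy k z ** F z))"
      unfolding sec_mult[OF dy_limits[OF k] F(1)] by (rule casimir_sec) (intro S0_limits_mult[OF compact_P] dy_limits k F)
    then show "(\<Oplus>\<^bsub>R\<^esub>l\<in>{..<N}. sec (dx l) \<otimes>\<^bsub>R\<^esub> (sec (dy k) \<otimes>\<^bsub>R\<^esub> sec F) \<otimes>\<^bsub>R\<^esub> sec (dy l)) \<otimes>\<^bsub>R\<^esub> sec (dx k)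
        = sec (\<lambda>z. cscale (trace (dy k z ** F z)) (dx k z))"
      by (simp add: scal_mult_sec S0_limits_expansion[OF F(1) k] dx_limits[OF k])
  qed (use SP in \<open>auto intro!: sec_closed\<close>)
  also have "\<dots> = sec (\<lambda>z. \<Sum>k<N. cscale (trace (dy k z ** F z)) (dx k z))"
    by (rule finsum_sec) (use SP in auto)
  also have "\<dots> = sec F"
    by (rule sec_eqI) (use SP expansion in \<open>auto intro!: S0_limits_sum F\<close>)
  finally show "(\<Oplus>\<^bsub>R\<^esub>k\<in>{..<N}. (\<Oplus>\<^bsub>R\<^esub>l\<in>{..<N}. sec (dx l) \<otimes>\<^bsub>R\<^esub> (sec (dy k) \<otimes>\<^bsub>R\<^esub> a) \<otimes>\<^bsub>R\<^esub> sec (dy l)) \<otimes>\<^bsub>R\<^esub> sec (dx k)) = a"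
    unfolding F(2) .
qed

theorem azumaya_R: "azumaya R"
  by (rule casimir_algebra.azumaya[OF casimir_algebra_R])

section \<open>Maximal ideals are kernels of evaluations\<close>

text \<open>Evaluation at \<open>z \<in> P\<close> of the extension to \<open>P\<close> of a section over the Shilov boundary.\<close>

definition ev :: "('n, 'd) tuple \<Rightarrow> (('n, 'd) qpoint \<Rightarrow> ('n, 'd) bpoint) \<Rightarrow> complex^'n^'n" where
  "ev z \<sigma> = (SOME F. F \<in> S0_limits P \<and> sec F = \<sigma>) z"

lemma ev_sec:
  assumes "F \<in> S0_limits P" "z \<in> P" shows "ev z (sec F) = F z"
proof -
  have "\<exists>H. H \<in> S0_limits P \<and> sec H = sec F" using assms(1) by blast
  from someI_ex[OF this] show ?thesis
    unfolding ev_def using sec_inject[OF _ assms(1) _ assms(2)] by blast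
qed

lemma ev_hom:
  assumes z: "z \<in> P" shows "ring_hom_ring R mat_alg (ev z)"
proof (rule ring_hom_ringI2[OF ring_R ring_mat_alg], rule ring_hom_memI)
  fix a b assume "a \<in> carrier R" "b \<in> carrier R"
  then obtain F H where "F \<in> S0_limits P" "a = sec F" "H \<in> S0_limits P" "b = sec H" by (elim sec_cases)
  then show "ev z (a \<otimes>\<^bsub>R\<^esub> b) = ev z a \<otimes>\<^bsub>mat_alg\<^esub> ev z b" "ev z (a \<oplus>\<^bsub>R\<^esub> b) = ev z a \<oplus>\<^bsub>mat_alg\<^esub> ev z b"
    by (simp_all add: sec_ops ev_sec S0_limits_intros z)
qed (simp_all add: sec_ops ev_sec S0_limits_intros z)

lemma ev_smult:
  assumes "z \<in> P" "a \<in> carrier R" shows "ev z (c \<odot>\<^bsub>R\<^esub> a) = cscale c (ev z a)"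
  using assms(2) by (rule sec_cases) (simp add: sec_ops ev_sec S0_limits_intros assms(1))

lemma ev_surj:
  assumes z: "z \<in> P" shows "ev z ` carrier R = carrier mat_alg"
proof -
  have "A \<in> ev z ` carrier R" for A
  proof -
    obtain F where "F \<in> G0" "F z = A" using G0_value[OF P_generating[OF z]] by blast
    then show ?thesis
      using ev_sec[OF S0_limits_S0[OF S0_G0] z, of F] sec_closed[OF S0_limits_S0[OF S0_G0], of F] by force
  qed
  then show ?thesis by auto
qed

lemma ideal_finsum:
  assumes "ideal m R" "finite S" "\<And>k. k \<in> S \<Longrightarrow> g k \<in> m"
  shows "finsum R g S \<in> m"
proof -
  interpret ideal m R by fact
  show ?thesis using assms(2,3)
  proof (induction S rule: finite_induct)
    case (insert k S)
    have "finsum R g (insert k S) = g k \<oplus>\<^bsub>R\<^esub> finsum R g S"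
      by (rule finsum_insert) (use insert a_subset in auto)
    then show ?case using insert by simp
  qed simp
qed

text \<open>The scalar functions in \<open>m\<close> have a common zero \<open>z\<close>. The coefficients \<open>tr (dy k a)\<close> of any \<open>a \<in> m\<close> are such
  functions, so \<open>a\<close> vanishes at \<open>z\<close>.\<close>

lemma maximal_ideal_evaluation:
  assumes m: "maximalideal m R"
  shows "\<exists>z\<in>P. m = a_kernel R mat_alg (ev z)"
proof -
  interpret maximalideal m R by fact
  let ?J = "{f \<in> I0_limits P. scal f \<in> m}"
  have "I0_limits_ideal P ?J"
    unfolding I0_limits_ideal_def
  proof (intro conjI ballI allI impI)
    show "?J \<subseteq> I0_limits P" by blast
    have "scal 0 = \<zero>\<^bsub>R\<^esub>" by (simp add: scal_def S_alg_simps cscale_simps)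
    then show "0 \<in> ?J"
      using I0_limits_I0[OF I0_const[of 0], of P] additive_subgroup.zero_closed[OF is_additive_subgroup] by (simp add: zero_fun_def)
  next
    fix f g assume "f \<in> ?J" "g \<in> ?J"
    moreover from this have "scal (f + g) = scal f \<oplus>\<^bsub>R\<^esub> scal g"
      by (simp add: scal_def sec_add S0_limits_scalar cscale_simps)
    ultimately show "f + g \<in> ?J"
      using additive_subgroup.a_closed[OF is_additive_subgroup] by (simp add: I0_limits_add plus_fun_def)
  next
    fix f g assume f: "f \<in> I0_limits P" and g: "g \<in> ?J"
    have "scal (f * g) = scal f \<otimes>\<^bsub>R\<^esub> scal g"
      using f g unfolding scal_def by (simp add: sec_mult S0_limits_scalar cscale_simps cscale_left_commute)
    moreover have "scal f \<in> carrier R" unfolding scal_def by (intro sec_closed S0_limits_scalar f)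
    ultimately have "scal (f * g) \<in> m" using g I_l_closed by simp
    then show "f * g \<in> ?J" using f g by (simp add: times_fun_def I0_limits_mult[OF compact_P])
  next
    fix f g assume f: "f \<in> ?J" and eq: "\<forall>z\<in>P. g z = f z"
    have g: "g \<in> I0_limits P" using f eq I0_limits_cong[of f P g] by blast
    have "scal g = scal f"
      unfolding scal_def using f g eq by (intro sec_eqI) (auto intro: S0_limits_scalar)
    then show "g \<in> ?J" using f g by simp
  qed
  moreover have "1 \<notin> ?J"
  proof
    assume "1 \<in> ?J"
    then have "\<one>\<^bsub>R\<^esub> \<in> m" by (simp add: scal_def S_alg_simps cscale_simps)
    then show False using one_imp_carrier I_notcarr by blast
  qed
  ultimately obtain z where z: "z \<in> P" "\<forall>f\<in>?J. f z = 0"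
    using I0_limits_nullstellensatz_reduced[of ?J] by blast
  interpret h: ring_hom_ring R mat_alg "ev z" by (rule ev_hom[OF z(1)])
  have "m \<subseteq> a_kernel R mat_alg (ev z)"
  proof
    fix a assume a: "a \<in> m"
    then have aR: "a \<in> carrier R" using a_subset by blast
    then obtain F where F: "F \<in> S0_limits P" "a = sec F" by (rule sec_cases)
    have "trace (dy k z ** F z) = 0" if k: "k < N" for k
    proof -
      have yF: "(\<lambda>z. dy k z ** F z) \<in> S0_limits P" by (intro S0_limits_mult[OF compact_P] dy_limits k F)
      have "sec (\<lambda>z. dy k z ** F z) = sec (dy k) \<otimes>\<^bsub>R\<^esub> a" by (simp add: F sec_mult dy_limits[OF k])
      also have "\<dots> \<in> m" using a I_l_closed sec_closed[OF dy_limits[OF k]] by blast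
      finally have ya: "sec (\<lambda>z. dy k z ** F z) \<in> m" .
      have "scal (\<lambda>z. trace (dy k z ** F z)) \<in> m"
        unfolding casimir_sec[OF yF, symmetric]
        using I_r_closed[OF I_l_closed[OF ya sec_closed[OF dx_limits]] sec_closed[OF dy_limits]]
        by (intro ideal_finsum[OF is_ideal]) auto
      then show ?thesis using z(2) S0_limits_expansion[OF F(1) k] by auto
    qed
    then have "F z = 0" using expansion[OF z(1), of "F z"] by (simp add: cscale_simps)
    then have "ev z a = \<zero>\<^bsub>mat_alg\<^esub>" by (simp add: F ev_sec z(1))
    then show "a \<in> a_kernel R mat_alg (ev z)" unfolding a_kernel_def' using aR by blast
  qed
  moreover have "ideal (a_kernel R mat_alg (ev z)) R" by (rule h.kernel_is_ideal)
  moreover have "a_kernel R mat_alg (ev z) \<subseteq> carrier R" unfolding a_kernel_def' by blast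
  moreover have "a_kernel R mat_alg (ev z) \<noteq> carrier R"
  proof
    assume "a_kernel R mat_alg (ev z) = carrier R"
    then have "ev z \<one>\<^bsub>R\<^esub> = \<zero>\<^bsub>mat_alg\<^esub>" using one_closed unfolding a_kernel_def' by blast
    then have "(mat 1 :: complex^'n^'n) = 0" using h.hom_one by simp
    then have "(mat 1 :: complex^'n^'n) $ i $ i = 0" for i by simp
    then show False by (simp add: mat_def)
  qed
  ultimately show ?thesis using I_maximal z(1) by blast
qed

lemma quotient_iso:
  assumes m: "maximalideal m R"
  shows "alg_iso (quotient_algebra R m) (mat_alg :: (complex, complex^'n^'n) module) \<noteq> {}"
proof -
  obtain z where z: "z \<in> P" and mk: "m = a_kernel R mat_alg (ev z)" using maximal_ideal_evaluation[OF m] by blast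
  interpret maximalideal m R by fact
  interpret h: ring_hom_ring R mat_alg "ev z" by (rule ev_hom[OF z])
  let ?h = "\<lambda>t. the_elem (ev z ` t)"
  have iso: "?h \<in> ring_iso (R Quot m) mat_alg"
    unfolding mk by (rule h.FactRing_iso_set[OF ev_surj[OF z]])
  have coset: "ev z ` (m +>\<^bsub>R\<^esub> a) = {ev z a}" if a: "a \<in> carrier R" for a
  proof -
    have "ev z (i \<oplus>\<^bsub>R\<^esub> a) = ev z a" if "i \<in> m" for i
      using that h.hom_add[of i a] a unfolding mk a_kernel_def' by simp
    moreover have "m \<noteq> {}" using additive_subgroup.zero_closed[OF is_additive_subgroup] by blast
    ultimately show ?thesis by (simp add: a_r_coset_def' image_UN)
  qed
  have sub: "m +>\<^bsub>R\<^esub> a \<subseteq> carrier R" if "a \<in> carrier R" for a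
    using that a_subset by (auto simp: a_r_coset_def')
  have "?h (c \<odot>\<^bsub>quotient_algebra R m\<^esub> t) = c \<odot>\<^bsub>mat_alg\<^esub> ?h t" if t: "t \<in> carrier (quotient_algebra R m)" for c t
  proof -
    obtain a where a: "a \<in> carrier R" "t = m +>\<^bsub>R\<^esub> a"
      using t by (auto simp: quotient_algebra_def FactRing_def A_RCOSETS_def')
    have ea: "ev z ` t = {ev z a}" using coset[OF a(1)] a(2) by simp
    have "ev z ` (m +>\<^bsub>R\<^esub> (c \<odot>\<^bsub>R\<^esub> b)) = {cscale c (ev z a)}" if b: "b \<in> t" for b
    proof -
      have bR: "b \<in> carrier R" using b a(2) sub[OF a(1)] by blast
      then have "c \<odot>\<^bsub>R\<^esub> b \<in> carrier R"
        by (rule sec_cases) (simp add: sec_ops sec_closed S0_limits_intros)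
      moreover have "ev z b = ev z a" using ea b by blast
      ultimately show ?thesis by (simp add: coset ev_smult z bR)
    qed
    moreover have "t \<noteq> {}" using ea by blast
    ultimately have "ev z ` (\<Union>b\<in>t. m +>\<^bsub>R\<^esub> (c \<odot>\<^bsub>R\<^esub> b)) = {cscale c (ev z a)}"
      unfolding image_UN by simp
    then show ?thesis using ea by (simp add: quotient_algebra_def)
  qed
  then have "?h \<in> alg_iso (quotient_algebra R m) mat_alg"
    using iso unfolding alg_iso_def alg_hom_def ring_iso_def ring_hom_def by (simp add: quotient_algebra_def)
  then show ?thesis by blast
qed

section \<open>The centre\<close>

text \<open>If \<open>B\<close> commutes with all matrices, the Casimir sum \<open>\<Sum>\<^sub>k x\<^sub>k B y\<^sub>k = tr B\<close> is also \<open>B\<close> times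
  \<open>\<Sum>\<^sub>k x\<^sub>k y\<^sub>k = n\<close>.\<close>

lemma commuting_scalar:
  fixes B :: "complex^'n^'n"
  assumes z: "z \<in> P" and comm: "\<And>A. B ** A = A ** B"
  shows "B = cscale (trace B / of_nat CARD('n)) (mat 1)"
proof -
  have "cscale (trace B) (mat 1) = (\<Sum>k<N. dx k z ** B ** dy k z)" using casimir[OF z, of B] by simp
  also have "\<dots> = (\<Sum>k<N. B ** (dx k z ** mat 1 ** dy k z))"
    by (rule sum.cong) (simp_all add: matrix_mul_assoc comm[symmetric])
  also have "\<dots> = B ** cscale (of_nat CARD('n)) (mat 1)"
    unfolding matrix_mult_sum_right[symmetric] casimir[OF z] by (simp add: trace_I)
  also have "\<dots> = cscale (of_nat CARD('n)) B" by (simp add: cscale_one_mult)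
  finally have "cscale (1 / of_nat CARD('n)) (cscale (of_nat CARD('n)) B) = cscale (1 / of_nat CARD('n)) (cscale (trace B) (mat 1))"
    by simp
  then show ?thesis by (simp add: cscale_simps(3)[symmetric] cscale_simps(4))
qed

lemma centre_scal:
  assumes "a \<in> centre R"
  shows "\<exists>f\<in>I0_limits P. a = scal f"
proof -
  have aR: "a \<in> carrier R" and comm: "\<And>b. b \<in> carrier R \<Longrightarrow> a \<otimes>\<^bsub>R\<^esub> b = b \<otimes>\<^bsub>R\<^esub> a"
    using assms by (auto simp: centre_def)
  obtain F where F: "F \<in> S0_limits P" "a = sec F" using aR by (rule sec_cases)
  have "F z ** A = A ** F z" if z: "z \<in> P" for z A
  proof -
    obtain H where H: "H \<in> G0" "H z = A" using G0_value[OF P_generating[OF z]] by blast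
    have HP: "H \<in> S0_limits P" by (intro S0_limits_S0 S0_G0 H)
    have "sec (\<lambda>z. F z ** H z) = sec (\<lambda>z. H z ** F z)"
      using comm[OF sec_closed[OF HP]] by (simp add: F sec_mult HP)
    then show ?thesis
      using sec_inject[OF S0_limits_mult[OF compact_P F(1) HP] S0_limits_mult[OF compact_P HP F(1)] _ z] H(2) by simp
  qed
  then have eq: "F z = cscale (1 / of_nat CARD('n) * trace (F z)) (mat 1)" if "z \<in> P" for z
    using commuting_scalar[OF that, of "F z"] that by simp
  have f: "(\<lambda>z. 1 / of_nat CARD('n) * trace (F z)) \<in> I0_limits P"
    by (intro I0_limits_mult[OF compact_P] I0_limits_trace F I0_limits_I0 I0_const)
  have "a = scal (\<lambda>z. 1 / of_nat CARD('n) * trace (F z))"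
    unfolding scal_def F(2) by (intro sec_eqI F S0_limits_scalar[OF f]) (rule eq)
  then show ?thesis using f by blast
qed

lemma I_to_S_scal: "I_to_S D P f = scal (\<lambda>z. f (\<pi>0 z))"
  by (simp add: I_to_S_def scal_def sec_def)

lemma scal_cong:
  "f \<in> I0_limits P \<Longrightarrow> (\<And>z. z \<in> P \<Longrightarrow> g z = f z) \<Longrightarrow> scal g = scal f"
  unfolding scal_def using I0_limits_cong[of f P g] by (intro sec_eqI S0_limits_scalar) auto

lemma scal_ops:
  assumes "f \<in> I0_limits P" "g \<in> I0_limits P"
  shows "scal f \<otimes>\<^bsub>R\<^esub> scal g = scal (\<lambda>z. f z * g z)" "scal f \<oplus>\<^bsub>R\<^esub> scal g = scal (\<lambda>z. f z + g z)"
    "c \<odot>\<^bsub>R\<^esub> scal f = scal (\<lambda>z. c * f z)"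
  using assms unfolding scal_def
  by (simp_all add: sec_ops S0_limits_scalar cscale_simps cscale_left_commute)

theorem I_to_S_iso: "I_to_S D P \<in> alg_iso (I_alg D) (centre_alg R)"
proof -
  have fI: "(\<lambda>z. f (\<pi>0 z)) \<in> I0_limits P" if "f \<in> I_carrier D" for f using that I_carrier_iff by blast
  have clos: "\<pi>0 z \<in> clos D" if "z \<in> P" for z using that \<pi>0_image by blast
  have mult: "I_to_S D P (\<lambda>u\<in>clos D. f u * g u) = I_to_S D P f \<otimes>\<^bsub>R\<^esub> I_to_S D P g"
    and add: "I_to_S D P (\<lambda>u\<in>clos D. f u + g u) = I_to_S D P f \<oplus>\<^bsub>R\<^esub> I_to_S D P g"
    if f: "f \<in> I_carrier D" and g: "g \<in> I_carrier D" for f g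
    unfolding I_to_S_scal scal_ops[OF fI[OF f] fI[OF g]]
    by (rule scal_cong, intro I0_limits_mult[OF compact_P] I0_limits_add fI f g, simp add: clos)+
  have smult: "I_to_S D P (\<lambda>u\<in>clos D. c * f u) = c \<odot>\<^bsub>R\<^esub> I_to_S D P f" if f: "f \<in> I_carrier D" for c f
    unfolding I_to_S_scal scal_ops[OF fI[OF f] fI[OF f]]
    by (rule scal_cong, intro I0_limits_mult[OF compact_P] fI f I0_limits_I0 I0_const, simp add: clos)
  have one: "I_to_S D P (\<lambda>u\<in>clos D. 1) = \<one>\<^bsub>R\<^esub>"
  proof -
    have "I_to_S D P (\<lambda>u\<in>clos D. 1) = scal (\<lambda>z. 1)"
      unfolding I_to_S_scal by (rule scal_cong) (auto intro: I0_limits_I0 I0_const simp: clos)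
    then show ?thesis by (simp add: scal_def S_alg_simps cscale_simps)
  qed
  have "bij_betw (I_to_S D P) (I_carrier D) (centre R)"
    unfolding bij_betw_def
  proof
    show "inj_on (I_to_S D P) (I_carrier D)"
    proof (rule inj_onI)
      fix f g assume f: "f \<in> I_carrier D" and g: "g \<in> I_carrier D" and eq: "I_to_S D P f = I_to_S D P g"
      have "f (\<pi>0 z) = g (\<pi>0 z)" if z: "z \<in> P" for z
      proof -
        have "cscale (f (\<pi>0 z)) (mat 1) = cscale (g (\<pi>0 z)) (mat 1 :: complex^'n^'n)"
          using sec_inject[OF S0_limits_scalar[OF fI[OF f]] S0_limits_scalar[OF fI[OF g]] _ z] eq
          unfolding I_to_S_scal scal_def by blast
        then have "cscale (f (\<pi>0 z)) (mat 1) $ i $ i = cscale (g (\<pi>0 z)) (mat 1 :: complex^'n^'n) $ i $ i" for i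
          by simp
        then show ?thesis by (simp add: mat_def)
      qed
      then have "\<And>u. u \<in> clos D \<Longrightarrow> f u = g u" unfolding \<pi>0_image[symmetric] by blast
      then show "f = g" using f g unfolding I_carrier_iff by (blast intro: extensionalityI)
    qed
    show "I_to_S D P ` I_carrier D = centre R"
    proof (intro subset_antisym subsetI)
      fix a assume "a \<in> I_to_S D P ` I_carrier D"
      then obtain f where f: "f \<in> I_carrier D" "a = scal (\<lambda>z. f (\<pi>0 z))" unfolding I_to_S_scal by blast
      show "a \<in> centre R" unfolding f(2) by (rule scal_centre[OF fI[OF f(1)]])
    next
      fix a assume "a \<in> centre R"
      then obtain f where f: "f \<in> I0_limits P" "a = scal f" using centre_scal by blast
      obtain g where g: "g \<in> I_carrier D" "\<forall>z\<in>P. g (\<pi>0 z) = f z" using I0_limits_descend[OF f(1)] by blast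
      have "a = I_to_S D P g" unfolding I_to_S_scal f(2) by (rule scal_cong[OF f(1), symmetric]) (use g(2) in blast)
      then show "a \<in> I_to_S D P ` I_carrier D" using g(1) by blast
    qed
  qed
  moreover from this have "I_to_S D P f \<in> centre R" if "f \<in> I_carrier D" for f
    using that by (auto simp: bij_betw_def)
  ultimately show ?thesis
    using mult add smult one
    by (auto simp: alg_iso_def alg_hom_def ring_hom_def I_alg_def centre_alg_def)
qed

end

theorem theorem1p9:
  fixes D :: "('n::finite, 'd::finite) qpoint set"
    and P :: "('n, 'd) tuple set"
  assumes "CARD('d) \<ge> 2" and "CARD('n) \<ge> 2"
    and "domain_in_Q0 D"
    and "compactin Qtop (clos D)" and "clos D \<subseteq> Q0"
    and "reduction P (clos D)"
    and "I0_convex (clos D)"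
  shows "azumaya_rank_sq TYPE('n) (S_alg D P) \<and>
         I_to_S D P \<in> alg_iso (I_alg D) (centre_alg (S_alg D P))"
proof -
  have "D \<noteq> {}" "D \<subseteq> topspace Qtop"
    using assms(3) connectedin_subset_topspace by (auto simp: domain_in_Q0_def)
  then interpret reduced_domain D P
    using assms by unfold_locales
  show ?thesis
    using azumaya_R quotient_iso I_to_S_iso by (simp add: azumaya_rank_sq_def)
qed

end
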